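(* Let $p\in[1,\infty)$. For each $n\in\mathbb N$ let $\mathbf X_n=(X_1^{(n)},\dots,X_n^{(n)})$ be a random vector that is either uniformly distributed over $\mathbb B_p^n$, or distributed according to the cone probability measure $\mu_p$ on $\mathbb S_p^{n-1}$, or distributed according to the surface probability measure $\sigma_p$ on $\mathbb S_p^{n-1}$, and let $$\mathcal R_n:=\frac{\big(\prod_{i=1}^n|X_i^{(n)}|\big)^{1/n}}{\big(\frac1n\sum_{i=1}^n|X_i^{(n)}|^p\big)^{1/p}}.$$ Let $\mathcal J_p:\mathbb R\to[0,+\infty]$ be given for $\theta\in(0,1)$ by $$\mathcal J_p(\theta):=[pG_p(\theta)-1]\log(\theta)+G_p(\theta)\big[\log\big(G_p(\theta)\big)-1\big]-\log\Gamma\big(G_p(\theta)\big)+\frac1p+\frac1p\log(p)+\log\Gamma\Big(\frac1p\Big),$$ and by $\mathcal J_p(\theta):=+\infty$ for $\theta\in\mathbb R\setminus(0,1)$. Then for all Borel measurable sets $A\subseteq\mathbb R$, $$-\inf_{\theta\in A^\circ}\mathcal J_p(\theta)\le\liminf_{n\to\infty}\frac1n\log\mathbb P[\mathcal R_n\in A]\le\limsup_{n\to\infty}\frac1n\log\mathbb P[\mathcal R_n\in A]\le-\inf_{\theta\in\overline A}\mathcal J_p(\theta),$$ where $A^\circ$ and $\overline A$ denote the interior and closure of $A$, respectively.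
   Context: For $p\in[1,\infty)$ and $x=(x_1,\dots,x_n)\in\mathbb R^n$ let $\|x\|_p=(\sum_{i=1}^n|x_i|^p)^{1/p}$, $\mathbb B_p^n=\{x\in\mathbb R^n:\|x\|_p\le1\}$ and $\mathbb S_p^{n-1}=\{x\in\mathbb R^n:\|x\|_p=1\}$. The uniform distribution on $\mathbb B_p^n$ is normalized Lebesgue measure. The cone probability measure $\mu_p$ on $\mathbb S_p^{n-1}$ is defined for Borel $A\subseteq\mathbb S_p^{n-1}$ by $\mu_p(A)=|\{rx:x\in A,\ r\in[0,1]\}|/|\mathbb B_p^n|$, where $|\cdot|$ is $n$-dimensional Lebesgue measure. The surface probability measure $\sigma_p$ on $\mathbb S_p^{n-1}$ is the $(n-1)$-dimensional Hausdorff measure on $\mathbb S_p^{n-1}$, normalized to be a probability measure. $\Gamma$ is the gamma function and $\psi(x)=\Gamma'(x)/\Gamma(x)$, $x>0$, is the digamma function. The function $H(x):=\psi(x)-\log(x)$ is an increasing bijection from $(0,\infty)$ onto $(-\infty,0)$, and $G_p(\theta):=H^{-1}(p\log(\theta))$ for $\theta\in(0,1)$. The ratio $\mathcal R_n$ is defined almost surely (its denominator vanishes only on the null event $\mathbf X_n=0$). Conventions: $\inf\emptyset=+\infty$, $\log 0=-\infty$. *)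

theory Defs
  imports "HOL-Probability.Probability"
begin

(* Since the dimension varies inside the statement, R^n is the space of extensional functions on
   {1..n}, with the product Borel sigma-algebra and n-dimensional Lebesgue measure. *)
definition Rn :: "nat \<Rightarrow> (nat \<Rightarrow> real) measure" where
  "Rn n = (\<Pi>\<^sub>M i\<in>{1..n}. lborel)"

definition lp_norm :: "real \<Rightarrow> nat \<Rightarrow> (nat \<Rightarrow> real) \<Rightarrow> real" where
  "lp_norm p n x = (\<Sum>i\<in>{1..n}. \<bar>x i\<bar> powr p) powr (1 / p)"

definition lp_ball :: "real \<Rightarrow> nat \<Rightarrow> (nat \<Rightarrow> real) set" where
  "lp_ball p n = {x \<in> space (Rn n). lp_norm p n x \<le> 1}"

definition lp_sphere :: "real \<Rightarrow> nat \<Rightarrow> (nat \<Rightarrow> real) set" where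
  "lp_sphere p n = {x \<in> space (Rn n). lp_norm p n x = 1}"

definition euclid_dist :: "nat \<Rightarrow> (nat \<Rightarrow> real) \<Rightarrow> (nat \<Rightarrow> real) \<Rightarrow> real" where
  "euclid_dist n x y = L2_set (\<lambda>i. x i - y i) {1..n}"

definition euclid_diam :: "nat \<Rightarrow> (nat \<Rightarrow> real) set \<Rightarrow> ennreal" where
  "euclid_diam n U = (SUP x\<in>U. SUP y\<in>U. ennreal (euclid_dist n x y))"

(* The empty set has to be treated separately because 0 ^ 0 = 1; with this convention the
   0-dimensional Hausdorff measure is counting measure. *)
definition hausdorff_weight :: "nat \<Rightarrow> nat \<Rightarrow> (nat \<Rightarrow> real) set \<Rightarrow> ennreal" where
  "hausdorff_weight n k U = (if U = {} then 0 else euclid_diam n U ^ k)"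

definition hausdorff_pre :: "nat \<Rightarrow> nat \<Rightarrow> real \<Rightarrow> (nat \<Rightarrow> real) set \<Rightarrow> ennreal" where
  "hausdorff_pre n k \<delta> A =
     (INF U \<in> {U :: nat \<Rightarrow> (nat \<Rightarrow> real) set. A \<subseteq> (\<Union>j. U j) \<and>
               (\<forall>j. U j \<subseteq> space (Rn n) \<and> euclid_diam n (U j) \<le> ennreal \<delta>)}.
        \<Sum>j. hausdorff_weight n k (U j))"

(* k-dimensional Hausdorff (outer) measure on R^n, without the customary dimensional constant,
   which cancels in the normalization of the surface measure below. *)
definition hausdorff :: "nat \<Rightarrow> nat \<Rightarrow> (nat \<Rightarrow> real) set \<Rightarrow> ennreal" where
  "hausdorff n k A = (SUP \<delta>\<in>{0<..}. hausdorff_pre n k \<delta> A)"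

definition uniform_lp_ball :: "real \<Rightarrow> nat \<Rightarrow> (nat \<Rightarrow> real) measure" where
  "uniform_lp_ball p n = uniform_measure (Rn n) (lp_ball p n)"

(* The cone and the surface measure live on the sphere; here they are Borel measures on R^n
   (n \<ge> 1) concentrated on it, the mass of A being that of its intersection with the sphere. *)
definition cone_measure :: "real \<Rightarrow> nat \<Rightarrow> (nat \<Rightarrow> real) measure" where
  "cone_measure p n = measure_of (space (Rn n)) (sets (Rn n))
     (\<lambda>A. emeasure (Rn n)
            {(\<lambda>i\<in>{1..n}. r * x i) | r x. x \<in> A \<inter> lp_sphere p n \<and> r \<in> {0..1}}
          / emeasure (Rn n) (lp_ball p n))"

definition surface_measure :: "real \<Rightarrow> nat \<Rightarrow> (nat \<Rightarrow> real) measure" where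
  "surface_measure p n = measure_of (space (Rn n)) (sets (Rn n))
     (\<lambda>A. hausdorff n (n - 1) (A \<inter> lp_sphere p n) / hausdorff n (n - 1) (lp_sphere p n))"

definition mean_ratio :: "real \<Rightarrow> nat \<Rightarrow> (nat \<Rightarrow> real) \<Rightarrow> real" where
  "mean_ratio p n x =
     (\<Prod>i\<in>{1..n}. \<bar>x i\<bar>) powr (1 / real n)
       / ((1 / real n) * (\<Sum>i\<in>{1..n}. \<bar>x i\<bar> powr p)) powr (1 / p)"

definition H_fun :: "real \<Rightarrow> real" where
  "H_fun x = Digamma x - ln x"

definition G_fun :: "real \<Rightarrow> real \<Rightarrow> real" where
  "G_fun p \<theta> = the_inv_into {0<..} H_fun (p * ln \<theta>)"

definition rate_fun :: "real \<Rightarrow> real \<Rightarrow> ereal" where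
  "rate_fun p \<theta> =
     (if \<theta> \<in> {0<..<1} then
        ereal ((p * G_fun p \<theta> - 1) * ln \<theta> + G_fun p \<theta> * (ln (G_fun p \<theta>) - 1)
               - ln (Gamma (G_fun p \<theta>)) + 1 / p + 1 / p * ln p + ln (Gamma (1 / p)))
      else \<infinity>)"

(* Logarithm of a nonnegative real with log 0 = -\<infinity>. *)
definition elog :: "real \<Rightarrow> ereal" where
  "elog x = (if x \<le> 0 then -\<infinity> else ereal (ln x))"

end

(*
The ratio is invariant under scaling. For the uniform distribution on the ball its law is therefore
that of the cone measure, and weighting Lebesgue measure with prod |x_i|^(p a - 1), the tilt of
Lebesgue measure by a power of the ratio, gives measures whose total mass on the ball is a quotient
of gamma functions, by the layer cake formula for exp (- sum |x_i|^p). With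
Q x = ln (Gamma x) - x ln x + x, Stirling's formula turns this into the limiting cumulant generating
function Q a - Q (1/p), and Q' = H; Chernoff bounds and tilting give the two estimates.

The surface measure is compared with the cone measure up to a factor polynomial in n. By an argument
of Christensen, two measures are comparable as soon as each gives all small balls around points of
the sphere (off the coordinate hyperplanes) comparable mass. Two small patches of the sphere
are matched by a slightly contracting similarity that carries tangent hyperplane to tangent
hyperplane, followed by radial projection; this map is nearly isometric, which compares Hausdorff
measures, and its action on thin shells compares cone volumes. Since a measure obtained from
measure_of is the zero measure unless the given set function is a measure, the hypothesis that the
law of X_n is a probability measure already supplies countable additivity of the Hausdorff measure
and finiteness and positivity of its value on the sphere.
*)
theory Submission
  imports Defs "HOL-Real_Asymp.Real_Asymp"
begin

section \<open>The function \<open>H\<close> and the gamma function\<close>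

text \<open>The density of one power weight against another is a power of \<open>prod |x_i|\<close>,
  hence a power of the ratio times a power of the norm. On the shell of relative thickness
  \<open>1 / n\<close> that power of the norm stays between constants, and by homogeneity the shell
  keeps a fixed share of every set described by the ratio; so tilting works on the ball itself, for
  both tails. The best tilt for \<theta> is \<open>b = G_fun p \<theta>\<close>, the critical point
  of the Chernoff exponent; for \<theta> \<ge> 1 the exponent is unbounded, since
  \<open>Q_fun\<close> tends to minus infinity.

  The obstacle in the surface case is that the norm need not be differentiable on the coordinate
  hyperplanes (p = 1), so the local estimates are made where every coordinate exceeds \<delta> in
  absolute value, below a radius depending on \<delta>. Their constants depend on n alone. The
  radius disappears in the limit of small balls, and \<delta> can then tend to zero once the
  hyperplane sections are known to be null.\<close>

definition Q_fun :: "real \<Rightarrow> real" where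
  "Q_fun x = ln (Gamma x) - x * ln x + x"

lemma Gamma_plus1_pos: "x > 0 \<Longrightarrow> Gamma (x + 1) = x * Gamma (x :: real)"
  by (intro Gamma_plus1) (auto elim: nonpos_Ints_cases)

lemma Q_fun_has_derivative:
  assumes "x > 0"
  shows "(Q_fun has_field_derivative H_fun x) (at x)"
proof -
  have "((\<lambda>y. ln_Gamma y - y * ln y + y) has_field_derivative H_fun x) (at x)"
    unfolding H_fun_def by (rule derivative_eq_intros refl | use assms in simp)+
  moreover have "eventually (\<lambda>y. y > 0) (nhds x)"
    using assms eventually_nhds_in_open[of "{0<..}" x] by simp
  then have "eventually (\<lambda>y. Q_fun y = ln_Gamma y - y * ln y + y) (nhds x)"
    by eventually_elim (simp add: Q_fun_def ln_Gamma_real_pos)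
  ultimately show ?thesis
    using DERIV_cong_ev[OF refl, of Q_fun "\<lambda>y. ln_Gamma y - y * ln y + y"] by blast
qed

text \<open>Over [x, x + 1] the function \<open>ln_Gamma\<close> grows by exactly
  \<open>ln x\<close>, so \<open>Digamma\<close> takes the value \<open>ln x\<close> at some point
  between; its monotonicity gives both bounds.\<close>

lemma Digamma_bounds:
  fixes x :: real
  assumes "x > 0"
  shows "Digamma x \<le> ln x" "ln x \<le> Digamma (x + 1)"
proof -
  have "\<exists>z. x < z \<and> z < x + 1 \<and> ln_Gamma (x + 1) - ln_Gamma x = (x + 1 - x) * Digamma z"
    by (rule MVT2) (use assms in \<open>auto intro!: derivative_eq_intros\<close>)
  then obtain z where z: "x < z" "z < x + 1" "ln_Gamma (x + 1) - ln_Gamma x = Digamma z"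
    by auto
  have "Gamma (x + 1) = x * Gamma x"
    using assms by (rule Gamma_plus1_pos)
  then have "ln_Gamma (x + 1) - ln_Gamma x = ln x"
    using assms by (simp add: ln_Gamma_real_pos ln_mult Gamma_real_pos less_imp_neq[THEN not_sym])
  then show "Digamma x \<le> ln x" "ln x \<le> Digamma (x + 1)"
    using z assms Digamma_real_mono[of x z] Digamma_real_mono[of z "x + 1"] by auto
qed

lemma H_fun_le_0: "x > 0 \<Longrightarrow> H_fun x \<le> 0"
  using Digamma_bounds(1) by (simp add: H_fun_def)

lemma H_fun_ge: "x > 0 \<Longrightarrow> H_fun x \<ge> - 1 / x"
  using Digamma_bounds(2)[of x] Digamma_plus1[of x] by (simp add: H_fun_def)

lemma H_fun_plus1: "x > 0 \<Longrightarrow> H_fun (x + 1) - H_fun x = 1 / x - (ln (x + 1) - ln x)"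
  using Digamma_plus1[of x] by (simp add: H_fun_def)

lemma H_fun_at_top: "(H_fun \<longlongrightarrow> 0) at_top"
proof (rule tendsto_sandwich)
  show "eventually (\<lambda>x. - 1 / x \<le> H_fun x) at_top" "eventually (\<lambda>x. H_fun x \<le> 0) at_top"
    using eventually_gt_at_top[of "0 :: real"]
    by (eventually_elim, use H_fun_ge H_fun_le_0 in auto)+
  show "((\<lambda>x::real. - 1 / x) \<longlongrightarrow> 0) at_top" by real_asymp
qed simp

text \<open>As \<open>H_fun\<close> vanishes at infinity, \<open>- H_fun x\<close> is the sum of
  \<open>h (x + k)\<close> over k \<ge> 0, where \<open>h\<close> is the increment of
  \<open>H_fun\<close> over a unit step. Since \<open>h\<close> is strictly decreasing, these sums
  are strictly ordered.\<close>

lemma H_fun_strict_mono: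
  assumes "0 < x" "x < y"
  shows "H_fun x < H_fun y"
proof -
  define h where "h = (\<lambda>x::real. 1 / x - (ln (x + 1) - ln x))"
  have h_less: "h b < h a" if "0 < a" "a < b" for a b
  proof (rule DERIV_neg_imp_decreasing[OF that(2)])
    fix z assume z: "a \<le> z" "z \<le> b"
    have "(h has_field_derivative (- 1 / z\<^sup>2 - (1 / (z + 1) - 1 / z))) (at z)"
      unfolding h_def using z that
      by (auto intro!: derivative_eq_intros simp: power2_eq_square)
    moreover have "- 1 / z\<^sup>2 - (1 / (z + 1) - 1 / z) < 0"
      using z that by (simp add: divide_simps power2_eq_square)
    ultimately show "\<exists>d. (h has_field_derivative d) (at z) \<and> d < 0" by blast
  qed
  \<comment> \<open>Of the differences of summands only the first is kept, the later ones being
    positive; it survives the limit and makes the inequality strict.\<close>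
  have step: "H_fun y - H_fun x \<ge> h x - h y + (H_fun (y + real (Suc n)) - H_fun (x + real (Suc n)))" for n
  proof (induction n)
    case 0
    show ?case using H_fun_plus1[of x] H_fun_plus1[of y] assms by (simp add: h_def)
  next
    case (Suc n)
    have "h (y + Suc n) < h (x + Suc n)" using assms by (intro h_less) auto
    then show ?case
      using Suc H_fun_plus1[of "x + Suc n"] H_fun_plus1[of "y + Suc n"] assms
      by (simp add: h_def add_ac)
  qed
  have "(\<lambda>n. h x - h y + (H_fun (y + real (Suc n)) - H_fun (x + real (Suc n)))) \<longlonglongrightarrow> h x - h y + (0 - 0)"
    by (intro tendsto_intros filterlim_compose[OF H_fun_at_top]) real_asymp+
  then have "h x - h y + (0 - 0) \<le> H_fun y - H_fun x"
    using step by (intro tendsto_le[OF _ tendsto_const]) auto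
  moreover have "h y < h x" using assms by (rule h_less)
  ultimately show ?thesis by simp
qed

text \<open>The pole \<open>1 / x\<close> in the recursion of \<open>Digamma\<close> outweighs the
  logarithm.\<close>

lemma H_fun_at_0: "filterlim H_fun at_bot (at_right 0)"
proof (rule filterlim_at_bot_mono)
  show "filterlim (\<lambda>x::real. Digamma 2 - 1 / x - ln x) at_bot (at_right 0)"
    by real_asymp
  show "eventually (\<lambda>x. H_fun x \<le> Digamma 2 - 1 / x - ln x) (at_right 0)"
    using eventually_at_right_less[of 0] eventually_at_right_real[of 0 1, simplified]
  proof eventually_elim
    case (elim x)
    then show ?case
      using Digamma_plus1[of x] Digamma_real_mono[of "x + 1" 2] by (simp add: H_fun_def)
  qed
qed

lemma H_fun_neg: "x > 0 \<Longrightarrow> H_fun x < 0"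
  using H_fun_strict_mono[of x "x + 1"] H_fun_le_0[of "x + 1"] by simp

lemma continuous_on_H_fun: "continuous_on {0<..} H_fun"
  unfolding H_fun_def by (intro continuous_intros continuous_on_Polygamma)
    (auto elim: nonpos_Ints_cases)

text \<open>\<open>G_fun\<close> is built with \<open>the_inv_into\<close>, which inverts only an
  injective function and only on its image; hence both injectivity and the exact range.\<close>

lemma H_fun_bij: "bij_betw H_fun {0<..} {..<0}"
  unfolding bij_betw_def
proof
  show "inj_on H_fun {0<..}"
    by (rule inj_onI) (metis H_fun_strict_mono greaterThan_iff less_irrefl linorder_neqE_linordered_idom)
  show "H_fun ` {0<..} = {..<0}"
  proof (intro equalityI subsetI)
    fix t :: real assume t: "t \<in> {..<0}"
    have "eventually (\<lambda>x. H_fun x < t \<and> 0 < x) (at_right 0)"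
      using H_fun_at_0 eventually_at_right_less[of 0]
      by (intro eventually_conj) (auto simp: filterlim_at_bot_dense)
    then obtain a where a: "H_fun a < t" "0 < a"
      using eventually_happens'[OF trivial_limit_at_right_real] by blast
    have "eventually (\<lambda>x. t < H_fun x \<and> a < x) at_top"
      using order_tendstoD(1)[OF H_fun_at_top, of t] t
      by (intro eventually_conj eventually_gt_at_top) auto
    then obtain b where b: "t < H_fun b" "a < b"
      using eventually_happens'[OF trivial_limit_at_top_linorder] by blast
    have "\<exists>x\<ge>a. x \<le> b \<and> H_fun x = t"
      using a b by (intro IVT' continuous_on_subset[OF continuous_on_H_fun]) auto
    then show "t \<in> H_fun ` {0<..}" using a by force
  qed (use H_fun_neg in auto)
qed

lemma G_fun_pos: "p > 0 \<Longrightarrow> \<theta> \<in> {0<..<1} \<Longrightarrow> G_fun p \<theta> > 0"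
  and H_G_fun: "p > 0 \<Longrightarrow> \<theta> \<in> {0<..<1} \<Longrightarrow> H_fun (G_fun p \<theta>) = p * ln \<theta>"
proof -
  assume "p > 0" "\<theta> \<in> {0<..<1}"
  then have *: "p * ln \<theta> \<in> H_fun ` {0<..}"
    using H_fun_bij by (auto simp: bij_betw_def mult_pos_neg)
  show "H_fun (G_fun p \<theta>) = p * ln \<theta>"
    unfolding G_fun_def using H_fun_bij * by (intro f_the_inv_into_f) (auto simp: bij_betw_def)
  show "G_fun p \<theta> > 0"
    unfolding G_fun_def using H_fun_bij *
    the_inv_into_into[of H_fun "{0<..}" "p * ln \<theta>" "{0<..}"] by (auto simp: bij_betw_def)
qed

section \<open>Growth of \<open>Q_fun\<close>: a weak form of Stirling's formula\<close>

lemma Q_fun_antimono: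
  assumes "0 < x" "x \<le> y" shows "Q_fun y \<le> Q_fun x"
  using assms(2)
proof (rule DERIV_nonpos_imp_nonincreasing)
  fix z assume "x \<le> z" "z \<le> y"
  then show "\<exists>d. (Q_fun has_field_derivative d) (at z) \<and> d \<le> 0"
    using Q_fun_has_derivative[of z] H_fun_le_0[of z] assms by auto
qed

text \<open>Because \<open>H_fun z\<close> is at least \<open>- 1 / z\<close>, the function
  \<open>Q_fun + ln\<close> is nondecreasing. The true order is \<open>- ln x / 2\<close>; any
  logarithmic bound disappears after division by n.\<close>

lemma Q_fun_lower:
  assumes "1 \<le> x" shows "Q_fun x \<ge> Q_fun 1 - ln x"
proof -
  have "Q_fun 1 + ln 1 \<le> Q_fun x + ln x"
    using assms
  proof (rule DERIV_nonneg_imp_nondecreasing)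
    fix z assume "1 \<le> z" "z \<le> x"
    then show "\<exists>d. ((\<lambda>x. Q_fun x + ln x) has_field_derivative d) (at z) \<and> 0 \<le> d"
      using Q_fun_has_derivative[of z] H_fun_ge[of z] assms
      by (intro exI[of _ "H_fun z + 1 / z"]) (auto intro!: derivative_eq_intros)
  qed
  then show ?thesis by simp
qed

lemma Q_fun_subexp:
  assumes "a > 0" shows "(\<lambda>n. Q_fun (real n * a) / real n) \<longlonglongrightarrow> 0"
proof (rule tendsto_sandwich)
  have ev: "eventually (\<lambda>n. real n * a \<ge> 1) at_top"
    using assms by real_asymp
  show "eventually (\<lambda>n. (Q_fun 1 - ln (real n * a)) / real n \<le> Q_fun (real n * a) / real n) at_top"
    using ev by eventually_elim (intro divide_right_mono Q_fun_lower, auto)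
  show "eventually (\<lambda>n. Q_fun (real n * a) / real n \<le> Q_fun 1 / real n) at_top"
    using ev by eventually_elim (intro divide_right_mono Q_fun_antimono, auto)
  show "(\<lambda>n. (Q_fun 1 - ln (real n * a)) / real n) \<longlonglongrightarrow> 0" "(\<lambda>n. Q_fun 1 / real n) \<longlonglongrightarrow> 0"
    using assms by real_asymp+
qed

text \<open>A Pade bound. At \<open>y = 1 / x\<close> the left side is \<open>1 / (x + 1/2)\<close>,
  exact to second order, and that precision decides the sign of the increments of
  \<open>Q_fun\<close>.\<close>

lemma ln_one_plus_ge:
  fixes y :: real assumes "0 \<le> y" shows "2 * y / (2 + y) \<le> ln (1 + y)"
proof -
  have "ln (1 + 0) - 2 * 0 / (2 + 0) \<le> ln (1 + y) - 2 * y / (2 + y)"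
    using assms
  proof (rule DERIV_nonneg_imp_nondecreasing)
    fix z :: real assume z: "0 \<le> z" "z \<le> y"
    have "((\<lambda>y. ln (1 + y) - 2 * y / (2 + y)) has_field_derivative 1 / (1 + z) - 4 / (2 + z)\<^sup>2) (at z)"
      using z by (auto intro!: derivative_eq_intros simp: power2_eq_square)
    moreover have "4 * (1 + z) \<le> (2 + z)\<^sup>2"
      by (simp add: power2_eq_square algebra_simps)
    then have "4 / (2 + z)\<^sup>2 \<le> 1 / (1 + z)"
      using z by (simp add: divide_simps mult.commute)
    ultimately show "\<exists>d. ((\<lambda>y. ln (1 + y) - 2 * y / (2 + y)) has_field_derivative d) (at z) \<and> 0 \<le> d"
      using z by auto
  qed
  then show ?thesis by simp
qed

text \<open>A unit step changes \<open>Q_fun\<close> by \<open>1 - (x + 1) * L\<close> with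
  \<open>L = ln (x + 1) - ln x\<close>. Split x + 1 as (x + 2/3) + 1/3: the first part times L is at
  least 1, so at most \<open>- L / 3\<close> remains, and this telescopes. Any split point from 1/2
  up to, but excluding, 1 would do; the aim is that \<open>Q_fun\<close> tends to minus
  infinity.\<close>

lemma Q_fun_nat_le: "Q_fun (real (Suc n)) \<le> Q_fun 1 - ln (real (Suc n)) / 3"
proof (induction n)
  case (Suc n)
  define x where "x = real (Suc n)"
  have x: "x > 0" by (simp add: x_def)
  have "Gamma (x + 1) = x * Gamma x"
    using x by (rule Gamma_plus1_pos)
  then have "Q_fun (x + 1) - Q_fun x = ln x + x * ln x - (x + 1) * ln (x + 1) + 1"
    using x by (simp add: Q_fun_def ln_mult Gamma_real_pos less_imp_neq[THEN not_sym])
  also have "\<dots> = 1 - (x + 1) * (ln (x + 1) - ln x)"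
    by (simp add: algebra_simps)
  finally have 1: "Q_fun (x + 1) - Q_fun x = 1 - (x + 1) * (ln (x + 1) - ln x)" .
  have "ln (x + 1) - ln x = ln (1 + 1 / x)"
    using x ln_div[of "x + 1" x] by (simp add: add_divide_distrib add.commute)
  also have "\<dots> \<ge> 2 * (1 / x) / (2 + 1 / x)"
    using x by (intro ln_one_plus_ge) auto
  finally have "(x + 2 / 3) * (2 * (1 / x) / (2 + 1 / x)) \<le> (x + 2 / 3) * (ln (x + 1) - ln x)"
    using x by (intro mult_left_mono) auto
  moreover have "1 \<le> (x + 2 / 3) * (2 * (1 / x) / (2 + 1 / x))"
    using x by (simp add: field_simps)
  ultimately have "1 \<le> (x + 2 / 3) * (ln (x + 1) - ln x)" by linarith
  with 1 Suc show ?case by (simp add: x_def field_simps)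
qed simp

lemma Q_fun_at_top: "\<exists>a\<ge>b. Q_fun a \<le> c"
proof -
  have "eventually (\<lambda>n. Q_fun 1 - ln (real (Suc n)) / 3 \<le> c) at_top"
    by real_asymp
  moreover have "eventually (\<lambda>n. b \<le> real (Suc n)) at_top"
    by real_asymp
  ultimately have "eventually (\<lambda>n. b \<le> real (Suc n) \<and> Q_fun (real (Suc n)) \<le> c) at_top"
    by eventually_elim (use Q_fun_nat_le in \<open>auto intro: order_trans\<close>)
  then show ?thesis
    using eventually_happens'[OF sequentially_bot] by blast
qed

text \<open>The Legendre form of the rate. The map
  \<open>b \<mapsto> (p * b - 1) * ln \<theta> - Q_fun b\<close> has derivative
  \<open>p * ln \<theta> - H_fun b\<close>, so \<open>G_fun p \<theta>\<close> is its critical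
  point, and the rate is its value there minus its value at \<open>1 / p\<close>.\<close>

lemma rate_fun_eq:
  assumes "p > 0" "\<theta> \<in> {0<..<1}"
  shows "rate_fun p \<theta> = ereal ((p * G_fun p \<theta> - 1) * ln \<theta> - Q_fun (G_fun p \<theta>) + Q_fun (1 / p))"
  using assms by (simp add: rate_fun_def Q_fun_def ln_div algebra_simps)

section \<open>Lebesgue measure and power weights on \<open>\<real>\<^sup>n\<close>\<close>

declare One_nat_def [simp del]

interpretation lborel_product: product_sigma_finite "\<lambda>_::nat. lborel :: real measure"
  by standard

lemma space_Rn: "space (Rn n) = extensional {1..n}"
  by (simp add: Rn_def space_PiM PiE_def)

lemma sigma_finite_Rn: "sigma_finite_measure (Rn n)"
  unfolding Rn_def by (rule lborel_product.sigma_finite) simp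

lemma measurable_Rn_component [measurable]: "i \<in> {1..n} \<Longrightarrow> (\<lambda>x. x i) \<in> borel_measurable (Rn n)"
  unfolding Rn_def using measurable_component_singleton[of i "{1..n}" "\<lambda>_. lborel :: real measure"] by simp

lemma measurable_RnI:
  assumes "\<And>i. i \<in> {1..n} \<Longrightarrow> (\<lambda>x. f x i) \<in> borel_measurable M"
    and "\<And>x. x \<in> space M \<Longrightarrow> f x \<in> extensional {1..n}"
  shows "f \<in> M \<rightarrow>\<^sub>M Rn n"
  unfolding Rn_def
  by (rule measurable_PiM_single') (use assms in \<open>auto simp: PiE_def\<close>)

lemma measurable_lp_norm [measurable]: "lp_norm p n \<in> borel_measurable (Rn n)"
  unfolding lp_norm_def by measurable

lemma measurable_mean_ratio [measurable]: "mean_ratio p n \<in> borel_measurable (Rn n)"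
  unfolding mean_ratio_def by measurable

definition affine_Rn :: "nat \<Rightarrow> (nat \<Rightarrow> real) \<Rightarrow> real \<Rightarrow> (nat \<Rightarrow> real) \<Rightarrow> nat \<Rightarrow> real" where
  "affine_Rn n t c z = (\<lambda>i\<in>{1..n}. t i + c * z i)"

lemma measurable_affine_Rn [measurable]: "affine_Rn n t c \<in> Rn n \<rightarrow>\<^sub>M Rn n"
  by (rule measurable_RnI) (auto simp: affine_Rn_def)

text \<open>Both sides agree on boxes, where the one-dimensional change of variables contributes a
  factor \<open>\<bar>c\<bar>\<close> per coordinate, and a product measure is determined by its
  boxes.\<close>

lemma Rn_affine:
  assumes "c \<noteq> 0"
  shows "Rn n = density (distr (Rn n) (Rn n) (affine_Rn n t c)) (\<lambda>_. ennreal (\<bar>c\<bar> ^ n))"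
proof -
  let ?P = "density (distr (Rn n) (Rn n) (affine_Rn n t c)) (\<lambda>_. ennreal (\<bar>c\<bar> ^ n))"
  have "?P = PiM {1..n} (\<lambda>_. lborel)"
  proof (rule lborel_product.PiM_eqI)
    fix A :: "nat \<Rightarrow> real set"
    assume A: "\<And>i. i \<in> {1..n} \<Longrightarrow> A i \<in> sets lborel"
    have box: "Pi\<^sub>E {1..n} A \<in> sets (Rn n)"
      unfolding Rn_def using A by (intro sets_PiM_I_finite) auto
    have pre: "affine_Rn n t c -` Pi\<^sub>E {1..n} A \<inter> space (Rn n) = (\<Pi>\<^sub>E i\<in>{1..n}. (\<lambda>x. t i + c * x) -` A i)"
      by (auto simp: affine_Rn_def space_Rn PiE_def Pi_def extensional_def)
    have meas: "(\<lambda>x. t i + c * x) -` A i \<in> sets lborel" if "i \<in> {1..n}" for i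
      using A[OF that] measurable_sets[of "\<lambda>x. t i + c * x" lborel borel "A i"] by simp
    have "emeasure ?P (Pi\<^sub>E {1..n} A) = ennreal (\<bar>c\<bar> ^ n) * emeasure (Rn n) (\<Pi>\<^sub>E i\<in>{1..n}. (\<lambda>x. t i + c * x) -` A i)"
      using box by (simp add: emeasure_density nn_integral_cmult_indicator emeasure_distr pre)
    also have "\<dots> = (\<Prod>i\<in>{1..n}. ennreal \<bar>c\<bar> * emeasure lborel ((\<lambda>x. t i + c * x) -` A i))"
      unfolding Rn_def using meas
      by (subst lborel_product.emeasure_PiM) (auto simp: prod.distrib ennreal_power)
    also have "\<dots> = (\<Prod>i\<in>{1..n}. emeasure lborel (A i))"
    proof (rule prod.cong[OF refl])
      fix i assume i: "i \<in> {1..n}"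
      have "emeasure lborel (A i) = emeasure (density (distr lborel borel (\<lambda>x. t i + c * x)) (\<lambda>_. ennreal \<bar>c\<bar>)) (A i)"
        using lborel_real_affine[OF assms, of "t i"] by simp
      also have "\<dots> = ennreal \<bar>c\<bar> * emeasure lborel ((\<lambda>x. t i + c * x) -` A i)"
        using A[OF i] by (simp add: emeasure_density nn_integral_cmult_indicator emeasure_distr)
      finally show "ennreal \<bar>c\<bar> * emeasure lborel ((\<lambda>x. t i + c * x) -` A i) = emeasure lborel (A i)" ..
    qed
    finally show "emeasure ?P (Pi\<^sub>E {1..n} A) = (\<Prod>i\<in>{1..n}. emeasure lborel (A i))" .
  qed (auto simp: Rn_def)
  then show ?thesis by (simp add: Rn_def)
qed

lemma nn_integral_Rn_affine:
  assumes [measurable]: "h \<in> borel_measurable (Rn n)" and "c \<noteq> 0"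
  shows "(\<integral>\<^sup>+x. h x \<partial>Rn n) = ennreal (\<bar>c\<bar> ^ n) * (\<integral>\<^sup>+x. h (affine_Rn n t c x) \<partial>Rn n)"
  by (subst Rn_affine[OF assms(2), of n t])
     (simp add: nn_integral_density nn_integral_distr nn_integral_cmult)

lemma emeasure_Rn_affine:
  assumes "A \<in> sets (Rn n)" "c \<noteq> 0"
  shows "emeasure (Rn n) A = ennreal (\<bar>c\<bar> ^ n) * emeasure (Rn n) (affine_Rn n t c -` A \<inter> space (Rn n))"
proof -
  have [measurable]: "A \<in> sets (Rn n)" by fact
  have "emeasure (Rn n) A = (\<integral>\<^sup>+x. indicator A x \<partial>Rn n)" by simp
  also have "\<dots> = ennreal (\<bar>c\<bar> ^ n) * (\<integral>\<^sup>+x. indicator A (affine_Rn n t c x) \<partial>Rn n)"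
    by (rule nn_integral_Rn_affine) (use assms in auto)
  also have "(\<integral>\<^sup>+x. indicator A (affine_Rn n t c x) \<partial>Rn n) =
      (\<integral>\<^sup>+x. indicator (affine_Rn n t c -` A \<inter> space (Rn n)) x \<partial>Rn n)"
    by (rule nn_integral_cong) (auto simp: indicator_def)
  finally show ?thesis by simp
qed

text \<open>Each hyperplane lies in a box with one side of length zero, and zero times infinity is
  zero.\<close>

lemma AE_Rn_component_nonzero: "AE x in Rn n. \<forall>i\<in>{1..n}. x i \<noteq> 0"
proof (subst AE_finite_all)
  show "\<forall>i\<in>{1..n}. AE x in Rn n. x i \<noteq> 0"
  proof
    fix i assume i: "i \<in> {1..n}"
    let ?A = "\<lambda>j. if j = i then {0 :: real} else UNIV"
    have "emeasure (Rn n) (Pi\<^sub>E {1..n} ?A) = (\<Prod>j\<in>{1..n}. emeasure lborel (?A j))"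
      unfolding Rn_def by (intro lborel_product.emeasure_PiM) auto
    also have "\<dots> = 0"
      using i by (intro prod_zero) auto
    finally have "emeasure (Rn n) (Pi\<^sub>E {1..n} ?A) = 0" .
    moreover have "Pi\<^sub>E {1..n} ?A \<in> sets (Rn n)"
      unfolding Rn_def by (intro sets_PiM_I_finite) auto
    moreover have "{x \<in> space (Rn n). \<not> x i \<noteq> 0} \<subseteq> Pi\<^sub>E {1..n} ?A"
      by (auto simp: space_Rn PiE_def Pi_def)
    ultimately show "AE x in Rn n. x i \<noteq> 0"
      by (intro AE_I) auto
  qed
qed simp

text \<open>Write \<open>exp (- F x)\<close> as the integral of \<open>exp (- t)\<close> over
  \<open>t \<ge> F x\<close> and swap the integrals; the level masses \<open>t powr q * m\<close>
  then produce the gamma integral. It serves in dimension one to evaluate an integral from known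
  level masses, and on \<open>Rn n\<close> to find the unknown \<open>m\<close>, which may a priori
  be infinite.\<close>

lemma layer_cake_exp:
  fixes F :: "'a \<Rightarrow> real"
  assumes "sigma_finite_measure M" and [measurable]: "F \<in> borel_measurable M"
    and nonneg: "\<And>x. x \<in> space M \<Longrightarrow> 0 \<le> F x" and "q \<ge> 0"
    and level: "\<And>t. t > 0 \<Longrightarrow> emeasure M {x \<in> space M. F x \<le> t} = ennreal (t powr q) * m"
  shows "(\<integral>\<^sup>+x. ennreal (exp (- F x)) \<partial>M) = ennreal (Gamma (q + 1)) * m"
proof -
  interpret sigma_finite_measure M by fact
  interpret pair_sigma_finite lborel M by standard
  have exp_eq: "ennreal (exp (- F x)) = (\<integral>\<^sup>+t. ennreal (exp (- t)) * indicator {F x..} t \<partial>lborel)" for x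
  proof -
    have "((\<lambda>t::real. exp (- t)) has_integral exp (- F x)) {F x..}"
      using has_integral_exp_minus_to_infinity[of 1 "F x"] by simp
    from nn_integral_has_integral_lebesgue'[OF _ this] show ?thesis by simp
  qed
  have "(\<integral>\<^sup>+x. ennreal (exp (- F x)) \<partial>M) = (\<integral>\<^sup>+x. (\<integral>\<^sup>+t. ennreal (exp (- t)) * indicator {F x..} t \<partial>lborel) \<partial>M)"
    by (simp add: exp_eq)
  also have "\<dots> = (\<integral>\<^sup>+x. (\<integral>\<^sup>+t. ennreal (exp (- t)) * indicator {z \<in> space (lborel \<Otimes>\<^sub>M M). F (snd z) \<le> fst z} (t, x) \<partial>lborel) \<partial>M)"
    by (intro nn_integral_cong) (auto simp: indicator_def space_pair_measure)
  also have "\<dots> = (\<integral>\<^sup>+t. (\<integral>\<^sup>+x. ennreal (exp (- t)) * indicator {z \<in> space (lborel \<Otimes>\<^sub>M M). F (snd z) \<le> fst z} (t, x) \<partial>M) \<partial>lborel)"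
    by (rule Fubini') measurable
  also have "\<dots> = (\<integral>\<^sup>+t. ennreal (indicator {0..} t * t powr q / exp t) * m \<partial>lborel)"
  proof (rule nn_integral_cong_AE)
    \<comment> \<open>The level hypothesis says nothing about t = 0.\<close>
    have "AE t in lborel. t \<noteq> (0::real)"
      by (simp add: AE_lborel_singleton)
    then show "AE t in lborel. (\<integral>\<^sup>+x. ennreal (exp (- t)) * indicator {z \<in> space (lborel \<Otimes>\<^sub>M M). F (snd z) \<le> fst z} (t, x) \<partial>M)
        = ennreal (indicator {0..} t * t powr q / exp t) * m"
    proof eventually_elim
      case (elim t)
      have "(\<integral>\<^sup>+x. ennreal (exp (- t)) * indicator {z \<in> space (lborel \<Otimes>\<^sub>M M). F (snd z) \<le> fst z} (t, x) \<partial>M)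
          = (\<integral>\<^sup>+x. ennreal (exp (- t)) * indicator {x \<in> space M. F x \<le> t} x \<partial>M)"
        by (intro nn_integral_cong) (auto simp: indicator_def space_pair_measure)
      also have "\<dots> = ennreal (exp (- t)) * emeasure M {x \<in> space M. F x \<le> t}"
        by (subst nn_integral_cmult_indicator) auto
      also have "\<dots> = ennreal (indicator {0..} t * t powr q / exp t) * m"
      proof (cases "t > 0")
        case True
        then show ?thesis
          by (simp add: level exp_minus field_simps ennreal_mult' flip: mult.assoc ennreal_mult)
      next
        case False
        then have "{x \<in> space M. F x \<le> t} = {}"
          using nonneg elim by force
        then show ?thesis using False elim by (simp only:) (simp add: indicator_def)
      qed
      finally show ?case .
    qed
  qed
  also have "\<dots> = (\<integral>\<^sup>+t. ennreal (indicator {0..} t * t powr (q + 1 - 1) / exp t) \<partial>lborel) * m"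
    by (subst nn_integral_multc) auto
  also have "\<dots> = ennreal (Gamma (q + 1)) * m"
    using assms(4) by (subst Gamma_conv_nn_integral_real[symmetric]) auto
  finally show ?thesis .
qed

lemma nn_integral_powr_exp:
  assumes "p > 0" "a > 0"
  shows "(\<integral>\<^sup>+x. ennreal (\<bar>x\<bar> powr (p * a - 1) * exp (- (\<bar>x\<bar> powr p))) \<partial>lborel) = ennreal (2 / p * Gamma a)"
proof -
  let ?M = "density lborel (\<lambda>x. ennreal (\<bar>x\<bar> powr (p * a - 1)))"
  have "(\<integral>\<^sup>+x. ennreal (\<bar>x\<bar> powr (p * a - 1) * exp (- (\<bar>x\<bar> powr p))) \<partial>lborel)
      = (\<integral>\<^sup>+x. ennreal (exp (- (\<bar>x\<bar> powr p))) \<partial>?M)"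
    by (subst nn_integral_density) (auto simp: ennreal_mult')
  also have "\<dots> = ennreal (Gamma (a + 1)) * ennreal (2 / (p * a))"
  proof (rule layer_cake_exp)
    show "sigma_finite_measure ?M"
      by (subst sigma_finite_measure.sigma_finite_iff_density_finite[OF sigma_finite_lborel]) auto
    fix t :: real assume t: "t > 0"
    define c where "c = t powr (1 / p)"
    have c: "c > 0" using t by (simp add: c_def)
    have le: "\<bar>x\<bar> powr p \<le> t \<longleftrightarrow> \<bar>x\<bar> \<le> c" for x
    proof -
      have "\<bar>x\<bar> \<le> c \<longleftrightarrow> \<bar>x\<bar> powr p \<le> c powr p"
        using assms c powr_mono2[of p "\<bar>x\<bar>" c] powr_less_mono2[of p c "\<bar>x\<bar>"] by linarith
      then show ?thesis using assms t by (simp add: c_def powr_powr)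
    qed
    have pos: "(\<integral>\<^sup>+x. ennreal (x powr (p * a - 1)) * indicator {0..c} x \<partial>lborel) = ennreal (c powr (p * a) / (p * a))"
      using nn_integral_has_integral_lebesgue'[OF _ has_integral_powr_from_0[of "p * a - 1" c]] assms c by simp
    have "emeasure ?M {x \<in> space ?M. \<bar>x\<bar> powr p \<le> t} = (\<integral>\<^sup>+x. ennreal (\<bar>x\<bar> powr (p * a - 1)) * indicator {x. \<bar>x\<bar> powr p \<le> t} x \<partial>lborel)"
      by (subst emeasure_density) auto
    \<comment> \<open>At x = 0 both indicators are 1, which is harmless because
      \<open>0 powr _ = 0\<close>.\<close>
    also have "\<dots> = (\<integral>\<^sup>+x. ennreal (x powr (p * a - 1)) * indicator {0..c} x + ennreal ((- x) powr (p * a - 1)) * indicator {0..c} (- x) \<partial>lborel)"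
      by (intro nn_integral_cong) (auto simp: le indicator_def)
    also have "\<dots> = (\<integral>\<^sup>+x. ennreal (x powr (p * a - 1)) * indicator {0..c} x \<partial>lborel) + (\<integral>\<^sup>+x. ennreal ((- x) powr (p * a - 1)) * indicator {0..c} (- x) \<partial>lborel)"
      by (rule nn_integral_add) auto
    also have "(\<integral>\<^sup>+x. ennreal ((- x) powr (p * a - 1)) * indicator {0..c} (- x) \<partial>lborel) = (\<integral>\<^sup>+x. ennreal (x powr (p * a - 1)) * indicator {0..c} x \<partial>lborel)"
      by (subst (2) nn_integral_real_affine[where c = "-1" and t = 0]) auto
    finally have "emeasure ?M {x \<in> space ?M. \<bar>x\<bar> powr p \<le> t} = ennreal (2 * (c powr (p * a) / (p * a)))"
      unfolding pos using assms by (subst (asm) ennreal_plus[symmetric]) auto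
    also have "c powr (p * a) = t powr a"
      using assms t by (simp add: c_def powr_powr)
    finally show "emeasure ?M {x \<in> space ?M. \<bar>x\<bar> powr p \<le> t} = ennreal (t powr a) * ennreal (2 / (p * a))"
      using assms by (subst ennreal_mult[symmetric]) (auto simp: mult.commute)
  qed (use assms in auto)
  also have "\<dots> = ennreal (2 / p * Gamma a)"
    using assms by (subst ennreal_mult[symmetric]) (auto simp: Gamma_plus1_pos)
  finally show ?thesis .
qed

section \<open>Homogeneity of the norm, the ratio and the weighted measures\<close>

lemma lp_norm_affine_0:
  assumes "c > 0" "p > 0" shows "lp_norm p n (affine_Rn n (\<lambda>_. 0) c x) = c * lp_norm p n x"
  using assms by (simp add: lp_norm_def affine_Rn_def abs_mult powr_mult powr_powr sum_nonneg
      flip: sum_distrib_left)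

lemma lp_norm_le_iff:
  assumes "p > 0" "t \<ge> 0"
  shows "lp_norm p n x \<le> t \<longleftrightarrow> (\<Sum>i\<in>{1..n}. \<bar>x i\<bar> powr p) \<le> t powr p"
proof -
  define s where "s = (\<Sum>i\<in>{1..n}. \<bar>x i\<bar> powr p)"
  have "s \<ge> 0" by (simp add: s_def sum_nonneg)
  have "s powr (1 / p) \<le> t \<longleftrightarrow> (s powr (1 / p)) powr p \<le> t powr p"
    using assms powr_mono2[of p "s powr (1 / p)" t] powr_less_mono2[of p t "s powr (1 / p)"] by fastforce
  then show ?thesis
    using assms \<open>s \<ge> 0\<close> by (simp add: lp_norm_def s_def powr_powr)
qed

lemma mean_ratio_affine_0:
  assumes "c > 0" "p > 0" "n \<ge> 1"
  shows "mean_ratio p n (affine_Rn n (\<lambda>_. 0) c x) = mean_ratio p n x"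
proof -
  have "(\<Prod>i\<in>{1..n}. \<bar>affine_Rn n (\<lambda>_. 0) c x i\<bar>) powr (1 / real n) = c * (\<Prod>i\<in>{1..n}. \<bar>x i\<bar>) powr (1 / real n)"
    using assms by (simp add: affine_Rn_def abs_mult prod.distrib powr_mult prod_nonneg
        powr_powr flip: powr_realpow)
  moreover have "((1 / real n) * (\<Sum>i\<in>{1..n}. \<bar>affine_Rn n (\<lambda>_. 0) c x i\<bar> powr p)) powr (1 / p)
     = c * ((1 / real n) * (\<Sum>i\<in>{1..n}. \<bar>x i\<bar> powr p)) powr (1 / p)"
  proof -
    have "(1 / real n) * (\<Sum>i\<in>{1..n}. \<bar>affine_Rn n (\<lambda>_. 0) c x i\<bar> powr p)
       = c powr p * ((1 / real n) * (\<Sum>i\<in>{1..n}. \<bar>x i\<bar> powr p))"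
      using assms by (simp add: affine_Rn_def abs_mult powr_mult flip: sum_distrib_left)
    then show ?thesis using assms by (simp only:) (subst powr_mult, auto simp: powr_powr sum_nonneg)
  qed
  ultimately show ?thesis
    using assms by (simp add: mean_ratio_def)
qed

text \<open>The exponent is parametrized so that \<open>a = 1 / p\<close> is Lebesgue measure, the
  measure is homogeneous of degree \<open>p * a * n\<close>, and the gamma functions in its ball
  masses have arguments built from \<open>a\<close> itself.\<close>

definition nu :: "real \<Rightarrow> nat \<Rightarrow> real \<Rightarrow> (nat \<Rightarrow> real) measure" where
  "nu p n a = density (Rn n) (\<lambda>x. ennreal (\<Prod>i\<in>{1..n}. \<bar>x i\<bar> powr (p * a - 1)))"

lemma sets_nu [measurable_cong, simp]: "sets (nu p n a) = sets (Rn n)"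
  and space_nu [simp]: "space (nu p n a) = space (Rn n)"
  by (simp_all add: nu_def)

text \<open>Lebesgue measure contributes degree n and the weight degree
  \<open>(p * a - 1) * n\<close>, while the condition on the ratio is invariant under
  dilation.\<close>

lemma nu_scaling:
  assumes "v > 0" "p > 0" "n \<ge> 1" and [measurable]: "E \<in> sets borel"
  shows "emeasure (nu p n a) {x \<in> space (Rn n). lp_norm p n x \<le> v \<and> mean_ratio p n x \<in> E}
       = ennreal (v powr (p * a * n)) * emeasure (nu p n a) {x \<in> space (Rn n). lp_norm p n x \<le> 1 \<and> mean_ratio p n x \<in> E}"
proof -
  let ?g = "\<lambda>x. ennreal (\<Prod>i\<in>{1..n}. \<bar>x i\<bar> powr (p * a - 1))"
  let ?S = "\<lambda>v. {x \<in> space (Rn n). lp_norm p n x \<le> v \<and> mean_ratio p n x \<in> E}"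
  let ?T = "affine_Rn n (\<lambda>_. 0) v"
  have "emeasure (nu p n a) (?S v) = (\<integral>\<^sup>+x. ?g x * indicator (?S v) x \<partial>Rn n)"
    unfolding nu_def by (rule emeasure_density) measurable
  also have "\<dots> = ennreal (\<bar>v\<bar> ^ n) * (\<integral>\<^sup>+x. ?g (?T x) * indicator (?S v) (?T x) \<partial>Rn n)"
    using assms by (intro nn_integral_Rn_affine) auto
  also have "(\<integral>\<^sup>+x. ?g (?T x) * indicator (?S v) (?T x) \<partial>Rn n)
    = (\<integral>\<^sup>+x. ennreal (v powr ((p * a - 1) * n)) * (?g x * indicator (?S 1) x) \<partial>Rn n)"
  proof (rule nn_integral_cong)
    fix x assume x: "x \<in> space (Rn n)"
    have "?T x \<in> space (Rn n)" by (simp add: space_Rn affine_Rn_def)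
    then have "indicator (?S v) (?T x) = (indicator (?S 1) x :: ennreal)"
      using assms x by (simp add: indicator_def lp_norm_affine_0 mean_ratio_affine_0)
    moreover have "(\<Prod>i\<in>{1..n}. \<bar>?T x i\<bar> powr (p * a - 1)) = v powr ((p * a - 1) * n) * (\<Prod>i\<in>{1..n}. \<bar>x i\<bar> powr (p * a - 1))"
      using assms by (simp add: affine_Rn_def abs_mult powr_mult prod.distrib powr_powr flip: powr_realpow)
    ultimately show "?g (?T x) * indicator (?S v) (?T x) = ennreal (v powr ((p * a - 1) * n)) * (?g x * indicator (?S 1) x)"
      by (simp add: ennreal_mult' prod_nonneg mult.assoc)
  qed
  also have "\<dots> = ennreal (v powr ((p * a - 1) * n)) * emeasure (nu p n a) (?S 1)"
    unfolding nu_def by (subst nn_integral_cmult, measurable, subst emeasure_density, measurable)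
  also have "ennreal (\<bar>v\<bar> ^ n) * (ennreal (v powr ((p * a - 1) * n)) * emeasure (nu p n a) (?S 1))
    = ennreal (v powr n * v powr ((p * a - 1) * n)) * emeasure (nu p n a) (?S 1)"
    using assms by (simp add: powr_realpow ennreal_mult flip: mult.assoc)
  also have "v powr n * v powr ((p * a - 1) * n) = v powr (p * a * n)"
    by (simp add: algebra_simps flip: powr_add)
  finally show ?thesis .
qed

text \<open>The integral of \<open>exp (- sum |x_i|^p)\<close> is computed in two ways: as a product
  of one-dimensional integrals, and through the level sets, which are dilated balls. Equating the
  results determines the mass of the unit ball.\<close>

lemma emeasure_nu_ball:
  assumes "p > 0" "a > 0" "n \<ge> 1"
  shows "emeasure (nu p n a) (lp_ball p n) = ennreal ((2 / p * Gamma a) ^ n / Gamma (n * a + 1))"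
proof -
  let ?F = "\<lambda>x. \<Sum>i\<in>{1..n}. \<bar>x i\<bar> powr p"
  let ?m = "emeasure (nu p n a) (lp_ball p n)"
  have "(\<integral>\<^sup>+x. ennreal (exp (- ?F x)) \<partial>nu p n a) = ennreal (Gamma (n * a + 1)) * ?m"
  proof (rule layer_cake_exp)
    show "sigma_finite_measure (nu p n a)"
      unfolding nu_def
      by (subst sigma_finite_measure.sigma_finite_iff_density_finite[OF sigma_finite_Rn]) auto
    fix t :: real assume t: "t > 0"
    have "?F x \<le> t \<longleftrightarrow> lp_norm p n x \<le> t powr (1 / p)" for x
      using assms t by (simp add: lp_norm_le_iff powr_powr)
    then have "emeasure (nu p n a) {x \<in> space (nu p n a). ?F x \<le> t}
      = emeasure (nu p n a) {x \<in> space (Rn n). lp_norm p n x \<le> t powr (1 / p) \<and> mean_ratio p n x \<in> UNIV}"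
      by simp
    also have "\<dots> = ennreal ((t powr (1 / p)) powr (p * a * n)) * emeasure (nu p n a) {x \<in> space (Rn n). lp_norm p n x \<le> 1 \<and> mean_ratio p n x \<in> UNIV}"
      using assms t by (intro nu_scaling) auto
    also have "\<dots> = ennreal (t powr (n * a)) * ?m"
      using assms by (simp add: powr_powr lp_ball_def mult_ac)
    finally show "emeasure (nu p n a) {x \<in> space (nu p n a). ?F x \<le> t} = ennreal (t powr (n * a)) * ?m" .
  next
    show "?F \<in> borel_measurable (nu p n a)"
      by (subst measurable_cong_sets[OF sets_nu refl]) measurable
  qed (use assms in \<open>auto intro!: sum_nonneg\<close>)
  moreover have "(\<integral>\<^sup>+x. ennreal (exp (- ?F x)) \<partial>nu p n a) = ennreal ((2 / p * Gamma a) ^ n)"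
  proof -
    have "(\<integral>\<^sup>+x. ennreal (exp (- ?F x)) \<partial>nu p n a)
      = (\<integral>\<^sup>+x. ennreal (\<Prod>i\<in>{1..n}. \<bar>x i\<bar> powr (p * a - 1)) * ennreal (exp (- ?F x)) \<partial>Rn n)"
      unfolding nu_def by (rule nn_integral_density) auto
    also have "\<dots> = (\<integral>\<^sup>+x. (\<Prod>i\<in>{1..n}. ennreal (\<bar>x i\<bar> powr (p * a - 1) * exp (- (\<bar>x i\<bar> powr p)))) \<partial>Rn n)"
      by (intro nn_integral_cong)
         (simp add: exp_sum prod.distrib ennreal_mult flip: sum_negf prod_ennreal)
    also have "\<dots> = (\<Prod>i\<in>{1..n}. ennreal (2 / p * Gamma a))"
      unfolding Rn_def using nn_integral_powr_exp[OF assms(1,2)]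
      by (subst lborel_product.product_nn_integral_prod) auto
    also have "\<dots> = ennreal ((2 / p * Gamma a) ^ n)"
      using assms by (simp add: ennreal_power)
    finally show ?thesis .
  qed
  ultimately have eq: "ennreal (Gamma (n * a + 1)) * ?m = ennreal ((2 / p * Gamma a) ^ n)" by simp
  have G: "Gamma (n * a + 1) > 0" using assms by (intro Gamma_real_pos) (simp add: add_nonneg_pos)
  \<comment> \<open>The mass is not yet known to be finite, so the equation is solved by
    multiplication in \<open>ennreal\<close>.\<close>
  have "?m = ennreal (1 / Gamma (n * a + 1)) * (ennreal (Gamma (n * a + 1)) * ?m)"
    using G by (simp flip: mult.assoc ennreal_mult)
  also have "\<dots> = ennreal ((2 / p * Gamma a) ^ n / Gamma (n * a + 1))"
    unfolding eq using G assms by (simp flip: ennreal_mult)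
  finally show ?thesis .
qed

text \<open>The prefactor compensates the mean \<open>1 / n\<close> inside the ratio: tilting from
  \<open>a\<close> to \<open>b\<close> produces \<open>n powr (- n * (b - a))\<close>, which two
  such prefactors cancel. It also removes the superexponential decay of the ball mass.\<close>

definition ratio_mass :: "real \<Rightarrow> nat \<Rightarrow> real \<Rightarrow> real set \<Rightarrow> real" where
  "ratio_mass p n a E = real n powr (n * a) *
     measure (nu p n a) {x \<in> space (Rn n). lp_norm p n x \<le> 1 \<and> mean_ratio p n x \<in> E}"

lemma nu_ball_finite:
  assumes "p > 0" "a > 0" "n \<ge> 1"
  shows "emeasure (nu p n a) {x \<in> space (Rn n). lp_norm p n x \<le> t \<and> mean_ratio p n x \<in> E} < \<infinity>"
proof -
  have "emeasure (nu p n a) {x \<in> space (Rn n). lp_norm p n x \<le> t \<and> mean_ratio p n x \<in> E}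
      \<le> emeasure (nu p n a) {x \<in> space (Rn n). lp_norm p n x \<le> max t 1 \<and> mean_ratio p n x \<in> UNIV}"
    by (intro emeasure_mono) auto
  also have "\<dots> = ennreal (max t 1 powr (p * a * n)) * emeasure (nu p n a) (lp_ball p n)"
    using assms by (subst nu_scaling) (auto simp: lp_ball_def)
  also have "\<dots> < \<infinity>"
    using assms by (simp add: emeasure_nu_ball ennreal_mult_less_top)
  finally show ?thesis .
qed

lemma ratio_mass_UNIV:
  assumes "p > 0" "a > 0" "n \<ge> 1"
  shows "ratio_mass p n a UNIV = real n powr (n * a) * ((2 / p * Gamma a) ^ n / Gamma (n * a + 1))"
proof -
  have "Gamma (n * a + 1) > 0" using assms by (intro Gamma_real_pos) (simp add: add_nonneg_pos)
  moreover have "measure (nu p n a) (lp_ball p n) = enn2real (ennreal ((2 / p * Gamma a) ^ n / Gamma (n * a + 1)))"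
    using emeasure_nu_ball[OF assms] by (simp add: measure_def)
  ultimately show ?thesis
    using assms by (simp add: ratio_mass_def lp_ball_def)
qed

lemma ratio_mass_UNIV_pos:
  assumes "p > 0" "a > 0" "n \<ge> 1"
  shows "ratio_mass p n a UNIV > 0"
proof -
  have "Gamma (n * a + 1) > 0" using assms by (intro Gamma_real_pos) (simp add: add_nonneg_pos)
  then show ?thesis using assms by (simp add: ratio_mass_UNIV)
qed

text \<open>The prefactor cancels the term \<open>n * a * ln n\<close> of
  \<open>ln (Gamma (n * a + 1))\<close>. What is left is linear in n, up to
  \<open>ln (n * a)\<close> and \<open>Q_fun (n * a)\<close>, both of smaller order. The constant
  \<open>ln (2 / p)\<close> will cancel in quotients.\<close>

lemma ratio_mass_UNIV_asymp:
  assumes "p > 0" "a > 0"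
  shows "(\<lambda>n. ln (ratio_mass p n a UNIV) / n) \<longlonglongrightarrow> ln (2 / p) + Q_fun a"
proof -
  have "(\<lambda>n. ln (2 / p) + Q_fun a - ln (real n * a) / real n - Q_fun (real n * a) / real n)
      \<longlonglongrightarrow> ln (2 / p) + Q_fun a - 0 - 0"
    using assms by (intro tendsto_intros Q_fun_subexp) (real_asymp | simp)+
  moreover have "eventually (\<lambda>n. ln (2 / p) + Q_fun a - ln (real n * a) / real n - Q_fun (real n * a) / real n
      = ln (ratio_mass p n a UNIV) / n) at_top"
    using eventually_ge_at_top[of 1]
  proof eventually_elim
    case (elim n)
    define x where "x = real n * a"
    have x: "x > 0" using elim assms by (simp add: x_def)
    have "ln (ratio_mass p n a UNIV) = ln (real n powr x) + (ln ((2 / p * Gamma a) ^ n) - ln (x * Gamma x))"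
      using elim assms x Gamma_real_pos[OF x] Gamma_real_pos[of a]
      by (simp add: ratio_mass_UNIV Gamma_plus1_pos x_def[symmetric] ln_mult_pos ln_div
          del: Gamma_real_pos ln_powr ln_realpow)
    also have "\<dots> = x * ln n + (n * (ln (2 / p) + ln (Gamma a)) - (ln x + ln (Gamma x)))"
      using elim assms x Gamma_real_pos[OF x] Gamma_real_pos[of a]
        ln_mult_pos[of "2 / p" "Gamma a"]
      by (simp add: ln_powr ln_realpow ln_mult_pos del: Gamma_real_pos)
    also have "ln (Gamma x) = Q_fun x + x * ln x - x"
      by (simp add: Q_fun_def)
    also have "ln (Gamma a) = Q_fun a + a * ln a - a"
      by (simp add: Q_fun_def)
    also have "ln x = ln n + ln a"
      using elim assms by (simp add: x_def ln_mult_pos)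
    finally have "ln (ratio_mass p n a UNIV) = n * (ln (2 / p) + Q_fun a) - (ln n + ln a) - Q_fun x"
      by (simp add: x_def algebra_simps)
    then show ?case
      using elim assms by (simp add: x_def[symmetric] diff_divide_distrib) (simp add: x_def ln_mult_pos)
  qed
  ultimately show ?thesis by (simp add: tendsto_cong)
qed

text \<open>This expresses the density of a tilt through the ratio. The norm remains as a factor to
  the power n, so it has to be kept within distance of order \<open>1 / n\<close> of 1.\<close>

lemma prod_abs_eq_mean_ratio:
  assumes "p > 0" "n \<ge> 1" "lp_norm p n x > 0"
  shows "(\<Prod>i\<in>{1..n}. \<bar>x i\<bar>) = (mean_ratio p n x * lp_norm p n x) powr n * real n powr (- real n / p)"
proof -
  define P where "P = (\<Prod>i\<in>{1..n}. \<bar>x i\<bar>)"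
  define s where "s = (\<Sum>i\<in>{1..n}. \<bar>x i\<bar> powr p)"
  have "P \<ge> 0" "s \<ge> 0" by (auto simp: P_def s_def prod_nonneg sum_nonneg)
  have s: "lp_norm p n x = s powr (1 / p)" by (simp add: lp_norm_def s_def)
  with assms \<open>s \<ge> 0\<close> have "s > 0" by (cases "s = 0") auto
  have "mean_ratio p n x * lp_norm p n x = P powr (1 / n) / ((1 / n) powr (1 / p) * s powr (1 / p)) * s powr (1 / p)"
    unfolding mean_ratio_def s using \<open>s > 0\<close> assms
    by (simp add: P_def s_def[symmetric] powr_mult[symmetric])
  also have "\<dots> = P powr (1 / n) * real n powr (1 / p)"
    using \<open>s > 0\<close> assms by (simp add: powr_divide)
  finally have "mean_ratio p n x * lp_norm p n x = P powr (1 / n) * real n powr (1 / p)" .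
  then have "(mean_ratio p n x * lp_norm p n x) powr n = P * real n powr (n / p)"
    using assms \<open>P \<ge> 0\<close> by (simp add: powr_mult powr_powr)
  then show ?thesis
    using assms by (simp add: P_def flip: powr_add)
qed

text \<open>These bounds single out the shell thickness \<open>1 / n\<close>: the n-th power of
  \<open>1 - 1 / n\<close> stays away from both 0 and 1.\<close>

lemma one_minus_inverse_powr_bounds:
  assumes "n \<ge> 2" "q \<ge> 0"
  shows "exp (- 2 * q) \<le> (1 - 1 / real n) powr (n * q)" "(1 - 1 / real n) powr (n * q) \<le> exp (- q)"
proof -
  let ?x = "1 / real n"
  have powr_eq: "(1 - ?x) powr (n * q) = exp (q * (n * ln (1 - ?x)))"
    using assms by (simp add: powr_def mult_ac)
  have x: "0 \<le> ?x" "?x \<le> 1 / 2" using assms by (auto simp: field_simps)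
  have 1: "- ?x - 2 * ?x\<^sup>2 \<le> ln (1 - ?x)" using x by (rule ln_one_minus_pos_lower_bound)
  have 2: "ln (1 - ?x) \<le> - ?x" using ln_le_minus_one[of "1 - ?x"] x by simp
  \<comment> \<open>The right side equals \<open>- 1 - 2 / n\<close>, whence n \<ge> 2.\<close>
  have "- 2 \<le> real n * (- ?x - 2 * ?x\<^sup>2)" using assms by (simp add: field_simps power2_eq_square)
  also have "\<dots> \<le> n * ln (1 - ?x)" using 1 by (intro mult_left_mono) auto
  finally have "q * (- 2) \<le> q * (n * ln (1 - ?x))" using assms by (intro mult_left_mono) auto
  then show "exp (- 2 * q) \<le> (1 - 1 / real n) powr (n * q)"
    unfolding powr_eq by simp
  have "n * ln (1 - ?x) \<le> n * (- ?x)" using 2 by (intro mult_left_mono) auto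
  also have "\<dots> = - 1" using assms by simp
  finally have "q * (n * ln (1 - ?x)) \<le> q * (- 1)" using assms by (intro mult_left_mono) auto
  then show "(1 - 1 / real n) powr (n * q) \<le> exp (- q)"
    unfolding powr_eq by simp
qed

text \<open>By homogeneity the ball of radius \<open>1 - 1 / n\<close> keeps at most the fraction
  \<open>exp (- (p * a))\<close> of the mass, uniformly in n.\<close>

lemma nu_shell:
  assumes "p > 0" "a > 0" "n \<ge> 2" and [measurable]: "E \<in> sets borel"
  shows "(1 - exp (- (p * a))) * measure (nu p n a) {x \<in> space (Rn n). lp_norm p n x \<le> 1 \<and> mean_ratio p n x \<in> E}
    \<le> measure (nu p n a) {x \<in> space (Rn n). 1 - 1 / real n < lp_norm p n x \<and> lp_norm p n x \<le> 1 \<and> mean_ratio p n x \<in> E}"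
proof -
  let ?c = "1 - 1 / real n"
  let ?S = "\<lambda>t. {x \<in> space (Rn n). lp_norm p n x \<le> t \<and> mean_ratio p n x \<in> E}"
  have c: "?c > 0" using assms by simp
  have fin: "emeasure (nu p n a) (?S t) < \<infinity>" for t using assms by (intro nu_ball_finite) auto
  have "emeasure (nu p n a) (?S ?c) = ennreal (?c powr (p * a * n)) * emeasure (nu p n a) (?S 1)"
    using assms c by (intro nu_scaling) auto
  then have "measure (nu p n a) (?S ?c) = ?c powr (p * a * n) * measure (nu p n a) (?S 1)"
    by (simp add: measure_def enn2real_mult)
  moreover have "?c powr (n * (p * a)) \<le> exp (- (p * a))"
    using assms by (intro one_minus_inverse_powr_bounds) auto
  ultimately have le: "measure (nu p n a) (?S ?c) \<le> exp (- (p * a)) * measure (nu p n a) (?S 1)"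
    by (auto intro!: mult_right_mono simp: mult_ac)
  have "measure (nu p n a) (?S 1 - ?S ?c) = measure (nu p n a) (?S 1) - measure (nu p n a) (?S ?c)"
    using fin[of 1] fin[of ?c] by (intro measure_Diff) (auto intro: order_trans)
  moreover have "?S 1 - ?S ?c = {x \<in> space (Rn n). ?c < lp_norm p n x \<and> lp_norm p n x \<le> 1 \<and> mean_ratio p n x \<in> E}"
    by auto
  ultimately show ?thesis using le by (simp add: algebra_simps)
qed

text \<open>
  On the shell \<open>1 - 1/n < \<parallel>x\<parallel>\<^sub>p \<le> 1\<close> the density of \<open>nu p n b\<close> with respect to \<open>nu p n a\<close> is,
  up to a factor that is bounded in \<open>n\<close>, the \<open>n\<close>-th power of a function of the ratio.
\<close>

lemma ratio_mass_tilt: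
  assumes "p > 0" "a > 0" "b > 0" "\<rho> > 0" and E[measurable]: "E \<in> sets borel"
    and pos: "\<And>\<theta>. \<theta> \<in> E \<Longrightarrow> \<theta> > 0 \<and> \<rho> \<le> \<theta> powr (p * (b - a))"
    and "n \<ge> 2"
  shows "\<rho> powr n * ratio_mass p n a E
      \<le> exp (2 * p * \<bar>b - a\<bar>) / (1 - exp (- (p * a))) * ratio_mass p n b E"
proof -
  let ?c = "1 - 1 / real n"
  let ?S = "\<lambda>t. {x \<in> space (Rn n). lp_norm p n x \<le> t \<and> mean_ratio p n x \<in> E}"
  let ?T = "{x \<in> space (Rn n). ?c < lp_norm p n x \<and> lp_norm p n x \<le> 1 \<and> mean_ratio p n x \<in> E}"
  define g where "g = (\<lambda>a x. \<Prod>i\<in>{1..n}. \<bar>x i\<bar> powr (p * a - 1))"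
  \<comment> \<open>A lower bound for the density of \<open>nu p n b\<close> against
    \<open>nu p n a\<close> on the shell: the three factors come from the norm, from the ratio and
    from the mean \<open>1 / n\<close> inside the ratio.\<close>
  define K where "K = exp (- 2 * p * \<bar>b - a\<bar>) * \<rho> powr n * real n powr (- (n * (b - a)))"
  have c: "0 < ?c" "?c < 1" using assms by auto
  have K: "K > 0" using assms by (simp add: K_def)
  have g_le: "K * g a x \<le> g b x" if x: "x \<in> ?T" for x
  proof -
    let ?f = "lp_norm p n x" and ?R = "mean_ratio p n x"
    from x have "?c < ?f" "?f \<le> 1" by auto
    with c have f: "0 < ?f" "?c \<le> ?f" "?f \<le> 1" by linarith+
    have R: "?R > 0" "\<rho> \<le> ?R powr (p * (b - a))" using pos x by auto
    define P where "P = (\<Prod>i\<in>{1..n}. \<bar>x i\<bar>)"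
    have "P = (?R * ?f) powr n * real n powr (- real n / p)"
      unfolding P_def using assms f by (intro prod_abs_eq_mean_ratio) auto
    then have "P powr (p * (b - a)) = (?R powr (p * (b - a))) powr n * ?f powr (n * (p * (b - a))) * real n powr (- (n * (b - a)))"
      using R f assms by (simp add: powr_mult powr_powr mult_ac)
    also have "\<dots> \<ge> \<rho> powr n * exp (- 2 * p * \<bar>b - a\<bar>) * real n powr (- (n * (b - a)))"
    proof (intro mult_right_mono mult_mono)
      show "\<rho> powr n \<le> (?R powr (p * (b - a))) powr n"
        using R assms by (intro powr_mono2) auto
      \<comment> \<open>The sign of \<open>b - a\<close> is unknown; as the norm is at most 1, the
        exponent with \<open>\<bar>b - a\<bar>\<close> is the worst case.\<close>
      have "exp (- 2 * (p * \<bar>b - a\<bar>)) \<le> ?c powr (n * (p * \<bar>b - a\<bar>))"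
        using assms by (intro one_minus_inverse_powr_bounds) auto
      also have "\<dots> \<le> ?f powr (n * (p * \<bar>b - a\<bar>))"
        using f c assms by (intro powr_mono2) auto
      also have "\<dots> \<le> ?f powr (n * (p * (b - a)))"
        using f assms by (intro powr_mono') (auto intro!: mult_left_mono)
      finally show "exp (- 2 * p * \<bar>b - a\<bar>) \<le> ?f powr (n * (p * (b - a)))" by (simp add: mult_ac)
    qed auto
    finally have "K \<le> P powr (p * (b - a))" by (simp add: K_def mult_ac)
    then have "K * g a x \<le> P powr (p * (b - a)) * g a x"
      by (intro mult_right_mono) (auto simp: g_def prod_nonneg)
    also have "\<dots> = g b x"
      by (simp add: P_def g_def prod_powr_distrib[symmetric] flip: prod.distrib powr_add)
         (simp add: algebra_simps)
    finally show ?thesis .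
  qed
  have fin: "emeasure (nu p n d) (?S 1) < \<infinity>" if "d > 0" for d
    using assms that by (intro nu_ball_finite) auto
  have T_meas: "?T \<in> sets (Rn n)" by measurable
  have em: "emeasure (nu p n d) ?T = (\<integral>\<^sup>+x. ennreal (g d x) * indicator ?T x \<partial>Rn n)" for d
    unfolding nu_def g_def by (rule emeasure_density) measurable
  have "ennreal K * emeasure (nu p n a) ?T = (\<integral>\<^sup>+x. ennreal K * (ennreal (g a x) * indicator ?T x) \<partial>Rn n)"
    unfolding em g_def by (rule nn_integral_cmult[symmetric]) measurable
  also have "\<dots> \<le> emeasure (nu p n b) ?T"
    unfolding em using g_le K
    by (intro nn_integral_mono) (auto simp: indicator_def g_def prod_nonneg simp flip: ennreal_mult intro!: ennreal_leI)
  also have "\<dots> \<le> emeasure (nu p n b) (?S 1)"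
    by (intro emeasure_mono) auto
  finally have "ennreal K * emeasure (nu p n a) ?T \<le> emeasure (nu p n b) (?S 1)" .
  moreover have "emeasure (nu p n a) ?T < \<infinity>"
    using fin[of a] assms by (intro le_less_trans[OF emeasure_mono fin[of a]]) auto
  ultimately have "K * measure (nu p n a) ?T \<le> measure (nu p n b) (?S 1)"
    using K fin[OF assms(3)] enn2real_mono[of "ennreal K * emeasure (nu p n a) ?T" "emeasure (nu p n b) (?S 1)"]
    by (simp add: measure_def enn2real_mult)
  moreover have "K * ((1 - exp (- (p * a))) * measure (nu p n a) (?S 1)) \<le> K * measure (nu p n a) ?T"
    using assms K by (intro mult_left_mono nu_shell) auto
  ultimately have le: "K * ((1 - exp (- (p * a))) * measure (nu p n a) (?S 1)) \<le> measure (nu p n b) (?S 1)"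
    by simp
  have e1: "1 - exp (- (p * a)) > 0" using assms by simp
  have "\<rho> powr n * ratio_mass p n a E = exp (2 * p * \<bar>b - a\<bar>) / (1 - exp (- (p * a))) * real n powr (n * b) *
     (K * ((1 - exp (- (p * a))) * measure (nu p n a) (?S 1)))"
  proof -
    have 1: "exp (2 * p * \<bar>b - a\<bar>) * exp (- 2 * p * \<bar>b - a\<bar>) = 1"
      by (simp flip: exp_add)
    have 2: "real n powr (n * b) * real n powr (- (n * (b - a))) = real n powr (n * a)"
      by (simp add: algebra_simps flip: powr_add)
    have "X / e * A * (Y * r * B * (e * m)) = r * (C * m)"
      if "X * Y = 1" "A * B = C" "e \<noteq> 0" for X Y A B C e r m :: real
    proof -
      have "X / e * A * (Y * r * B * (e * m)) = (X * Y) * (A * B) * r * m"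
        using that(3) by simp
      then show ?thesis by (simp add: that)
    qed
    note this[OF 1 2, symmetric]
    then show ?thesis
      unfolding ratio_mass_def K_def by this (use assms(1,2) in simp)
  qed
  also have "\<dots> \<le> exp (2 * p * \<bar>b - a\<bar>) / (1 - exp (- (p * a))) * real n powr (n * b) * measure (nu p n b) (?S 1)"
    using e1 le by (intro mult_left_mono) auto
  also have "\<dots> = exp (2 * p * \<bar>b - a\<bar>) / (1 - exp (- (p * a))) * ratio_mass p n b E"
    by (simp add: ratio_mass_def)
  finally show ?thesis .
qed

section \<open>Large deviations for the uniform distribution on the ball\<close>

definition ball_prob :: "real \<Rightarrow> nat \<Rightarrow> real set \<Rightarrow> real" where
  "ball_prob p n E = measure (uniform_lp_ball p n) {x \<in> space (Rn n). mean_ratio p n x \<in> E}"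

text \<open>The weight has exponent 0 and differs from 1 only on the null hyperplanes, where
  \<open>0 powr 0 = 0\<close>.\<close>

lemma emeasure_nu_inverse:
  assumes "p > 0" "A \<in> sets (Rn n)"
  shows "emeasure (nu p n (1 / p)) A = emeasure (Rn n) A"
proof -
  have "emeasure (nu p n (1 / p)) A = (\<integral>\<^sup>+x. ennreal (\<Prod>i\<in>{1..n}. \<bar>x i\<bar> powr (p * (1 / p) - 1)) * indicator A x \<partial>Rn n)"
    unfolding nu_def using assms by (intro emeasure_density) auto
  also have "\<dots> = (\<integral>\<^sup>+x. indicator A x \<partial>Rn n)"
    using AE_Rn_component_nonzero[of n]
    by (intro nn_integral_cong_AE) (use assms in \<open>auto elim!: eventually_mono simp: indicator_def\<close>)
  finally show ?thesis using assms by simp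
qed

lemma lp_ball_sets [measurable, simp]: "lp_ball p n \<in> sets (Rn n)"
  unfolding lp_ball_def by measurable

lemma emeasure_lp_ball:
  assumes "p > 0" "n \<ge> 1"
  shows "emeasure (Rn n) (lp_ball p n) \<noteq> 0" "emeasure (Rn n) (lp_ball p n) \<noteq> \<infinity>"
proof -
  have "Gamma (n * (1 / p) + 1) > 0" using assms by (intro Gamma_real_pos) (simp add: add_nonneg_pos)
  then have "(2 / p * Gamma (1 / p)) ^ n / Gamma (n * (1 / p) + 1) > 0"
    using assms Gamma_real_pos[of "1 / p"] by (intro divide_pos_pos zero_less_power mult_pos_pos) auto
  then show "emeasure (Rn n) (lp_ball p n) \<noteq> 0" "emeasure (Rn n) (lp_ball p n) \<noteq> \<infinity>"
    using emeasure_nu_ball[of p "1 / p" n] assms emeasure_nu_inverse[of p "lp_ball p n" n]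
    by (simp_all add: ennreal_eq_0_iff not_le)
qed

lemma prob_space_uniform_lp_ball:
  assumes "p > 0" "n \<ge> 1"
  shows "prob_space (uniform_lp_ball p n)"
  unfolding uniform_lp_ball_def using emeasure_lp_ball[OF assms] by (rule prob_space_uniform_measure)

lemma space_uniform_lp_ball [simp]: "space (uniform_lp_ball p n) = space (Rn n)"
  and sets_uniform_lp_ball [simp, measurable_cong]: "sets (uniform_lp_ball p n) = sets (Rn n)"
  by (simp_all add: uniform_lp_ball_def)

lemma ball_prob_eq:
  assumes "p > 0" "n \<ge> 1" and [measurable]: "E \<in> sets borel"
  shows "ball_prob p n E = ratio_mass p n (1 / p) E / ratio_mass p n (1 / p) UNIV"
proof -
  have "ball_prob p n E = measure (Rn n) (lp_ball p n \<inter> {x \<in> space (Rn n). mean_ratio p n x \<in> E}) / measure (Rn n) (lp_ball p n)"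
    unfolding ball_prob_def uniform_lp_ball_def
    using emeasure_lp_ball[OF assms(1,2)] by (intro measure_uniform_measure) auto
  moreover have "lp_ball p n \<inter> {x \<in> space (Rn n). mean_ratio p n x \<in> E} = {x \<in> space (Rn n). lp_norm p n x \<le> 1 \<and> mean_ratio p n x \<in> E}"
    by (auto simp: lp_ball_def)
  ultimately show ?thesis
    using assms by (simp add: ratio_mass_def measure_def emeasure_nu_inverse lp_ball_def)
qed

lemma AE_mean_ratio_pos:
  assumes "p > 0" "n \<ge> 1"
  shows "AE x in Rn n. mean_ratio p n x > 0"
  using AE_Rn_component_nonzero
proof eventually_elim
  case (elim x)
  then have "(\<Prod>i\<in>{1..n}. \<bar>x i\<bar>) > 0" by (intro prod_pos) auto
  moreover have "(\<Sum>i\<in>{1..n}. \<bar>x i\<bar> powr p) > 0"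
    using elim assms by (intro sum_pos) auto
  ultimately show ?case
    using assms unfolding mean_ratio_def by (intro divide_pos_pos) (simp_all add: less_imp_neq[THEN not_sym])
qed

lemma AE_nu:
  assumes "AE x in Rn n. P x" shows "AE x in nu p n a. P x"
  unfolding nu_def using assms by (subst AE_density) (auto elim!: eventually_mono)

lemma ratio_mass_mono:
  assumes "p > 0" "a > 0" "n \<ge> 1" "E \<subseteq> F" and [measurable]: "E \<in> sets borel" "F \<in> sets borel"
  shows "ratio_mass p n a E \<le> ratio_mass p n a F"
  unfolding ratio_mass_def using assms nu_ball_finite[of p a n 1 F]
  by (intro mult_left_mono measure_mono_fmeasurable) (auto simp: fmeasurable_def)

lemma ratio_mass_nonneg: "ratio_mass p n a E \<ge> 0"
  by (simp add: ratio_mass_def)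

text \<open>Tilting takes powers of the ratio and therefore asks for positive values, which the
  ratio has off the coordinate hyperplanes.\<close>

lemma ratio_mass_pos_part:
  assumes "p > 0" "a > 0" "n \<ge> 1" and [measurable]: "E \<in> sets borel"
  shows "ratio_mass p n a E = ratio_mass p n a (E \<inter> {0<..})"
proof -
  have "measure (nu p n a) {x \<in> space (Rn n). lp_norm p n x \<le> 1 \<and> mean_ratio p n x \<in> E} =
    measure (nu p n a) {x \<in> space (Rn n). lp_norm p n x \<le> 1 \<and> mean_ratio p n x \<in> E \<inter> {0<..}}"
    using AE_nu[OF AE_mean_ratio_pos[OF assms(1,3)], of p a]
    by (intro measure_eq_AE) (auto elim!: eventually_mono)
  then show ?thesis by (simp add: ratio_mass_def)
qed

lemma ratio_mass_Un:
  assumes "p > 0" "a > 0" "n \<ge> 1" and [measurable]: "E \<in> sets borel" "F \<in> sets borel"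
  shows "ratio_mass p n a (E \<union> F) \<le> ratio_mass p n a E + ratio_mass p n a F"
proof -
  let ?S = "\<lambda>E. {x \<in> space (Rn n). lp_norm p n x \<le> 1 \<and> mean_ratio p n x \<in> E}"
  have "?S (E \<union> F) = ?S E \<union> ?S F" by auto
  moreover have "measure (nu p n a) (?S E \<union> ?S F) \<le> measure (nu p n a) (?S E) + measure (nu p n a) (?S F)"
    by (intro measure_Un_le) auto
  ultimately show ?thesis
    unfolding ratio_mass_def by (simp only: distrib_left[symmetric]) (intro mult_left_mono, auto)
qed

section \<open>Exponential tail bounds and the local lower bound\<close>

lemma eventually_exp_bounds:
  fixes u :: "nat \<Rightarrow> real"
  assumes "(\<lambda>n. ln (u n) / n) \<longlonglongrightarrow> l" and "eventually (\<lambda>n. u n > 0) at_top"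
  shows "l < c \<Longrightarrow> eventually (\<lambda>n. u n < exp (n * c)) at_top"
    and "c < l \<Longrightarrow> eventually (\<lambda>n. exp (n * c) < u n) at_top"
proof -
  assume "l < c"
  with assms(1) have "eventually (\<lambda>n. ln (u n) / n < c) at_top" by (rule order_tendstoD)
  with assms(2) eventually_gt_at_top[of 0] show "eventually (\<lambda>n. u n < exp (n * c)) at_top"
  proof eventually_elim
    case (elim n)
    then have "exp (ln (u n)) < exp (n * c)"
      by (subst exp_less_cancel_iff) (simp add: divide_less_eq mult.commute)
    with elim show ?case by simp
  qed
next
  assume "c < l"
  with assms(1) have "eventually (\<lambda>n. c < ln (u n) / n) at_top" by (rule order_tendstoD)
  with assms(2) eventually_gt_at_top[of 0] show "eventually (\<lambda>n. exp (n * c) < u n) at_top"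
  proof eventually_elim
    case (elim n)
    then have "exp (n * c) < exp (ln (u n))"
      by (subst exp_less_cancel_iff) (simp add: less_divide_eq mult.commute)
    with elim show ?case by simp
  qed
qed

text \<open>In the quotient \<open>ln (2 / p)\<close> cancels, and the constant \<open>C\<close>
  disappears after division by n.\<close>

lemma ln_scaled_asymp:
  assumes "p > 0" "a > 0" "b > 0" "C > 0" "\<rho> > 0"
  shows "(\<lambda>n. ln (C * \<rho> powr n * (ratio_mass p n a UNIV / ratio_mass p n b UNIV)) / n)
    \<longlonglongrightarrow> ln \<rho> + (Q_fun a - Q_fun b)"
    and "eventually (\<lambda>n. C * \<rho> powr n * (ratio_mass p n a UNIV / ratio_mass p n b UNIV) > 0) at_top"
proof -
  show "eventually (\<lambda>n. C * \<rho> powr n * (ratio_mass p n a UNIV / ratio_mass p n b UNIV) > 0) at_top"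
    using eventually_ge_at_top[of 1]
    by eventually_elim (use assms ratio_mass_UNIV_pos in auto)
  have "(\<lambda>n. ln C / n + ln \<rho> + (ln (ratio_mass p n a UNIV) / n - ln (ratio_mass p n b UNIV) / n))
    \<longlonglongrightarrow> 0 + ln \<rho> + ((ln (2 / p) + Q_fun a) - (ln (2 / p) + Q_fun b))"
    using assms by (intro tendsto_intros ratio_mass_UNIV_asymp) (real_asymp | simp)+
  moreover have "eventually (\<lambda>n. ln C / n + ln \<rho> + (ln (ratio_mass p n a UNIV) / n - ln (ratio_mass p n b UNIV) / n) =
     ln (C * \<rho> powr n * (ratio_mass p n a UNIV / ratio_mass p n b UNIV)) / n) at_top"
    using eventually_ge_at_top[of 1]
  proof eventually_elim
    case (elim n)
    then show ?case
      using assms ratio_mass_UNIV_pos[of p a n] ratio_mass_UNIV_pos[of p b n]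
      by (simp add: ln_mult_pos ln_div ln_powr add_divide_distrib diff_divide_distrib)
  qed
  ultimately show "(\<lambda>n. ln (C * \<rho> powr n * (ratio_mass p n a UNIV / ratio_mass p n b UNIV)) / n)
    \<longlonglongrightarrow> ln \<rho> + (Q_fun a - Q_fun b)" by (simp add: tendsto_cong)
qed

text \<open>Chernoff's bound. In both cases \<open>t powr (p * (b - a))\<close> is on
  \<open>E\<close> at least its value at \<theta>, so tilting from \<open>a\<close> to
  \<open>b\<close> costs a power of \<theta>; the tilted mass of \<open>E\<close> is bounded by the
  total mass. The start \<open>a\<close> is arbitrary because the tails of the tilted weights have
  to be bounded as well.\<close>

lemma ratio_mass_tail:
  assumes "p > 0" "a > 0" "b > 0" "\<theta> > 0" and [measurable]: "E \<in> sets borel"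
    and E: "E \<subseteq> {0<..\<theta>} \<and> b \<le> a \<or> E \<subseteq> {\<theta>..} \<and> a \<le> b"
    and c: "c < p * (b - a) * ln \<theta> - Q_fun b + Q_fun a"
  shows "eventually (\<lambda>n. ratio_mass p n a E / ratio_mass p n a UNIV \<le> exp (- (n * c))) at_top"
proof -
  define \<rho> where "\<rho> = \<theta> powr (p * (b - a))"
  define C where "C = exp (2 * p * \<bar>b - a\<bar>) / (1 - exp (- (p * a)))"
  have pos: "\<rho> > 0" "C > 0" using assms by (auto simp: \<rho>_def C_def)
  have "ln (1 / \<rho>) + (Q_fun b - Q_fun a) < - c"
    using assms pos by (simp add: \<rho>_def ln_div ln_powr)
  then have "eventually (\<lambda>n. C * (1 / \<rho>) powr n * (ratio_mass p n b UNIV / ratio_mass p n a UNIV) < exp (n * - c)) at_top"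
    using assms pos by (intro eventually_exp_bounds(1)[OF ln_scaled_asymp]) auto
  then show ?thesis
    using eventually_ge_at_top[of 2]
  proof eventually_elim
    case (elim n)
    have "\<rho> powr n * ratio_mass p n a E \<le> C * ratio_mass p n b E"
      unfolding C_def
    proof (rule ratio_mass_tilt)
      fix t assume "t \<in> E"
      then consider "0 < t" "t \<le> \<theta>" "b \<le> a" | "\<theta> \<le> t" "a \<le> b" using E by auto
      then show "t > 0 \<and> \<rho> \<le> t powr (p * (b - a))"
      proof cases
        case 1
        then show ?thesis
          using assms(1) by (auto simp: \<rho>_def intro!: powr_mono2' mult_nonneg_nonpos)
      next
        case 2
        then have "\<rho> \<le> t powr (p * (b - a))"
          unfolding \<rho>_def using assms(1,4) by (intro powr_mono2 mult_nonneg_nonneg) auto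
        then show ?thesis using 2 assms(4) by simp
      qed
    qed (use assms pos elim in auto)
    also have "\<dots> \<le> C * ratio_mass p n b UNIV"
      using assms pos elim by (intro mult_left_mono ratio_mass_mono) auto
    finally have "ratio_mass p n a E \<le> C * (1 / \<rho>) powr n * ratio_mass p n b UNIV"
      using pos by (simp add: powr_divide field_simps)
    then have "ratio_mass p n a E / ratio_mass p n a UNIV \<le> C * (1 / \<rho>) powr n * ratio_mass p n b UNIV / ratio_mass p n a UNIV"
      using ratio_mass_nonneg by (intro divide_right_mono)
    then show ?case using elim by simp
  qed
qed

lemma ball_prob_tail:
  assumes "p > 0" "b > 0" "\<theta> > 0" and E[measurable]: "E \<in> sets borel"
    and "E \<subseteq> {..\<theta>} \<and> b \<le> 1 / p \<or> E \<subseteq> {\<theta>..} \<and> 1 / p \<le> b"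
    and c: "c < (p * b - 1) * ln \<theta> - Q_fun b + Q_fun (1 / p)"
  shows "eventually (\<lambda>n. ball_prob p n E \<le> exp (- (n * c))) at_top"
proof -
  have "eventually (\<lambda>n. ratio_mass p n (1 / p) (E \<inter> {0<..}) / ratio_mass p n (1 / p) UNIV \<le> exp (- (n * c))) at_top"
  proof (rule ratio_mass_tail[where b = b and \<theta> = \<theta>])
    have "p * (b - 1 / p) = p * b - 1" using assms by (simp add: field_simps)
    then show "c < p * (b - 1 / p) * ln \<theta> - Q_fun b + Q_fun (1 / p)" using c by simp
  qed (use assms in auto)
  then show ?thesis
    using eventually_ge_at_top[of 1]
    by eventually_elim (use assms in \<open>simp add: ball_prob_eq ratio_mass_pos_part[of p "1 / p" _ E]\<close>)
qed

text \<open>Under the tilted weights with \<open>a = G_fun p \<theta>\<close> the ratio concentrates at \<open>\<theta>\<close>, since \<open>H_fun a = p * ln \<theta>\<close>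
  is the derivative of the limiting cumulant generating function \<open>Q_fun\<close>.\<close>

lemma ratio_mass_concentration:
  assumes "p > 0" "0 < \<theta>1" "\<theta>1 < \<theta>" "\<theta> < \<theta>2" "\<theta> < 1"
  shows "eventually (\<lambda>n. ratio_mass p n (G_fun p \<theta>) {\<theta>1<..<\<theta>2} \<ge> ratio_mass p n (G_fun p \<theta>) UNIV / 2) at_top"
proof -
  define a where "a = G_fun p \<theta>"
  have a: "a > 0" "H_fun a = p * ln \<theta>"
    using assms G_fun_pos[of p \<theta>] H_G_fun[of p \<theta>] by (auto simp: a_def)
  have ln: "ln \<theta>1 < ln \<theta>" "ln \<theta> < ln \<theta>2" using assms by auto
  \<comment> \<open>The exponent for the upper tail at \<theta>2 is the drop of this function below
    its value at \<open>a\<close>. Its derivative at \<open>a\<close> is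
    \<open>p * (ln \<theta> - ln \<theta>2)\<close>, which is negative, so a slightly larger
    \<open>b\<close> gives a positive exponent. The lower tail is treated in the same way with a
    smaller \<open>b\<close>.\<close>
  have "((\<lambda>b. Q_fun b - p * (b - a) * ln \<theta>2) has_field_derivative H_fun a - p * ln \<theta>2) (at a)"
    using a by (auto intro!: derivative_eq_intros Q_fun_has_derivative)
  moreover have "H_fun a - p * ln \<theta>2 < 0" using a ln assms by simp
  ultimately obtain d where d: "d > 0" "\<And>h. 0 < h \<Longrightarrow> h < d \<Longrightarrow> Q_fun (a + h) - p * (a + h - a) * ln \<theta>2 < Q_fun a - p * (a - a) * ln \<theta>2"
    using DERIV_neg_dec_right by blast
  have up: "eventually (\<lambda>n. ratio_mass p n a {\<theta>2..} / ratio_mass p n a UNIV \<le> exp (- (n * c))) at_top"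
    if "c < p * (a + d / 2 - a) * ln \<theta>2 - Q_fun (a + d / 2) + Q_fun a" for c
    by (rule ratio_mass_tail[where b = "a + d / 2" and \<theta> = \<theta>2]) (use assms a d that in auto)
  obtain c2 where c2: "c2 > 0" "eventually (\<lambda>n. ratio_mass p n a {\<theta>2..} / ratio_mass p n a UNIV \<le> exp (- (n * c2))) at_top"
    using up d(2)[of "d / 2"] d(1) dense[of 0 "p * (a + d / 2 - a) * ln \<theta>2 - Q_fun (a + d / 2) + Q_fun a"] by auto
  have "((\<lambda>b. Q_fun b - p * (b - a) * ln \<theta>1) has_field_derivative H_fun a - p * ln \<theta>1) (at a)"
    using a by (auto intro!: derivative_eq_intros Q_fun_has_derivative)
  moreover have "H_fun a - p * ln \<theta>1 > 0" using a ln assms by simp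
  ultimately obtain d' where d': "d' > 0" "\<And>h. 0 < h \<Longrightarrow> h < d' \<Longrightarrow> Q_fun (a - h) - p * (a - h - a) * ln \<theta>1 < Q_fun a - p * (a - a) * ln \<theta>1"
    using DERIV_pos_inc_left by blast
  \<comment> \<open>Besides staying below \<open>d'\<close>, the step must keep the parameter
    \<open>a - h\<close> positive.\<close>
  define h where "h = min d' a / 2"
  have h: "0 < h" "h < d'" "h < a" using d' a by (auto simp: h_def)
  have down: "eventually (\<lambda>n. ratio_mass p n a {0<..\<theta>1} / ratio_mass p n a UNIV \<le> exp (- (n * c))) at_top"
    if "c < p * (a - h - a) * ln \<theta>1 - Q_fun (a - h) + Q_fun a" for c
    by (rule ratio_mass_tail[where b = "a - h" and \<theta> = \<theta>1]) (use assms a h that in auto)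
  obtain c1 where c1: "c1 > 0" "eventually (\<lambda>n. ratio_mass p n a {0<..\<theta>1} / ratio_mass p n a UNIV \<le> exp (- (n * c1))) at_top"
    using down d'(2)[OF h(1,2)] dense[of 0 "p * (a - h - a) * ln \<theta>1 - Q_fun (a - h) + Q_fun a"] by auto
  have "eventually (\<lambda>n. exp (- (real n * c1)) + exp (- (real n * c2)) \<le> 1 / 2) at_top"
  proof -
    have "(\<lambda>n. exp (- (real n * c))) \<longlonglongrightarrow> 0" if "c > 0" for c :: real
      using that by real_asymp
    from tendsto_add[OF this[OF c1(1)] this[OF c2(1)]]
    have "(\<lambda>n. exp (- (real n * c1)) + exp (- (real n * c2))) \<longlonglongrightarrow> 0" by simp
    from order_tendstoD(2)[OF this, of "1 / 2"] show ?thesis by (auto elim: eventually_mono)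
  qed
  with c1(2) c2(2) eventually_ge_at_top[of 1] show ?thesis
    unfolding a_def[symmetric]
  proof eventually_elim
    case (elim n)
    let ?W = "ratio_mass p n a"
    have W: "?W UNIV > 0" using assms a elim by (intro ratio_mass_UNIV_pos) auto
    have "?W UNIV = ?W ({0<..\<theta>1} \<union> ({\<theta>1<..<\<theta>2} \<union> {\<theta>2..}))"
      using assms a elim by (subst ratio_mass_pos_part) (auto intro!: arg_cong[where f = ?W])
    also have "\<dots> \<le> ?W {0<..\<theta>1} + ?W ({\<theta>1<..<\<theta>2} \<union> {\<theta>2..})"
      using assms a elim by (intro ratio_mass_Un) auto
    also have "?W ({\<theta>1<..<\<theta>2} \<union> {\<theta>2..}) \<le> ?W {\<theta>1<..<\<theta>2} + ?W {\<theta>2..}"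
      using assms a elim by (intro ratio_mass_Un) auto
    finally have "?W UNIV \<le> ?W {0<..\<theta>1} + (?W {\<theta>1<..<\<theta>2} + ?W {\<theta>2..})" by simp
    moreover have "(?W {0<..\<theta>1} + ?W {\<theta>2..}) / ?W UNIV \<le> 1 / 2"
      using elim unfolding add_divide_distrib by linarith
    then have "?W {0<..\<theta>1} + ?W {\<theta>2..} \<le> ?W UNIV / 2"
      using W by (simp add: field_simps)
    ultimately show ?case by simp
  qed
qed

text \<open>Tilting back: under the weight with parameter \<open>G_fun p \<theta>\<close> a small
  window around \<theta> carries at least half of the mass, and on it the density back to Lebesgue
  measure is close to its value at \<theta>.\<close>

lemma ball_prob_lower:
  assumes "p > 0" "\<theta> \<in> {0<..<1}" "0 < \<epsilon>" and c: "rate_fun p \<theta> < ereal c"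
  shows "eventually (\<lambda>n. ball_prob p n {\<theta> - \<epsilon><..<\<theta> + \<epsilon>} \<ge> exp (- (n * c))) at_top"
proof -
  define a where "a = G_fun p \<theta>"
  have a: "a > 0" using assms G_fun_pos[of p \<theta>] by (auto simp: a_def)
  have rate: "(p * a - 1) * ln \<theta> - Q_fun a + Q_fun (1 / p) < c"
    using c assms by (simp add: rate_fun_eq a_def)
  \<comment> \<open>The cost of the tilt at a point t near \<theta>, with \<open>a\<close> frozen.
    It is continuous in t, so the window can be shrunk until the cost at both ends is below
    \<open>c\<close>.\<close>
  define \<phi> where "\<phi> = (\<lambda>t. (p * a - 1) * ln t - Q_fun a + Q_fun (1 / p))"
  have "(\<phi> \<longlongrightarrow> \<phi> \<theta>) (at \<theta>)"
    unfolding \<phi>_def using assms by (auto intro!: tendsto_eq_intros)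
  then have "eventually (\<lambda>t. \<phi> t < c) (at \<theta>)"
    using rate by (intro order_tendstoD) (simp_all add: \<phi>_def)
  then obtain d where d: "d > 0" "\<And>t. t \<noteq> \<theta> \<Longrightarrow> dist t \<theta> < d \<Longrightarrow> \<phi> t < c"
    by (auto simp: eventually_at)
  define e where "e = min (min d \<epsilon>) \<theta> / 2"
  have e: "0 < e" "e < d" "e < \<epsilon>" "e < \<theta>" using d assms by (auto simp: e_def)
  define \<theta>1 \<theta>2 where "\<theta>1 = \<theta> - e" and "\<theta>2 = \<theta> + e"
  have \<theta>: "0 < \<theta>1" "\<theta>1 < \<theta>" "\<theta> < \<theta>2" "\<phi> \<theta>1 < c" "\<phi> \<theta>2 < c"
    using e by (auto simp: \<theta>1_def \<theta>2_def dist_real_def intro!: d)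
  \<comment> \<open>The exponent may have either sign, so the minimum over the window is the smaller
    of the two end values.\<close>
  define \<rho> where "\<rho> = min (\<theta>1 powr (p * (1 / p - a))) (\<theta>2 powr (p * (1 / p - a)))"
  define C where "C = exp (2 * p * \<bar>1 / p - a\<bar>) / (1 - exp (- (p * a)))"
  have pos: "\<rho> > 0" "C > 0" using assms a \<theta> by (auto simp: \<rho>_def C_def)
  have "p * (1 / p - a) = 1 - p * a" using assms by (simp add: field_simps)
  then have "- c < ln \<rho> + (Q_fun a - Q_fun (1 / p))"
    using \<theta> by (auto simp: \<rho>_def min_def ln_powr \<phi>_def algebra_simps)
  then have "eventually (\<lambda>n. exp (n * - c) < 1 / (2 * C) * \<rho> powr n * (ratio_mass p n a UNIV / ratio_mass p n (1 / p) UNIV)) at_top"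
    using assms a pos by (intro eventually_exp_bounds(2)[OF ln_scaled_asymp]) auto
  moreover have "eventually (\<lambda>n. ratio_mass p n a {\<theta>1<..<\<theta>2} \<ge> ratio_mass p n a UNIV / 2) at_top"
    unfolding a_def using assms \<theta> by (intro ratio_mass_concentration) auto
  ultimately show ?thesis
    using eventually_ge_at_top[of 2]
  proof eventually_elim
    case (elim n)
    have W: "ratio_mass p n (1 / p) UNIV > 0" using assms elim by (intro ratio_mass_UNIV_pos) auto
    have "\<rho> powr n * ratio_mass p n a {\<theta>1<..<\<theta>2} \<le> C * ratio_mass p n (1 / p) {\<theta>1<..<\<theta>2}"
      unfolding C_def
    proof (rule ratio_mass_tilt)
      fix t assume t: "t \<in> {\<theta>1<..<\<theta>2}"
      show "t > 0 \<and> \<rho> \<le> t powr (p * (1 / p - a))"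
      proof (cases "p * (1 / p - a) \<ge> 0")
        case True
        then have "\<theta>1 powr (p * (1 / p - a)) \<le> t powr (p * (1 / p - a))"
          using t \<theta> by (intro powr_mono2) auto
        then show ?thesis using t \<theta> by (auto simp: \<rho>_def)
      next
        case False
        then have "\<theta>2 powr (p * (1 / p - a)) \<le> t powr (p * (1 / p - a))"
          using t \<theta> by (intro powr_mono2') auto
        then show ?thesis using t \<theta> by (auto simp: \<rho>_def)
      qed
    qed (use assms a pos elim in auto)
    also have "\<dots> \<le> C * ratio_mass p n (1 / p) {\<theta> - \<epsilon><..<\<theta> + \<epsilon>}"
      using assms pos elim e by (intro mult_left_mono ratio_mass_mono) (auto simp: \<theta>1_def \<theta>2_def)
    finally have 1: "\<rho> powr n * ratio_mass p n a {\<theta>1<..<\<theta>2} \<le> C * ratio_mass p n (1 / p) {\<theta> - \<epsilon><..<\<theta> + \<epsilon>}" .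
    have "\<rho> powr n * (ratio_mass p n a UNIV / 2) \<le> \<rho> powr n * ratio_mass p n a {\<theta>1<..<\<theta>2}"
      using elim by (intro mult_left_mono) auto
    from order_trans[OF this 1]
    have "\<rho> powr n * (ratio_mass p n a UNIV / 2) \<le> C * ratio_mass p n (1 / p) {\<theta> - \<epsilon><..<\<theta> + \<epsilon>}" .
    then have "1 / (2 * C) * \<rho> powr n * ratio_mass p n a UNIV \<le> ratio_mass p n (1 / p) {\<theta> - \<epsilon><..<\<theta> + \<epsilon>}"
      using pos by (simp add: field_simps)
    then have "1 / (2 * C) * \<rho> powr n * ratio_mass p n a UNIV / ratio_mass p n (1 / p) UNIV \<le> ball_prob p n {\<theta> - \<epsilon><..<\<theta> + \<epsilon>}"
      using assms(1) elim by (subst ball_prob_eq) (auto intro!: divide_right_mono ratio_mass_nonneg simp del: times_divide_eq_left)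
    then show ?case using elim by simp
  qed
qed

section \<open>Upper bound for closed sets, and transfer to comparable laws\<close>

lemma H_fun_le_iff:
  assumes "x > 0" "y > 0" shows "H_fun x \<le> H_fun y \<longleftrightarrow> x \<le> y"
  using H_fun_strict_mono[of x y] H_fun_strict_mono[of y x] assms by (cases x y rule: linorder_cases) auto

lemma ball_prob_null:
  assumes "p > 0" "n \<ge> 1" "E \<subseteq> {..0}" and [measurable]: "E \<in> sets borel"
  shows "ball_prob p n E = 0"
proof -
  have "E \<inter> {0<..} = {}" using assms(3) by auto
  then show ?thesis
    using assms by (simp add: ball_prob_eq ratio_mass_pos_part[of p "1 / p" n E]) (simp add: ratio_mass_def)
qed

text \<open>The bound \<open>exp (H_fun (1 / p) / p)\<close> is the typical value of the ratio:
  there \<open>G_fun\<close> equals \<open>1 / p\<close> and the rate is zero. To its left the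
  largest point \<open>t\<close> of \<open>F\<close> has \<open>G_fun p t \<le> 1 / p\<close>, which
  is the sign that the Chernoff bound at \<open>t\<close> asks for; all of \<open>F\<close> lies
  below \<open>t\<close>, so only the rate at this one point enters.\<close>

lemma ball_prob_upper_left:
  assumes "p > 0" "closed F" "F \<subseteq> {..exp (H_fun (1 / p) / p)}"
    and c: "\<And>\<theta>. \<theta> \<in> F \<Longrightarrow> ereal c < rate_fun p \<theta>"
  shows "eventually (\<lambda>n. ball_prob p n F \<le> exp (- (n * c))) at_top"
proof (cases "F \<subseteq> {..0}")
  case True
  show ?thesis
    using eventually_ge_at_top[of 1]
    by eventually_elim (use True assms in \<open>simp add: ball_prob_null\<close>)
next
  case False
  let ?\<theta>s = "exp (H_fun (1 / p) / p)"
  \<comment> \<open>Cutting \<open>F\<close> off below a positive point makes it compact and its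
    maximum positive.\<close>
  obtain x where x: "x \<in> F" "x > 0" using False by force
  have cpt: "compact (F \<inter> {x..?\<theta>s})" using assms by (intro closed_Int_compact) auto
  have "x \<in> F \<inter> {x..?\<theta>s}" using x assms(3) by auto
  then have "F \<inter> {x..?\<theta>s} \<noteq> {}" by blast
  from compact_attains_sup[OF cpt this] obtain t where t: "t \<in> F \<inter> {x..?\<theta>s}" "\<And>y. y \<in> F \<inter> {x..?\<theta>s} \<Longrightarrow> y \<le> t"
    by blast
  have "ln t \<le> ln ?\<theta>s"
    using t x by (subst ln_le_cancel_iff) auto
  then have ln_t: "ln t \<le> H_fun (1 / p) / p" by simp
  have "H_fun (1 / p) / p < 0" using assms H_fun_neg[of "1 / p"] by (simp add: divide_neg_pos)
  with ln_t have "ln t < 0" by simp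
  then have t01: "t \<in> {0<..<1}" using t x by (auto simp: ln_less_zero_iff)
  have "H_fun (G_fun p t) \<le> H_fun (1 / p)"
    using ln_t assms t01 by (simp add: H_G_fun field_simps)
  then have "G_fun p t \<le> 1 / p"
    using assms t01 by (simp add: H_fun_le_iff G_fun_pos)
  moreover have "F \<subseteq> {..t}"
  proof
    fix y assume "y \<in> F"
    then show "y \<in> {..t}" using t assms(3) by (cases "x \<le> y") auto
  qed
  ultimately show ?thesis
    using assms t t01 c[of t]
    by (intro ball_prob_tail[where b = "G_fun p t" and \<theta> = t]) (auto simp: G_fun_pos rate_fun_eq)
qed

text \<open>The mirror image with the smallest point \<open>t\<close> of \<open>F\<close>, except
  that \<open>t\<close> may be 1 or more, where \<open>G_fun\<close> offers no tilt.\<close>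

lemma ball_prob_upper_right:
  assumes "p > 0" "closed F" "F \<subseteq> {exp (H_fun (1 / p) / p)..}"
    and c: "\<And>\<theta>. \<theta> \<in> F \<Longrightarrow> ereal c < rate_fun p \<theta>"
  shows "eventually (\<lambda>n. ball_prob p n F \<le> exp (- (n * c))) at_top"
proof (cases "F = {}")
  case True
  then show ?thesis by (simp add: ball_prob_def)
next
  case False
  let ?\<theta>s = "exp (H_fun (1 / p) / p)"
  have "bdd_below F" using assms(3) by (auto intro: bdd_belowI[of _ ?\<theta>s])
  define t where "t = Inf F"
  have t: "t \<in> F" "F \<subseteq> {t..}"
    unfolding t_def using closed_contains_Inf[OF False \<open>bdd_below F\<close> assms(2)] \<open>bdd_below F\<close>
    by (auto intro: cInf_lower)
  show ?thesis
  proof (cases "t < 1")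
    case True
    have "t \<ge> ?\<theta>s" using t assms by auto
    then have "t > 0" by (rule less_le_trans[OF exp_gt_zero])
    then have t01: "t \<in> {0<..<1}" using True by simp
    then have "H_fun (1 / p) / p \<le> ln t" using \<open>t \<ge> ?\<theta>s\<close> by (simp add: ln_ge_iff)
    then have "H_fun (1 / p) \<le> H_fun (G_fun p t)"
      using assms t01 by (simp add: H_G_fun field_simps)
    then have "1 / p \<le> G_fun p t"
      using assms t01 by (simp add: H_fun_le_iff G_fun_pos)
    then show ?thesis
      using assms t t01 c[of t]
      by (intro ball_prob_tail[where b = "G_fun p t" and \<theta> = t]) (auto simp: G_fun_pos rate_fun_eq)
  next
    case False
    \<comment> \<open>Here the rate is infinite on all of \<open>F\<close>. At \<theta> = 1 the term
      with \<open>ln \<theta>\<close> vanishes and the exponent is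
      \<open>Q_fun (1 / p) - Q_fun b\<close>, arbitrarily large for large \<open>b\<close>; the
      extra 1 makes the inequality strict.\<close>
    obtain b where b: "b \<ge> 1 / p" "Q_fun b \<le> Q_fun (1 / p) - c - 1"
      using Q_fun_at_top by blast
    moreover have "b > 0" using b(1) assms(1) by (auto intro: less_le_trans[of _ "1 / p"])
    ultimately show ?thesis
      using assms t False
      by (intro ball_prob_tail[where b = b and \<theta> = 1]) auto
  qed
qed

lemma ball_prob_mono:
  assumes "p > 0" "n \<ge> 1" "E \<subseteq> F" and [measurable]: "E \<in> sets borel" "F \<in> sets borel"
  shows "ball_prob p n E \<le> ball_prob p n F"
proof -
  interpret prob_space "uniform_lp_ball p n" using assms by (intro prob_space_uniform_lp_ball)
  show ?thesis unfolding ball_prob_def using assms by (intro finite_measure_mono) auto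
qed

lemma ball_prob_upper:
  assumes "p > 0" "closed F" and c: "\<And>\<theta>. \<theta> \<in> F \<Longrightarrow> ereal c < rate_fun p \<theta>"
  shows "eventually (\<lambda>n. ball_prob p n F \<le> 2 * exp (- (n * c))) at_top"
proof -
  let ?s = "exp (H_fun (1 / p) / p)"
  have "eventually (\<lambda>n. ball_prob p n (F \<inter> {..?s}) \<le> exp (- (n * c))) at_top"
    using assms by (intro ball_prob_upper_left) auto
  moreover have "eventually (\<lambda>n. ball_prob p n (F \<inter> {?s..}) \<le> exp (- (n * c))) at_top"
    using assms by (intro ball_prob_upper_right) auto
  ultimately show ?thesis using eventually_ge_at_top[of 1]
  proof eventually_elim
    case (elim n)
    interpret prob_space "uniform_lp_ball p n" using assms elim by (intro prob_space_uniform_lp_ball)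
    have [measurable]: "F \<in> sets borel" using assms by auto
    let ?S = "\<lambda>E. {x \<in> space (Rn n). mean_ratio p n x \<in> E}"
    have "?S F = ?S (F \<inter> {..?s}) \<union> ?S (F \<inter> {?s..})" by auto
    then have "ball_prob p n F \<le> ball_prob p n (F \<inter> {..?s}) + ball_prob p n (F \<inter> {?s..})"
      unfolding ball_prob_def by (simp only:) (intro measure_Un_le, auto)
    with elim show ?case by simp
  qed
qed

text \<open>The factor \<kappa> is subexponential and therefore invisible after taking logarithms
  and dividing by n, so one large deviation result for the ball covers every law comparable with
  it.\<close>

lemma ldp_of_comparison:
  fixes P :: "nat \<Rightarrow> real"
  assumes "p > 0" and A[measurable]: "A \<in> sets borel"
    and \<kappa>: "(\<lambda>n. ln (\<kappa> n) / n) \<longlonglongrightarrow> 0" "eventually (\<lambda>n. \<kappa> n > 0) at_top"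
    and le: "eventually (\<lambda>n. P n \<le> \<kappa> n * ball_prob p n A) at_top"
    and ge: "eventually (\<lambda>n. ball_prob p n A \<le> \<kappa> n * P n) at_top"
  shows "- (INF \<theta>\<in>interior A. rate_fun p \<theta>) \<le> liminf (\<lambda>n. ereal (1 / real n) * elog (P n))"
    and "limsup (\<lambda>n. ereal (1 / real n) * elog (P n)) \<le> - (INF \<theta>\<in>closure A. rate_fun p \<theta>)"
proof -
  have "- liminf (\<lambda>n. ereal (1 / real n) * elog (P n)) \<le> (INF \<theta>\<in>interior A. rate_fun p \<theta>)"
  proof (rule INF_greatest, rule dense_ge)
    fix \<theta> x assume \<theta>: "\<theta> \<in> interior A" and x: "rate_fun p \<theta> < x"
    show "- liminf (\<lambda>n. ereal (1 / real n) * elog (P n)) \<le> x"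
    proof (cases x)
      case (real c)
      obtain e where e: "e > 0" "ball \<theta> e \<subseteq> A"
        using \<theta> by (auto simp: mem_interior)
      have \<theta>01: "\<theta> \<in> {0<..<1}" using x by (auto simp: rate_fun_def split: if_splits)
      obtain c' where c': "rate_fun p \<theta> < ereal c'" "c' < c"
        using ereal_dense2[OF x] real by auto
      have "eventually (\<lambda>n. ball_prob p n {\<theta> - e<..<\<theta> + e} \<ge> exp (- (n * c'))) at_top"
        using assms \<theta>01 e c' by (intro ball_prob_lower) auto
      moreover have "eventually (\<lambda>n. \<kappa> n < exp (n * (c - c'))) at_top"
        using c' by (intro eventually_exp_bounds(1)[OF \<kappa>]) auto
      ultimately have "eventually (\<lambda>n. ereal (- c) \<le> ereal (1 / real n) * elog (P n)) at_top"
        using ge \<kappa>(2) eventually_ge_at_top[of 1]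
      proof eventually_elim
        case (elim n)
        have "{\<theta> - e<..<\<theta> + e} \<subseteq> A" using e by (auto simp: ball_eq_greaterThanLessThan)
        then have "ball_prob p n {\<theta> - e<..<\<theta> + e} \<le> ball_prob p n A"
          using assms(1) elim by (intro ball_prob_mono) auto
        with elim have 1: "exp (- (n * c')) \<le> \<kappa> n * P n" by simp
        then have "P n > 0"
          using elim(4) by (smt (verit) exp_gt_zero zero_less_mult_pos)
        have "exp (- (n * c)) * exp (n * (c - c')) = exp (- (n * c'))"
          by (simp add: algebra_simps flip: exp_add)
        also have "\<dots> \<le> exp (n * (c - c')) * P n"
          using 1 elim(2) \<open>P n > 0\<close> by (meson less_imp_le mult_right_mono order_trans)
        finally have "exp (- (n * c)) \<le> P n" by simp
        then have "- (n * c) \<le> ln (P n)" using \<open>P n > 0\<close> by (simp add: ln_ge_iff)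
        then have "- c \<le> 1 / n * ln (P n)" using elim(5) by (simp add: field_simps)
        then show ?case using \<open>P n > 0\<close> by (simp add: elog_def)
      qed
      then have "ereal (- c) \<le> liminf (\<lambda>n. ereal (1 / real n) * elog (P n))"
        by (rule Liminf_bounded)
      then show ?thesis using real by (simp add: ereal_uminus_le_reorder)
    qed (use x in auto)
  qed
  then show "- (INF \<theta>\<in>interior A. rate_fun p \<theta>) \<le> liminf (\<lambda>n. ereal (1 / real n) * elog (P n))"
    by (simp add: ereal_uminus_le_reorder)
next
  have "(INF \<theta>\<in>closure A. rate_fun p \<theta>) \<le> - limsup (\<lambda>n. ereal (1 / real n) * elog (P n))"
  proof (rule dense_le)
    fix x assume x: "x < (INF \<theta>\<in>closure A. rate_fun p \<theta>)"
    show "x \<le> - limsup (\<lambda>n. ereal (1 / real n) * elog (P n))"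
    proof (cases x)
      case (real c)
      \<comment> \<open>The gap between \<open>c\<close> and \<open>c'\<close> leaves room for
        \<kappa> and the factor 2.\<close>
      obtain c' where c': "ereal c' < (INF \<theta>\<in>closure A. rate_fun p \<theta>)" "c < c'"
        using ereal_dense2[OF x] real by auto
      have "eventually (\<lambda>n. ball_prob p n (closure A) \<le> 2 * exp (- (n * c'))) at_top"
        using assms c'(1) by (intro ball_prob_upper) (auto intro: less_le_trans INF_lower)
      moreover have "eventually (\<lambda>n. 2 * \<kappa> n < exp (n * (c' - c))) at_top"
      proof (rule eventually_exp_bounds(1))
        have "(\<lambda>n. ln 2 / real n + ln (\<kappa> n) / real n) \<longlonglongrightarrow> 0 + 0"
          by (intro tendsto_add \<kappa>) real_asymp
        moreover have "eventually (\<lambda>n. ln 2 / real n + ln (\<kappa> n) / real n = ln (2 * \<kappa> n) / real n) at_top"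
          using \<kappa>(2) by eventually_elim (simp add: ln_mult_pos add_divide_distrib)
        ultimately show "(\<lambda>n. ln (2 * \<kappa> n) / real n) \<longlonglongrightarrow> 0" by (simp add: tendsto_cong)
      qed (use \<kappa>(2) c' in auto)
      ultimately have "eventually (\<lambda>n. ereal (1 / real n) * elog (P n) \<le> ereal (- c)) at_top"
        using le \<kappa>(2) eventually_ge_at_top[of 1]
      proof eventually_elim
        case (elim n)
        have "ball_prob p n A \<le> ball_prob p n (closure A)"
          using assms(1) elim closure_subset by (intro ball_prob_mono) auto
        with elim have "ball_prob p n A \<le> 2 * exp (- (n * c'))" by simp
        then have "P n \<le> \<kappa> n * (2 * exp (- (n * c')))"
          using elim by (meson less_imp_le mult_left_mono order_trans)
        also have "\<dots> = (2 * \<kappa> n) * exp (- (n * c'))" by simp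
        also have "\<dots> \<le> exp (n * (c' - c)) * exp (- (n * c'))"
          using elim by (intro mult_right_mono) auto
        also have "\<dots> = exp (- (n * c))"
          by (simp add: algebra_simps flip: exp_add)
        finally have *: "P n \<le> exp (- (n * c))" .
        show ?case
        proof (cases "P n \<le> 0")
          case True
          then show ?thesis using elim by (simp add: elog_def)
        next
          case False
          then have "ln (P n) \<le> ln (exp (- (n * c)))" using * by (intro ln_mono) auto
          then have "ln (P n) \<le> - (n * c)" by simp
          then have "1 / n * ln (P n) \<le> - c" using elim(5) by (simp add: field_simps)
          then show ?thesis using False by (simp add: elog_def)
        qed
      qed
      then have "limsup (\<lambda>n. ereal (1 / real n) * elog (P n)) \<le> ereal (- c)"
        by (rule Limsup_bounded)
      then show ?thesis using real by (subst ereal_minus_le_minus[symmetric]) simp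
    qed (use x in auto)
  qed
  then show "limsup (\<lambda>n. ereal (1 / real n) * elog (P n)) \<le> - (INF \<theta>\<in>closure A. rate_fun p \<theta>)"
    by (subst ereal_minus_le_minus[symmetric]) simp
qed

section \<open>Ball comparison and Hausdorff measure\<close>

definition euclid_ball :: "nat \<Rightarrow> (nat \<Rightarrow> real) \<Rightarrow> real \<Rightarrow> (nat \<Rightarrow> real) set" where
  "euclid_ball n x r = {y \<in> space (Rn n). euclid_dist n x y < r}"

lemma euclid_dist_nonneg [simp]: "euclid_dist n x y \<ge> 0"
  by (simp add: euclid_dist_def)

lemma euclid_dist_commute: "euclid_dist n x y = euclid_dist n y x"
  by (simp add: euclid_dist_def L2_set_def power2_commute)

lemma euclid_dist_triangle: "euclid_dist n x z \<le> euclid_dist n x y + euclid_dist n y z"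
  using L2_set_triangle_ineq[of "\<lambda>i. x i - y i" "\<lambda>i. y i - z i" "{1..n}"]
  by (simp add: euclid_dist_def)

lemma euclid_dist_self [simp]: "euclid_dist n x x = 0"
  by (simp add: euclid_dist_def L2_set_def)

lemma component_le_euclid_dist: "i \<in> {1..n} \<Longrightarrow> \<bar>x i - y i\<bar> \<le> euclid_dist n x y"
  using member_le_L2_set[of "{1..n}" i "\<lambda>i. \<bar>x i - y i\<bar>"]
  by (simp add: euclid_dist_def L2_set_def)

lemma measurable_euclid_dist [measurable]: "euclid_dist n x \<in> borel_measurable (Rn n)"
  unfolding euclid_dist_def L2_set_def by measurable

lemma measurable_euclid_dist_pair [measurable]:
  "(\<lambda>z. euclid_dist n (fst z) (snd z)) \<in> borel_measurable (Rn n \<Otimes>\<^sub>M Rn n)"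
proof -
  have "(\<lambda>z. fst z i) \<in> borel_measurable (Rn n \<Otimes>\<^sub>M Rn n)"
    "(\<lambda>z. snd z i) \<in> borel_measurable (Rn n \<Otimes>\<^sub>M Rn n)" if "i \<in> {1..n}" for i
    using measurable_compose[OF measurable_fst measurable_Rn_component[OF that]]
      measurable_compose[OF measurable_snd measurable_Rn_component[OF that]] by auto
  then show ?thesis
    unfolding euclid_dist_def L2_set_def
    by (intro borel_measurable_sqrt[THEN measurable_compose[rotated]] borel_measurable_sum borel_measurable_power
        borel_measurable_diff) auto
qed

lemma sets_euclid_ball [measurable, simp]: "euclid_ball n x r \<in> sets (Rn n)"
  unfolding euclid_ball_def by measurable

text \<open>Tonelli's theorem for the indicator of the pairs at distance less than r; that this
  relation is symmetric is the source of both measure comparisons below.\<close>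

lemma emeasure_ball_integral_swap:
  assumes m1: "sigma_finite_measure m1" "sets m1 = sets (Rn n)"
    and m2: "sigma_finite_measure m2" "sets m2 = sets (Rn n)"
    and [measurable]: "U \<in> sets (Rn n)" "W \<in> sets (Rn n)"
  shows "(\<integral>\<^sup>+x. indicator U x * emeasure m2 (W \<inter> euclid_ball n x r) \<partial>m1) =
    (\<integral>\<^sup>+y. indicator W y * emeasure m1 (U \<inter> euclid_ball n y r) \<partial>m2)"
proof -
  interpret m1: sigma_finite_measure m1 by fact
  interpret m2: sigma_finite_measure m2 by fact
  interpret pair_sigma_finite m1 m2 by standard
  note [measurable_cong] = m1(2) m2(2)
  have sp: "space m1 = space (Rn n)" "space m2 = space (Rn n)"
    using sets_eq_imp_space_eq m1(2) m2(2) by auto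
  define k :: "(nat \<Rightarrow> real) \<Rightarrow> (nat \<Rightarrow> real) \<Rightarrow> ennreal" where
    "k = (\<lambda>x y. indicator (U \<times> W \<inter> {z \<in> space (Rn n \<Otimes>\<^sub>M Rn n). euclid_dist n (fst z) (snd z) < r}) (x, y))"
  have [measurable]: "case_prod k \<in> borel_measurable (m1 \<Otimes>\<^sub>M m2)"
    unfolding k_def by simp measurable
  have "(\<integral>\<^sup>+x. indicator U x * emeasure m2 (W \<inter> euclid_ball n x r) \<partial>m1) = (\<integral>\<^sup>+x. (\<integral>\<^sup>+y. k x y \<partial>m2) \<partial>m1)"
  proof (rule nn_integral_cong)
    fix x assume x: "x \<in> space m1"
    have "(\<integral>\<^sup>+y. k x y \<partial>m2) = (\<integral>\<^sup>+y. indicator U x * indicator (W \<inter> euclid_ball n x r) y \<partial>m2)"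
      using x by (intro nn_integral_cong) (auto simp: k_def indicator_def euclid_ball_def sp space_pair_measure)
    also have "\<dots> = indicator U x * emeasure m2 (W \<inter> euclid_ball n x r)"
      by (subst nn_integral_cmult) (auto simp: m2(2))
    finally show "indicator U x * emeasure m2 (W \<inter> euclid_ball n x r) = (\<integral>\<^sup>+y. k x y \<partial>m2)" ..
  qed
  also have "\<dots> = (\<integral>\<^sup>+y. (\<integral>\<^sup>+x. k x y \<partial>m1) \<partial>m2)"
    by (rule Fubini'[symmetric]) measurable
  also have "\<dots> = (\<integral>\<^sup>+y. indicator W y * emeasure m1 (U \<inter> euclid_ball n y r) \<partial>m2)"
  proof (rule nn_integral_cong)
    fix y assume y: "y \<in> space m2"
    have "(\<integral>\<^sup>+x. k x y \<partial>m1) = (\<integral>\<^sup>+x. indicator W y * indicator (U \<inter> euclid_ball n y r) x \<partial>m1)"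
      using y by (intro nn_integral_cong)
        (auto simp: k_def indicator_def euclid_ball_def sp space_pair_measure euclid_dist_commute)
    also have "\<dots> = indicator W y * emeasure m1 (U \<inter> euclid_ball n y r)"
      by (subst nn_integral_cmult) (auto simp: m1(2))
    finally show "(\<integral>\<^sup>+x. k x y \<partial>m1) = indicator W y * emeasure m1 (U \<inter> euclid_ball n y r)" .
  qed
  finally show ?thesis .
qed

lemma measurable_emeasure_ball:
  assumes m1: "sets m1 = sets (Rn n)"
    and m2: "sigma_finite_measure m2" "sets m2 = sets (Rn n)"
    and [measurable]: "W \<in> sets (Rn n)"
  shows "(\<lambda>x. emeasure m2 (W \<inter> euclid_ball n x r)) \<in> borel_measurable m1"
proof -
  interpret m2: sigma_finite_measure m2 by fact
  note [measurable_cong] = m1 m2(2)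
  have sp: "space m1 = space (Rn n)" "space m2 = space (Rn n)"
    using sets_eq_imp_space_eq m1 m2(2) by auto
  let ?Q = "space (Rn n) \<times> W \<inter> {z \<in> space (Rn n \<Otimes>\<^sub>M Rn n). euclid_dist n (fst z) (snd z) < r}"
  have "(\<lambda>x. emeasure m2 (Pair x -` ?Q)) \<in> borel_measurable m1"
    by (rule m2.measurable_emeasure_Pair) measurable
  also have "?this \<longleftrightarrow> ?thesis"
    by (intro measurable_cong arg_cong[where f = "emeasure m2"])
       (use sets.sets_into_space[of W "Rn n"] in \<open>auto simp: euclid_ball_def space_pair_measure sp\<close>)
  finally show ?thesis .
qed

text \<open>
  Christensen's argument: two measures that give comparable mass to all small balls are comparable
  on open sets. Integrate \<open>m2 (U \<inter> B(x,r)) / s(r)\<close> over \<open>x\<close> with respect to \<open>m1\<close>, swap the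
  integrals, and let \<open>r\<close> tend to zero with Fatou's lemma.
\<close>

lemma measure_le_of_ball_bounds:
  assumes m1: "sigma_finite_measure m1" "sets m1 = sets (Rn n)"
    and m2: "sigma_finite_measure m2" "sets m2 = sets (Rn n)"
    and U[measurable]: "U \<in> sets (Rn n)"
    and s: "\<And>j :: nat. 0 < s j" "\<And>j. s j < (\<infinity> :: ennreal)"
    and upper: "\<And>j y. y \<in> U \<Longrightarrow> emeasure m1 (euclid_ball n y (r j)) \<le> s j"
    and lower: "\<And>x. x \<in> U \<Longrightarrow> eventually (\<lambda>j. s j \<le> K * emeasure m2 (U \<inter> euclid_ball n x (r j))) at_top"
  shows "emeasure m1 U \<le> K * emeasure m2 U"
proof -
  note [measurable_cong] = m1(2) m2(2)
  have meas: "(\<lambda>x. emeasure m2 (U \<inter> euclid_ball n x r)) \<in> borel_measurable m1" for r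
    using m1(2) m2 U by (rule measurable_emeasure_ball)
  have "emeasure m1 U = (\<integral>\<^sup>+x. indicator U x \<partial>m1)"
    using m1(2) by simp
  also have "\<dots> \<le> (\<integral>\<^sup>+x. liminf (\<lambda>j. indicator U x * (K * emeasure m2 (U \<inter> euclid_ball n x (r j)) / s j)) \<partial>m1)"
  proof (rule nn_integral_mono)
    fix x assume "x \<in> space m1"
    show "indicator U x \<le> liminf (\<lambda>j. indicator U x * (K * emeasure m2 (U \<inter> euclid_ball n x (r j)) / s j))"
    proof (cases "x \<in> U")
      case True
      have "eventually (\<lambda>j. 1 \<le> indicator U x * (K * emeasure m2 (U \<inter> euclid_ball n x (r j)) / s j)) at_top"
        using lower[OF True]
      proof eventually_elim
        case (elim j)
        have "1 = s j / s j" using s[of j] by (simp add: ennreal_divide_self less_top)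
        also have "\<dots> \<le> K * emeasure m2 (U \<inter> euclid_ball n x (r j)) / s j"
          using elim by (rule divide_right_mono_ennreal)
        finally show ?case using True by simp
      qed
      then show ?thesis using True by (intro Liminf_bounded) simp
    qed simp
  qed
  also have "\<dots> \<le> liminf (\<lambda>j. \<integral>\<^sup>+x. indicator U x * (K * emeasure m2 (U \<inter> euclid_ball n x (r j)) / s j) \<partial>m1)"
    by (intro nn_integral_liminf borel_measurable_times_ennreal borel_measurable_divide_ennreal meas) auto
  also have "\<dots> \<le> liminf (\<lambda>j::nat. K * emeasure m2 U)"
  proof (rule Liminf_mono, rule always_eventually, rule allI)
    fix j
    have "(\<integral>\<^sup>+x. indicator U x * (K * emeasure m2 (U \<inter> euclid_ball n x (r j)) / s j) \<partial>m1) =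
      (\<integral>\<^sup>+x. K / s j * (indicator U x * emeasure m2 (U \<inter> euclid_ball n x (r j))) \<partial>m1)"
      by (intro nn_integral_cong) (simp add: divide_ennreal_def mult_ac)
    also have "\<dots> = K / s j * (\<integral>\<^sup>+x. indicator U x * emeasure m2 (U \<inter> euclid_ball n x (r j)) \<partial>m1)"
      by (intro nn_integral_cmult borel_measurable_times_ennreal meas) auto
    also have "\<dots> \<le> K / s j * (s j * emeasure m2 U)"
    proof (rule mult_left_mono)
      have "indicator U y * emeasure m1 (U \<inter> euclid_ball n y (r j)) \<le> s j * indicator U y" for y
      proof (cases "y \<in> U")
        case True
        have "emeasure m1 (U \<inter> euclid_ball n y (r j)) \<le> emeasure m1 (euclid_ball n y (r j))"
          by (rule emeasure_mono) (auto simp: m1(2))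
        with upper[OF True, of j] True show ?thesis by (simp add: order_trans)
      qed simp
      then have "(\<integral>\<^sup>+y. indicator U y * emeasure m1 (U \<inter> euclid_ball n y (r j)) \<partial>m2) \<le> (\<integral>\<^sup>+y. s j * indicator U y \<partial>m2)"
        by (rule nn_integral_mono)
      also have "\<dots> = s j * emeasure m2 U"
        using m2(2) U by (intro nn_integral_cmult_indicator) auto
      finally show "(\<integral>\<^sup>+x. indicator U x * emeasure m2 (U \<inter> euclid_ball n x (r j)) \<partial>m1) \<le> s j * emeasure m2 U"
        using emeasure_ball_integral_swap[OF m1 m2 U U, of "r j"] by simp
    qed simp
    also have "\<dots> = K * emeasure m2 U"
      using s[of j] by (simp add: ennreal_divide_times ennreal_divide_self less_top flip: mult.assoc)
    finally show "(\<integral>\<^sup>+x. indicator U x * (K * emeasure m2 (U \<inter> euclid_ball n x (r j)) / s j) \<partial>m1) \<le> K * emeasure m2 U" .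
  qed
  also have "\<dots> = K * emeasure m2 U" by (simp add: Liminf_const)
  finally show ?thesis .
qed

section \<open>Hausdorff measure under maps that shrink distances by a bounded factor\<close>

lemma euclid_diam_lipschitz:
  assumes "c > 0" and "\<And>u v. u \<in> V \<Longrightarrow> v \<in> V \<Longrightarrow> c * euclid_dist n u v \<le> euclid_dist n (\<psi> u) (\<psi> v)"
    and "\<psi> ` V \<subseteq> U"
  shows "ennreal c * euclid_diam n V \<le> euclid_diam n U"
proof -
  have "ennreal c * euclid_diam n V = (SUP u\<in>V. SUP v\<in>V. ennreal c * ennreal (euclid_dist n u v))"
    by (simp add: euclid_diam_def SUP_mult_left_ennreal)
  also have "\<dots> \<le> euclid_diam n U"
  proof (intro SUP_least)
    fix u v assume uv: "u \<in> V" "v \<in> V"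
    have "ennreal c * ennreal (euclid_dist n u v) \<le> ennreal (euclid_dist n (\<psi> u) (\<psi> v))"
      using assms(1) assms(2)[OF uv] by (simp add: ennreal_leI flip: ennreal_mult)
    also have "\<dots> \<le> euclid_diam n U"
      unfolding euclid_diam_def using uv assms(3) by (intro SUP_upper2[of "\<psi> u"] SUP_upper) auto
    finally show "ennreal c * ennreal (euclid_dist n u v) \<le> euclid_diam n U" .
  qed
  finally show ?thesis .
qed

text \<open>A cover of \<open>F\<close> is pulled back along \<psi> to a cover of \<open>E\<close>,
  and each diameter grows at most by the factor \<open>1 / c\<close>. The mesh changes from \<delta>
  to \<open>c * \<delta>\<close>, which the supremum over all meshes does not notice.\<close>

lemma hausdorff_lipschitz:
  assumes "c > 0" "E \<subseteq> space (Rn n)"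
    and lip: "\<And>u v. u \<in> E \<Longrightarrow> v \<in> E \<Longrightarrow> c * euclid_dist n u v \<le> euclid_dist n (\<psi> u) (\<psi> v)"
    and F: "\<psi> ` E \<subseteq> F"
  shows "ennreal c ^ k * hausdorff n k E \<le> hausdorff n k F"
proof -
  have pre: "ennreal c ^ k * hausdorff_pre n k \<delta> E \<le> hausdorff_pre n k (c * \<delta>) F" if "\<delta> > 0" for \<delta>
    unfolding hausdorff_pre_def[of n k "c * \<delta>"]
  proof (rule INF_greatest, safe)
    fix U :: "nat \<Rightarrow> (nat \<Rightarrow> real) set"
    assume U: "F \<subseteq> (\<Union>j. U j)" "\<forall>j. U j \<subseteq> space (Rn n) \<and> euclid_diam n (U j) \<le> ennreal (c * \<delta>)"
    define V where "V = (\<lambda>j :: nat. E \<inter> \<psi> -` U j)"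
    have diam: "ennreal c * euclid_diam n (V j) \<le> euclid_diam n (U j)" for j
      using assms(1) lip by (intro euclid_diam_lipschitz[where \<psi> = \<psi>]) (auto simp: V_def)
    have "ennreal c * euclid_diam n (V j) \<le> ennreal c * ennreal \<delta>" for j
      using order_trans[OF diam[of j], of "ennreal (c * \<delta>)"] U(2) assms(1) that by (simp add: ennreal_mult)
    then have "euclid_diam n (V j) \<le> ennreal \<delta>" for j
      using assms(1) by (simp add: ennreal_mult_le_mult_iff)
    moreover have "E \<subseteq> (\<Union>j. V j)" using F U(1) by (force simp: V_def)
    ultimately have "hausdorff_pre n k \<delta> E \<le> (\<Sum>j. hausdorff_weight n k (V j))"
      unfolding hausdorff_pre_def using assms(2) by (intro INF_lower) (auto simp: V_def)
    then have "ennreal c ^ k * hausdorff_pre n k \<delta> E \<le> ennreal c ^ k * (\<Sum>j. hausdorff_weight n k (V j))"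
      by (intro mult_left_mono) auto
    also have "\<dots> = (\<Sum>j. ennreal c ^ k * hausdorff_weight n k (V j))"
      by simp
    also have "\<dots> \<le> (\<Sum>j. hausdorff_weight n k (U j))"
    proof (intro suminf_le)
      fix j
      show "ennreal c ^ k * hausdorff_weight n k (V j) \<le> hausdorff_weight n k (U j)"
      \<comment> \<open>A nonempty pullback comes from a nonempty set, so the convention for the
        empty set is respected also for k = 0.\<close>
      proof (cases "V j = {}")
        case False
        then have "U j \<noteq> {}" by (auto simp: V_def)
        then show ?thesis
          using False power_mono[OF diam[of j], of k] by (simp add: hausdorff_weight_def power_mult_distrib)
      qed (simp add: hausdorff_weight_def)
    qed auto
    finally show "ennreal c ^ k * hausdorff_pre n k \<delta> E \<le> (\<Sum>j. hausdorff_weight n k (U j))" .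
  qed
  have "ennreal c ^ k * hausdorff n k E = (SUP \<delta>\<in>{0<..}. ennreal c ^ k * hausdorff_pre n k \<delta> E)"
    unfolding hausdorff_def by (rule SUP_mult_left_ennreal)
  also have "\<dots> \<le> hausdorff n k F"
  proof (rule SUP_least)
    fix \<delta> :: real assume "\<delta> \<in> {0<..}"
    then show "ennreal c ^ k * hausdorff_pre n k \<delta> E \<le> hausdorff n k F"
      unfolding hausdorff_def using pre[of \<delta>] assms(1) by (intro SUP_upper2[of "c * \<delta>"]) auto
  qed
  finally show ?thesis .
qed

lemma two_times_ennreal_half: "2 * ennreal (1 / 2) = 1"
proof -
  have "2 * ennreal (1 / 2) = ennreal 2 * ennreal (1 / 2)" by (simp only: ennreal_numeral)
  also have "\<dots> = ennreal (2 * (1 / 2))" by (rule ennreal_mult[symmetric]) auto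
  also have "2 * (1 / 2) = (1 :: real)" by simp
  finally show ?thesis by (simp only: ennreal_1)
qed

lemma emeasure_measure_of_total:
  assumes N: "N = measure_of (space M) (sets M) f" and "emeasure N (space N) \<noteq> 0" and "A \<in> sets M"
  shows "emeasure N A = f A"
proof -
  have "measure_space (space M) (sigma_sets (space M) (sets M)) f"
    using assms(2) unfolding N by (auto simp: emeasure_measure_of_conv split: if_splits)
  then show ?thesis
    using assms(3) unfolding N by (simp add: emeasure_measure_of_conv sets.sigma_sets_eq)
qed

section \<open>Local geometry of the sphere\<close>

definition ip :: "nat \<Rightarrow> (nat \<Rightarrow> real) \<Rightarrow> (nat \<Rightarrow> real) \<Rightarrow> real" where
  "ip n u v = (\<Sum>i\<in>{1..n}. u i * v i)"

lemma ip_commute: "ip n u v = ip n v u"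
  by (simp add: ip_def mult.commute)

lemma ip_diff_right: "ip n u (\<lambda>i. v i - w i) = ip n u v - ip n u w"
  by (simp add: ip_def right_diff_distrib sum_subtractf)

lemma ip_diff_left: "ip n (\<lambda>i. v i - w i) u = ip n v u - ip n w u"
  by (simp add: ip_def left_diff_distrib sum_subtractf)

lemma ip_scale_right: "ip n u (\<lambda>i. c * v i) = c * ip n u v"
  by (simp add: ip_def sum_distrib_left mult_ac)

lemma ip_scale_left: "ip n (\<lambda>i. c * v i) u = c * ip n v u"
  by (simp add: ip_def sum_distrib_left mult_ac)

lemma ip_self_nonneg [simp]: "ip n u u \<ge> 0"
  by (simp add: ip_def sum_nonneg)

lemma L2_set_eq_sqrt_ip: "L2_set u {1..n} = sqrt (ip n u u)"
  by (simp add: L2_set_def ip_def power2_eq_square)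

lemma euclid_dist_eq_sqrt_ip: "euclid_dist n u v = sqrt (ip n (\<lambda>i. u i - v i) (\<lambda>i. u i - v i))"
  by (simp add: euclid_dist_def L2_set_eq_sqrt_ip)

text \<open>Differentiability in the strict sense, uniformly in the base point: by the mean value
  theorem the slope between u and v is \<phi>' at an intermediate point, hence close to \<phi>' at
  s. Lipschitz estimates compare two moving points, which the usual derivative at s does not
  control.\<close>

lemma uniform_strict_derivative:
  fixes \<phi> \<phi>' :: "real \<Rightarrow> real"
  assumes deriv: "\<And>t. lo \<le> t \<Longrightarrow> t \<le> hi \<Longrightarrow> (\<phi> has_field_derivative \<phi>' t) (at t)"
    and cont: "continuous_on {lo..hi} \<phi>'" and "\<epsilon> > 0"
  shows "\<exists>r>0. \<forall>s\<in>{lo..hi}. \<forall>u\<in>{lo..hi}. \<forall>v\<in>{lo..hi}. \<bar>u - s\<bar> < r \<longrightarrow> \<bar>v - s\<bar> < r \<longrightarrow>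
    \<bar>\<phi> u - \<phi> v - \<phi>' s * (u - v)\<bar> \<le> \<epsilon> * \<bar>u - v\<bar>"
proof -
  have "uniformly_continuous_on {lo..hi} \<phi>'"
    using cont by (rule compact_uniformly_continuous) simp
  then obtain r where r: "r > 0" "\<And>s t. s \<in> {lo..hi} \<Longrightarrow> t \<in> {lo..hi} \<Longrightarrow> dist t s < r \<Longrightarrow> dist (\<phi>' t) (\<phi>' s) < \<epsilon>"
    using assms(3) by (metis uniformly_continuous_on_def)
  have *: "\<bar>\<phi> u - \<phi> v - \<phi>' s * (u - v)\<bar> \<le> \<epsilon> * \<bar>u - v\<bar>"
    if "s \<in> {lo..hi}" "u \<in> {lo..hi}" "v \<in> {lo..hi}" "\<bar>u - s\<bar> < r" "\<bar>v - s\<bar> < r" "v < u" for s u v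
  proof -
    have "\<exists>z>v. z < u \<and> \<phi> u - \<phi> v = (u - v) * \<phi>' z"
      using that by (intro MVT2 deriv) auto
    then obtain z where z: "v < z" "z < u" "\<phi> u - \<phi> v = (u - v) * \<phi>' z" by blast
    have "\<bar>\<phi>' z - \<phi>' s\<bar> < \<epsilon>"
      using r(2)[of s z] that z by (auto simp: dist_real_def)
    then have "\<bar>u - v\<bar> * \<bar>\<phi>' z - \<phi>' s\<bar> \<le> \<bar>u - v\<bar> * \<epsilon>" by (intro mult_left_mono) auto
    moreover have "\<phi> u - \<phi> v - \<phi>' s * (u - v) = (u - v) * (\<phi>' z - \<phi>' s)"
      by (simp add: z(3) algebra_simps)
    ultimately show ?thesis by (simp add: abs_mult mult.commute)
  qed
  show ?thesis
  proof (intro exI[of _ r] conjI ballI impI r)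
    fix s u v assume A: "s \<in> {lo..hi}" "u \<in> {lo..hi}" "v \<in> {lo..hi}" "\<bar>u - s\<bar> < r" "\<bar>v - s\<bar> < r"
    consider "v < u" | "u = v" | "u < v" by linarith
    then show "\<bar>\<phi> u - \<phi> v - \<phi>' s * (u - v)\<bar> \<le> \<epsilon> * \<bar>u - v\<bar>"
    proof cases
      case 3
      have "\<phi> u - \<phi> v - \<phi>' s * (u - v) = - (\<phi> v - \<phi> u - \<phi>' s * (v - u))"
        by (simp add: algebra_simps)
      then show ?thesis
        using *[OF A(1,3,2,5,4) 3] by (simp only: abs_minus_cancel abs_minus_commute[of u v])
    qed (use *[OF A] in auto)
  qed
qed

text \<open>At distance \<delta> from the coordinate hyperplanes the norm is continuously
  differentiable with a uniform modulus, also for p = 1.\<close>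

definition sphere_interior :: "real \<Rightarrow> nat \<Rightarrow> real \<Rightarrow> (nat \<Rightarrow> real) set" where
  "sphere_interior p n \<delta> = {x \<in> lp_sphere p n. \<forall>i\<in>{1..n}. \<delta> < \<bar>x i\<bar>}"

text \<open>The gradient of the norm at points of the unit sphere; elsewhere it would carry the
  additional factor \<open>lp_norm powr (1 - p)\<close>.\<close>

definition lp_grad :: "real \<Rightarrow> (nat \<Rightarrow> real) \<Rightarrow> nat \<Rightarrow> real" where
  "lp_grad p x = (\<lambda>i. \<bar>x i\<bar> powr (p - 1) * sgn (x i))"

lemma sphere_sum:
  assumes "p > 0" "x \<in> lp_sphere p n" shows "(\<Sum>i\<in>{1..n}. \<bar>x i\<bar> powr p) = 1"
proof -
  define s where "s = (\<Sum>i\<in>{1..n}. \<bar>x i\<bar> powr p)"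
  have "s \<ge> 0" by (simp add: s_def sum_nonneg)
  then have "s = (s powr (1 / p)) powr p" using assms(1) by (simp add: powr_powr)
  also have "s powr (1 / p) = 1" using assms(2) by (simp add: lp_sphere_def lp_norm_def s_def)
  finally show ?thesis by (simp add: s_def)
qed

lemma sphere_component_le_1:
  assumes "p > 0" "x \<in> lp_sphere p n" "i \<in> {1..n}" shows "\<bar>x i\<bar> \<le> 1"
proof -
  have "\<bar>x i\<bar> powr p \<le> (\<Sum>i\<in>{1..n}. \<bar>x i\<bar> powr p)"
    using assms by (intro member_le_sum) auto
  then have "\<bar>x i\<bar> powr p \<le> 1" using sphere_sum[OF assms(1,2)] by simp
  then show ?thesis
    using assms(1) gr_one_powr[of "\<bar>x i\<bar>" p] by linarith
qed

text \<open>The chain rule with uniform errors: strict differentiability of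
  \<open>\<bar>t\<bar> powr p\<close> in each coordinate gives that of the sum of powers, and
  composing with \<open>s powr (1 / p)\<close> near s = 1 gives that of the norm.\<close>

lemma lp_norm_strict_derivative:
  assumes "p \<ge> 1" "n \<ge> 1" "\<delta> > 0" "\<epsilon> > 0"
  shows "\<exists>r>0. \<forall>x\<in>sphere_interior p n \<delta>. \<forall>u v. euclid_dist n x u < r \<longrightarrow> euclid_dist n x v < r \<longrightarrow>
    \<bar>lp_norm p n u - lp_norm p n v - ip n (lp_grad p x) (\<lambda>i. u i - v i)\<bar> \<le> \<epsilon> * euclid_dist n u v"
proof -
  \<comment> \<open>A Lipschitz constant of the sum of powers near the sphere: \<open>n * p\<close>
    from its gradient and n from an error term with \<open>\<epsilon>1 \<le> 1\<close>.\<close>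
  define N where "N = real n * (p + 1)"
  have N: "N > 0" using assms by (simp add: N_def)
  \<comment> \<open>Each of the two layers of the chain rule may consume half of \<epsilon>.\<close>
  define \<epsilon>1 where "\<epsilon>1 = min 1 (\<epsilon> / (2 * real n))"
  define \<epsilon>2 where "\<epsilon>2 = \<epsilon> / (2 * N)"
  have e1: "0 < \<epsilon>1" "\<epsilon>1 \<le> 1" "\<epsilon>1 * real n \<le> \<epsilon> / 2"
    using assms by (auto simp: \<epsilon>1_def min_def field_simps)
  have e2: "0 < \<epsilon>2" "\<epsilon>2 * N = \<epsilon> / 2" using assms N by (auto simp: \<epsilon>2_def)
  have "\<exists>r>0. \<forall>s\<in>{\<delta>/2..2}. \<forall>u\<in>{\<delta>/2..2}. \<forall>v\<in>{\<delta>/2..2}. \<bar>u - s\<bar> < r \<longrightarrow> \<bar>v - s\<bar> < r \<longrightarrow>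
      \<bar>u powr p - v powr p - p * s powr (p - 1) * (u - v)\<bar> \<le> \<epsilon>1 * \<bar>u - v\<bar>"
    using assms e1 by (intro uniform_strict_derivative)
      (auto intro!: derivative_eq_intros continuous_intros)
  then obtain r1 where r1: "r1 > 0" "\<And>s u v. s \<in> {\<delta>/2..2} \<Longrightarrow> u \<in> {\<delta>/2..2} \<Longrightarrow> v \<in> {\<delta>/2..2} \<Longrightarrow> \<bar>u - s\<bar> < r1 \<Longrightarrow> \<bar>v - s\<bar> < r1 \<Longrightarrow>
      \<bar>u powr p - v powr p - p * s powr (p - 1) * (u - v)\<bar> \<le> \<epsilon>1 * \<bar>u - v\<bar>"
    by blast
  have "\<exists>r>0. \<forall>s\<in>{1/2..2}. \<forall>u\<in>{1/2..2}. \<forall>v\<in>{1/2..2}. \<bar>u - s\<bar> < r \<longrightarrow> \<bar>v - s\<bar> < r \<longrightarrow>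
      \<bar>u powr (1 / p) - v powr (1 / p) - 1 / p * s powr (1 / p - 1) * (u - v)\<bar> \<le> \<epsilon>2 * \<bar>u - v\<bar>"
    using assms e2 by (intro uniform_strict_derivative)
      (auto intro!: derivative_eq_intros continuous_intros)
  then obtain r2 where r2: "r2 > 0" "\<And>u v. u \<in> {1/2..2} \<Longrightarrow> v \<in> {1/2..2} \<Longrightarrow> \<bar>u - 1\<bar> < r2 \<Longrightarrow> \<bar>v - 1\<bar> < r2 \<Longrightarrow>
      \<bar>u powr (1 / p) - v powr (1 / p) - 1 / p * (u - v)\<bar> \<le> \<epsilon>2 * \<bar>u - v\<bar>"
    using bspec[of "{1/2..2::real}" _ 1] by force
  \<comment> \<open>Within r no coordinate changes sign or leaves \<open>[\<delta>/2, 2]\<close>,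
    and the sum of powers stays within \<open>r2\<close> of 1 and inside
    \<open>[1/2, 2]\<close>.\<close>
  define r where "r = min (min r1 (min (\<delta> / 2) 1)) (min r2 (1 / 2) / N)"
  have r: "r > 0" "r \<le> r1" "r \<le> \<delta> / 2" "r \<le> 1" "N * r \<le> r2" "N * r \<le> 1 / 2"
  proof -
    show "r > 0" using r1 r2 assms N by (auto simp: r_def)
    show "r \<le> r1" "r \<le> \<delta> / 2" "r \<le> 1"
      unfolding r_def by (meson min.cobounded1 min.cobounded2 order_trans)+
    have "N * r \<le> N * (min r2 (1 / 2) / N)" using N by (intro mult_left_mono) (auto simp: r_def)
    then show "N * r \<le> r2" "N * r \<le> 1 / 2" using N by auto
  qed
  show ?thesis
  proof (intro exI[of _ r] conjI ballI allI impI r)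
    fix x u v assume x: "x \<in> sphere_interior p n \<delta>" and u: "euclid_dist n x u < r" and v: "euclid_dist n x v < r"
    let ?F = "\<lambda>u. \<Sum>i\<in>{1..n}. \<bar>u i\<bar> powr p"
    have xS: "x \<in> lp_sphere p n" using x by (simp add: sphere_interior_def)
    have x_comp: "\<delta> < \<bar>x i\<bar>" "\<bar>x i\<bar> \<le> 1" if "i \<in> {1..n}" for i
      using x that sphere_component_le_1[OF _ xS that] assms by (auto simp: sphere_interior_def)
    have Fx: "?F x = 1" using sphere_sum[OF _ xS] assms by simp
    have comp: "\<bar>\<bar>u i\<bar> powr p - \<bar>v i\<bar> powr p - p * (lp_grad p x i * (u i - v i))\<bar> \<le> \<epsilon>1 * euclid_dist n u v"
      if i: "i \<in> {1..n}" and u: "euclid_dist n x u < r" and v: "euclid_dist n x v < r" for i u v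
    proof -
      have ui: "\<bar>u i - x i\<bar> < r" and vi: "\<bar>v i - x i\<bar> < r"
        using component_le_euclid_dist[OF i, of x u] component_le_euclid_dist[OF i, of x v] u v by auto
      have sgn: "\<bar>u i\<bar> - \<bar>v i\<bar> = sgn (x i) * (u i - v i)"
        using ui vi x_comp[OF i] r(3) assms(3) by (cases "x i > 0") (auto simp: sgn_if)
      have "\<bar>\<bar>u i\<bar> powr p - \<bar>v i\<bar> powr p - p * \<bar>x i\<bar> powr (p - 1) * (\<bar>u i\<bar> - \<bar>v i\<bar>)\<bar> \<le> \<epsilon>1 * \<bar>\<bar>u i\<bar> - \<bar>v i\<bar>\<bar>"
        using ui vi x_comp[OF i] r assms(3) by (intro r1(2)) auto
      also have "\<dots> \<le> \<epsilon>1 * euclid_dist n u v"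
        using component_le_euclid_dist[OF i, of u v] e1 by (intro mult_left_mono) auto
      finally show ?thesis unfolding sgn by (simp add: lp_grad_def mult_ac)
    qed
    have F_diff: "\<bar>?F u - ?F v - p * ip n (lp_grad p x) (\<lambda>i. u i - v i)\<bar> \<le> \<epsilon>1 * real n * euclid_dist n u v"
      if u: "euclid_dist n x u < r" and v: "euclid_dist n x v < r" for u v
    proof -
      have "?F u - ?F v - p * ip n (lp_grad p x) (\<lambda>i. u i - v i) =
        (\<Sum>i\<in>{1..n}. \<bar>u i\<bar> powr p - \<bar>v i\<bar> powr p - p * (lp_grad p x i * (u i - v i)))"
        by (simp add: ip_def sum_subtractf sum_distrib_left)
      also have "\<bar>\<dots>\<bar> \<le> (\<Sum>i\<in>{1..n}. \<epsilon>1 * euclid_dist n u v)"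
        using comp u v by (intro order_trans[OF sum_abs] sum_mono)
      finally show ?thesis by (simp add: mult_ac)
    qed
    have ip_le: "\<bar>ip n (lp_grad p x) (\<lambda>i. u i - v i)\<bar> \<le> real n * euclid_dist n u v" for u v
    proof -
      have "\<bar>ip n (lp_grad p x) (\<lambda>i. u i - v i)\<bar> \<le> (\<Sum>i\<in>{1..n}. \<bar>lp_grad p x i * (u i - v i)\<bar>)"
        unfolding ip_def by (rule sum_abs)
      also have "\<dots> \<le> (\<Sum>i\<in>{1..n}. euclid_dist n u v)"
      proof (rule sum_mono)
        fix i assume i: "i \<in> {1..n}"
        have "\<bar>lp_grad p x i\<bar> \<le> 1"
          using x_comp[OF i] assms by (auto simp: lp_grad_def abs_mult sgn_if powr_le1)
        then have "\<bar>lp_grad p x i\<bar> * \<bar>u i - v i\<bar> \<le> 1 * euclid_dist n u v"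
          using component_le_euclid_dist[OF i, of u v] by (intro mult_mono) auto
        then show "\<bar>lp_grad p x i * (u i - v i)\<bar> \<le> euclid_dist n u v" by (simp add: abs_mult)
      qed
      finally show ?thesis by simp
    qed
    have F_lip: "\<bar>?F u - ?F v\<bar> \<le> N * euclid_dist n u v"
      if u: "euclid_dist n x u < r" and v: "euclid_dist n x v < r" for u v
    proof -
      have "\<bar>?F u - ?F v\<bar> \<le> \<epsilon>1 * real n * euclid_dist n u v + p * \<bar>ip n (lp_grad p x) (\<lambda>i. u i - v i)\<bar>"
      proof -
        have "\<bar>a\<bar> \<le> c + \<bar>b\<bar>" if "\<bar>a - b\<bar> \<le> c" for a b c :: real
          using that by linarith
        from this[OF F_diff[OF u v]] show ?thesis
          using assms(1) by (simp only: abs_mult)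
      qed
      also have "\<dots> \<le> 1 * real n * euclid_dist n u v + p * (real n * euclid_dist n u v)"
        using e1 ip_le assms by (intro add_mono mult_right_mono mult_left_mono) auto
      finally show ?thesis by (simp add: N_def algebra_simps)
    qed
    have F_near: "?F u \<in> {1/2..2}" "\<bar>?F u - 1\<bar> < r2" if u: "euclid_dist n x u < r" for u
    proof -
      have "\<bar>?F u - 1\<bar> \<le> N * euclid_dist n x u"
        using F_lip[OF u, of x] r Fx by (simp add: euclid_dist_commute)
      also have "\<dots> < N * r" using u N by simp
      finally have "\<bar>?F u - 1\<bar> < N * r" .
      then show "?F u \<in> {1/2..2}" "\<bar>?F u - 1\<bar> < r2" using r by (auto simp: abs_less_iff)
    qed
    have "\<bar>lp_norm p n u - lp_norm p n v - 1 / p * (?F u - ?F v)\<bar> \<le> \<epsilon>2 * \<bar>?F u - ?F v\<bar>"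
      unfolding lp_norm_def using F_near[OF u] F_near[OF v] by (intro r2(2))
    also have "\<dots> \<le> \<epsilon>2 * (N * euclid_dist n u v)"
      using F_lip[OF u v] e2 by (intro mult_left_mono) auto
    also have "\<dots> = \<epsilon> / 2 * euclid_dist n u v" using e2 by simp
    finally have 1: "\<bar>lp_norm p n u - lp_norm p n v - 1 / p * (?F u - ?F v)\<bar> \<le> \<epsilon> / 2 * euclid_dist n u v" .
    have "\<bar>1 / p * (?F u - ?F v) - ip n (lp_grad p x) (\<lambda>i. u i - v i)\<bar> =
      1 / p * \<bar>?F u - ?F v - p * ip n (lp_grad p x) (\<lambda>i. u i - v i)\<bar>"
    proof -
      have "\<bar>1 / p * a - b\<bar> = 1 / p * \<bar>a - p * b\<bar>" for a b
      proof -
        have "1 / p * a - b = 1 / p * (a - p * b)" using assms(1) by (simp add: field_simps)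
        then show ?thesis using assms(1) by (simp add: abs_mult)
      qed
      then show ?thesis .
    qed
    also have "\<dots> \<le> 1 * (\<epsilon>1 * real n * euclid_dist n u v)"
      using assms F_diff[OF u v] by (intro mult_mono) auto
    also have "\<dots> \<le> \<epsilon> / 2 * euclid_dist n u v"
      using mult_right_mono[OF e1(3), of "euclid_dist n u v"] by simp
    finally show "\<bar>lp_norm p n u - lp_norm p n v - ip n (lp_grad p x) (\<lambda>i. u i - v i)\<bar> \<le> \<epsilon> * euclid_dist n u v"
      using 1 by linarith
  qed
qed

section \<open>Reflections and similarities matching tangent hyperplanes\<close>

text \<open>
  The reflection exchanging the unit vectors \<open>\<alpha>\<close> and \<open>\<beta>\<close>; if they coincide, the division by zero
  makes it the identity.
\<close>

definition householder :: "nat \<Rightarrow> (nat \<Rightarrow> real) \<Rightarrow> (nat \<Rightarrow> real) \<Rightarrow> (nat \<Rightarrow> real) \<Rightarrow> nat \<Rightarrow> real" where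
  "householder n \<alpha> \<beta> v = (\<lambda>i. v i - 2 * ip n (\<lambda>i. \<alpha> i - \<beta> i) v / ip n (\<lambda>i. \<alpha> i - \<beta> i) (\<lambda>i. \<alpha> i - \<beta> i) * (\<alpha> i - \<beta> i))"

lemma householder_diff: "householder n \<alpha> \<beta> (\<lambda>i. u i - v i) = (\<lambda>i. householder n \<alpha> \<beta> u i - householder n \<alpha> \<beta> v i)"
  by (rule ext) (simp add: householder_def ip_diff_right diff_divide_distrib algebra_simps)

lemma householder_scale: "householder n \<alpha> \<beta> (\<lambda>i. c * v i) = (\<lambda>i. c * householder n \<alpha> \<beta> v i)"
  by (rule ext) (simp add: householder_def ip_scale_right algebra_simps)

lemma householder_eq:
  assumes "e = (\<lambda>i. \<alpha> i - \<beta> i)"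
  shows "householder n \<alpha> \<beta> v = (\<lambda>i. v i - 2 * ip n e v / ip n e e * e i)"
  by (simp add: householder_def assms)

lemma ip_householder: "ip n (householder n \<alpha> \<beta> u) (householder n \<alpha> \<beta> v) = ip n u v"
proof -
  define e where "e = (\<lambda>i. \<alpha> i - \<beta> i)"
  define q where "q = ip n e e"
  have "ip n (\<lambda>i. u i - a * e i) (\<lambda>i. v i - b * e i) = ip n u v - a * ip n e v - b * ip n e u + a * b * q" for a b
    by (simp only: ip_diff_left ip_diff_right ip_scale_left ip_scale_right)
       (simp add: q_def ip_commute[of n u e] algebra_simps)
  note * = this[of "2 * ip n e u / q" "2 * ip n e v / q"]
  show ?thesis
    unfolding householder_eq[OF e_def] q_def[symmetric] *
    by (cases "q = 0") (simp_all add: mult_ac)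
qed

lemma householder_involution:
  "householder n \<alpha> \<beta> (householder n \<alpha> \<beta> v) = v"
proof -
  define e where "e = (\<lambda>i. \<alpha> i - \<beta> i)"
  define q where "q = ip n e e"
  have "ip n e (householder n \<alpha> \<beta> v) = ip n e v - 2 * ip n e v / q * q"
    unfolding householder_eq[OF e_def] q_def[symmetric]
    by (simp only: ip_diff_right ip_scale_right) (simp add: q_def)
  then show ?thesis
    unfolding householder_eq[OF e_def, of n "householder n \<alpha> \<beta> v"] q_def[symmetric]
    unfolding householder_eq[OF e_def, of n v] q_def[symmetric]
    by (cases "q = 0") auto
qed

text \<open>The reflection is self-adjoint and exchanges the unit vectors, so it carries the linear
  form of \<alpha> to that of \<beta>. If q = 0, then the two vectors agree on
  \<open>{1..n}\<close>.\<close>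

lemma ip_householder_right:
  assumes "ip n \<alpha> \<alpha> = 1" "ip n \<beta> \<beta> = 1"
  shows "ip n \<beta> (householder n \<alpha> \<beta> v) = ip n \<alpha> v"
proof -
  define e where "e = (\<lambda>i. \<alpha> i - \<beta> i)"
  define q where "q = ip n e e"
  have q: "q = 2 - 2 * ip n \<alpha> \<beta>"
    using assms by (simp add: q_def e_def ip_diff_left ip_diff_right ip_commute[of n \<beta> \<alpha>])
  have eb: "ip n \<beta> e = - q / 2"
    using assms by (simp add: q e_def ip_diff_right ip_commute[of n \<beta> \<alpha>])
  have ev: "ip n e v = ip n \<alpha> v - ip n \<beta> v" by (simp add: e_def ip_diff_left)
  have "ip n \<beta> (householder n \<alpha> \<beta> v) = ip n \<beta> v - 2 * ip n e v / q * ip n \<beta> e"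
    unfolding householder_eq[OF e_def] q_def[symmetric]
    by (simp only: ip_diff_right ip_scale_right)
  also have "\<dots> = ip n \<alpha> v"
  proof (cases "q = 0")
    case True
    then have "\<forall>i\<in>{1..n}. e i = 0"
      by (auto simp: q_def ip_def sum_nonneg_eq_0_iff)
    then have "ip n e v = 0" by (simp add: ip_def)
    with ev True show ?thesis by simp
  next
    case False
    then have "2 * c / q * (- q / 2) = - c" for c by simp
    then show ?thesis by (simp only: eb ev)
  qed
  finally show ?thesis .
qed

text \<open>It takes x to y, scales distances by \<tau> and, when \<alpha> and \<beta> are unit
  normals at x and y, maps the one tangent hyperplane onto the other.\<close>

definition similarity :: "nat \<Rightarrow> real \<Rightarrow> (nat \<Rightarrow> real) \<Rightarrow> (nat \<Rightarrow> real) \<Rightarrow> (nat \<Rightarrow> real) \<Rightarrow> (nat \<Rightarrow> real) \<Rightarrow> (nat \<Rightarrow> real) \<Rightarrow> nat \<Rightarrow> real" where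
  "similarity n \<tau> \<alpha> \<beta> x y z = (\<lambda>i\<in>{1..n}. y i + \<tau> * householder n \<alpha> \<beta> (\<lambda>i. z i - x i) i)"

lemma ip_cong: "(\<And>i. i \<in> {1..n} \<Longrightarrow> u i = u' i) \<Longrightarrow> (\<And>i. i \<in> {1..n} \<Longrightarrow> v i = v' i) \<Longrightarrow> ip n u v = ip n u' v'"
  by (simp add: ip_def)

lemma similarity_space [simp]: "similarity n \<tau> \<alpha> \<beta> x y z \<in> space (Rn n)"
  by (simp add: similarity_def space_Rn)

lemma similarity_diff:
  "i \<in> {1..n} \<Longrightarrow> similarity n \<tau> \<alpha> \<beta> x y u i - similarity n \<tau> \<alpha> \<beta> x y v i = \<tau> * householder n \<alpha> \<beta> (\<lambda>i. u i - v i) i"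
  by (simp add: similarity_def householder_diff algebra_simps)

lemma euclid_dist_similarity:
  assumes "\<tau> \<ge> 0"
  shows "euclid_dist n (similarity n \<tau> \<alpha> \<beta> x y u) (similarity n \<tau> \<alpha> \<beta> x y v) = \<tau> * euclid_dist n u v"
proof -
  let ?h = "\<lambda>i. \<tau> * householder n \<alpha> \<beta> (\<lambda>i. u i - v i) i"
  have "euclid_dist n (similarity n \<tau> \<alpha> \<beta> x y u) (similarity n \<tau> \<alpha> \<beta> x y v) = sqrt (ip n ?h ?h)"
    unfolding euclid_dist_eq_sqrt_ip by (intro arg_cong[where f = sqrt] ip_cong similarity_diff)
  also have "\<dots> = \<tau> * euclid_dist n u v"
    using assms by (simp only: ip_scale_left ip_scale_right ip_householder euclid_dist_eq_sqrt_ip)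
      (simp add: real_sqrt_mult)
  finally show ?thesis .
qed

lemma similarity_base: "y \<in> space (Rn n) \<Longrightarrow> similarity n \<tau> \<alpha> \<beta> x y x = y"
  by (auto simp: similarity_def householder_def ip_def space_Rn extensional_def fun_eq_iff)

lemma similarity_surj:
  assumes "\<tau> > 0" "w \<in> space (Rn n)"
  shows "\<exists>z\<in>space (Rn n). similarity n \<tau> \<alpha> \<beta> x y z = w"
proof
  let ?z = "\<lambda>i\<in>{1..n}. x i + 1 / \<tau> * householder n \<alpha> \<beta> (\<lambda>i. w i - y i) i"
  show "?z \<in> space (Rn n)" by (simp add: space_Rn)
  have *: "householder n \<alpha> \<beta> (\<lambda>i. ?z i - x i) i = 1 / \<tau> * (w i - y i)" if "i \<in> {1..n}" for i
  proof -
    have "ip n e (\<lambda>i. ?z i - x i) = ip n e (\<lambda>i. 1 / \<tau> * householder n \<alpha> \<beta> (\<lambda>i. w i - y i) i)" for e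
      by (intro ip_cong) auto
    then have "householder n \<alpha> \<beta> (\<lambda>i. ?z i - x i) i = householder n \<alpha> \<beta> (\<lambda>i. 1 / \<tau> * householder n \<alpha> \<beta> (\<lambda>i. w i - y i) i) i"
      unfolding householder_def[of n \<alpha> \<beta> "\<lambda>i. ?z i - x i"]
        householder_def[of n \<alpha> \<beta> "\<lambda>i. 1 / \<tau> * householder n \<alpha> \<beta> (\<lambda>i. w i - y i) i"]
      using that by simp
    also have "\<dots> = 1 / \<tau> * (w i - y i)"
      by (simp only: householder_scale householder_involution)
    finally show ?thesis .
  qed
  show "similarity n \<tau> \<alpha> \<beta> x y ?z = w"
  proof
    fix i
    show "similarity n \<tau> \<alpha> \<beta> x y ?z i = w i"
    proof (cases "i \<in> {1..n}")
      case True
      then have "similarity n \<tau> \<alpha> \<beta> x y ?z i = y i + \<tau> * householder n \<alpha> \<beta> (\<lambda>i. ?z i - x i) i"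
        by (simp add: similarity_def)
      then show ?thesis using *[OF True] assms(1) by simp
    next
      case False
      then show ?thesis using assms(2) by (simp add: similarity_def space_Rn extensional_def del: atLeastAtMost_iff)
    qed
  qed
qed

lemma measurable_similarity [measurable]: "similarity n \<tau> \<alpha> \<beta> x y \<in> Rn n \<rightarrow>\<^sub>M Rn n"
proof (rule measurable_RnI)
  fix i assume i: "i \<in> {1..n}"
  have "(\<lambda>z. y i + \<tau> * householder n \<alpha> \<beta> (\<lambda>i. z i - x i) i) \<in> borel_measurable (Rn n)"
    unfolding householder_def ip_def using i by measurable
  then show "(\<lambda>z. similarity n \<tau> \<alpha> \<beta> x y z i) \<in> borel_measurable (Rn n)"
    using i by (simp add: similarity_def)
qed (simp add: similarity_def)

section \<open>Volumes of Euclidean balls and images of open sets\<close>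

definition unit_ball_volume :: "nat \<Rightarrow> ennreal" where
  "unit_ball_volume n = emeasure (Rn n) (euclid_ball n (\<lambda>i\<in>{1..n}. 0) 1)"

lemma unit_ball_volume_finite: "unit_ball_volume n < \<infinity>"
proof -
  have "euclid_ball n (\<lambda>i\<in>{1..n}. 0) 1 \<subseteq> (\<Pi>\<^sub>E i\<in>{1..n}. {-1..1})"
  proof
    fix x assume x: "x \<in> euclid_ball n (\<lambda>i\<in>{1..n}. 0) 1"
    have "x i \<in> {-1..1}" if "i \<in> {1..n}" for i
      using component_le_euclid_dist[OF that, of "\<lambda>i\<in>{1..n}. 0" x] x that
      by (auto simp: euclid_ball_def abs_le_iff)
    then show "x \<in> (\<Pi>\<^sub>E i\<in>{1..n}. {-1..1})"
      using x by (auto simp: euclid_ball_def space_Rn PiE_def)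
  qed
  moreover have "(\<Pi>\<^sub>E i\<in>{1..n}. {-1..1::real}) \<in> sets (Rn n)"
    unfolding Rn_def by (intro sets_PiM_I_finite) auto
  ultimately have "unit_ball_volume n \<le> emeasure (Rn n) (\<Pi>\<^sub>E i\<in>{1..n}. {-1..1})"
    unfolding unit_ball_volume_def by (intro emeasure_mono)
  also have "\<dots> = (\<Prod>i\<in>{1..n}. ennreal 2)"
    unfolding Rn_def by (subst lborel_product.emeasure_PiM) auto
  also have "\<dots> < \<infinity>" by (simp add: ennreal_power flip: ennreal_numeral)
  finally show ?thesis .
qed

lemma unit_ball_volume_pos: "unit_ball_volume n > 0"
proof -
  define e where "e = 1 / (real n + 1)"
  have e: "e > 0" "real n * e < 1" by (auto simp: e_def)
  have "(\<Pi>\<^sub>E i\<in>{1..n}. {-e..e}) \<subseteq> euclid_ball n (\<lambda>i\<in>{1..n}. 0) 1"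
  proof
    fix x assume x: "x \<in> (\<Pi>\<^sub>E i\<in>{1..n}. {-e..e})"
    have "euclid_dist n (\<lambda>i\<in>{1..n}. 0) x \<le> (\<Sum>i\<in>{1..n}. \<bar>(\<lambda>i\<in>{1..n}. 0) i - x i\<bar>)"
      unfolding euclid_dist_def by (rule L2_set_le_sum_abs)
    also have "\<dots> \<le> (\<Sum>i\<in>{1..n}. e)"
      using x by (intro sum_mono) (auto simp: PiE_def Pi_def abs_le_iff)
    also have "\<dots> < 1" using e by simp
    finally show "x \<in> euclid_ball n (\<lambda>i\<in>{1..n}. 0) 1"
      using x by (auto simp: euclid_ball_def space_Rn PiE_def)
  qed
  then have "emeasure (Rn n) (\<Pi>\<^sub>E i\<in>{1..n}. {-e..e}) \<le> unit_ball_volume n"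
    unfolding unit_ball_volume_def by (intro emeasure_mono) auto
  moreover have "emeasure (Rn n) (\<Pi>\<^sub>E i\<in>{1..n}. {-e..e}) = (\<Prod>i\<in>{1..n}. ennreal (2 * e))"
    unfolding Rn_def using e by (subst lborel_product.emeasure_PiM) auto
  then have "emeasure (Rn n) (\<Pi>\<^sub>E i\<in>{1..n}. {-e..e}) > 0"
    using e by (simp add: ennreal_power)
  ultimately show ?thesis by (rule less_le_trans[rotated])
qed

lemma emeasure_euclid_ball:
  assumes "r > 0"
  shows "emeasure (Rn n) (euclid_ball n x r) = ennreal (r ^ n) * unit_ball_volume n"
proof -
  have "emeasure (Rn n) (euclid_ball n x r)
      = ennreal (\<bar>r\<bar> ^ n) * emeasure (Rn n) (affine_Rn n x r -` euclid_ball n x r \<inter> space (Rn n))"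
    using assms by (intro emeasure_Rn_affine) auto
  also have "affine_Rn n x r -` euclid_ball n x r \<inter> space (Rn n) = euclid_ball n (\<lambda>i\<in>{1..n}. 0) 1"
  proof -
    have "euclid_dist n x (affine_Rn n x r z) = r * euclid_dist n (\<lambda>i\<in>{1..n}. 0) z" for z
    proof -
      have "euclid_dist n x (affine_Rn n x r z) = L2_set (\<lambda>i. r * (0 - z i)) {1..n}"
        unfolding euclid_dist_def by (intro L2_set_cong) (auto simp: affine_Rn_def)
      also have "\<dots> = r * L2_set (\<lambda>i. 0 - z i) {1..n}"
        using assms by (subst L2_set_right_distrib) auto
      also have "L2_set (\<lambda>i. 0 - z i) {1..n} = euclid_dist n (\<lambda>i\<in>{1..n}. 0) z"
        unfolding euclid_dist_def by (intro L2_set_cong) auto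
      finally show ?thesis .
    qed
    then show ?thesis
      using assms by (auto simp: euclid_ball_def affine_Rn_def space_Rn)
  qed
  finally show ?thesis using assms by (simp add: unit_ball_volume_def)
qed

text \<open>Openness relative to the extensional functions; the product topology of the function
  type would also see the coordinates outside \<open>{1..n}\<close>.\<close>

definition euclid_open :: "nat \<Rightarrow> (nat \<Rightarrow> real) set \<Rightarrow> bool" where
  "euclid_open n W \<longleftrightarrow> (\<forall>w\<in>W. \<exists>\<rho>>0. euclid_ball n w \<rho> \<subseteq> W)"

text \<open>
  On balls the image of Lebesgue measure under the similarity is an explicit multiple of Lebesgue
  measure; Christensen's argument extends this to open sets without determinants.
\<close>

lemma emeasure_similarity_vimage:
  assumes "\<tau> > 0" and W[measurable]: "W \<in> sets (Rn n)" and op: "euclid_open n W"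
  shows "emeasure (Rn n) (similarity n \<tau> \<alpha> \<beta> x y -` W \<inter> space (Rn n)) \<le> ennreal ((1 / \<tau>) ^ n) * emeasure (Rn n) W"
proof -
  let ?I = "similarity n \<tau> \<alpha> \<beta> x y"
  let ?m = "distr (Rn n) (Rn n) ?I"
  have ball: "emeasure ?m (euclid_ball n w r) = ennreal ((r / \<tau>) ^ n) * unit_ball_volume n"
    if "w \<in> space (Rn n)" "r > 0" for w r
  proof -
    obtain z where z: "z \<in> space (Rn n)" "?I z = w"
      using similarity_surj[OF assms(1) \<open>w \<in> space (Rn n)\<close>] by blast
    have "?I -` euclid_ball n w r \<inter> space (Rn n) = euclid_ball n z (r / \<tau>)"
      using assms(1) by (auto simp: euclid_ball_def z(2)[symmetric] euclid_dist_similarity field_simps)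
    then have "emeasure ?m (euclid_ball n w r) = emeasure (Rn n) (euclid_ball n z (r / \<tau>))"
      by (simp add: emeasure_distr)
    then show ?thesis using assms(1) that by (simp add: emeasure_euclid_ball)
  qed
  have fin: "ennreal t * unit_ball_volume n < \<infinity>" for t
    using unit_ball_volume_finite by (simp add: ennreal_mult_less_top)
  \<comment> \<open>An image of a sigma-finite measure need not be sigma-finite; here concentric
    balls of finite mass exhaust the space.\<close>
  have sf: "sigma_finite_measure ?m"
  proof
    let ?o = "\<lambda>i\<in>{1..n}. 0"
    have o: "?o \<in> space (Rn n)" by (simp add: space_Rn)
    show "\<exists>A. countable A \<and> A \<subseteq> sets ?m \<and> \<Union>A = space ?m \<and> (\<forall>a\<in>A. emeasure ?m a \<noteq> \<infinity>)"
    proof (intro exI conjI)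
      show "\<Union>(range (\<lambda>j. euclid_ball n ?o (real (Suc j)))) = space ?m"
      proof safe
        fix z assume "z \<in> space ?m"
        then show "z \<in> \<Union>(range (\<lambda>j. euclid_ball n ?o (real (Suc j))))"
          using reals_Archimedean2[of "euclid_dist n ?o z"]
          by (auto simp: euclid_ball_def intro: less_trans[OF _ less_add_one] simp: add.commute[of 1])
      qed (auto simp: euclid_ball_def)
      show "\<forall>a\<in>range (\<lambda>j. euclid_ball n ?o (real (Suc j))). emeasure ?m a \<noteq> \<infinity>"
        using ball[OF o] fin by (auto simp: less_top[symmetric] simp del: power_Suc of_nat_Suc)
    qed auto
  qed
  define r where "r = (\<lambda>j. 1 / real (Suc j))"
  have r: "r j > 0" for j by (simp add: r_def)
  have "emeasure ?m W \<le> ennreal ((1 / \<tau>) ^ n) * emeasure (Rn n) W"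
  proof (rule measure_le_of_ball_bounds[where r = r and s = "\<lambda>j. ennreal ((r j / \<tau>) ^ n) * unit_ball_volume n"])
    fix j
    show "0 < ennreal ((r j / \<tau>) ^ n) * unit_ball_volume n"
      using r[of j] assms(1) unit_ball_volume_pos[of n] by (auto simp: ennreal_zero_less_mult_iff)
  next
    fix j y assume "y \<in> W"
    then have "y \<in> space (Rn n)" using sets.sets_into_space[OF W] by auto
    then show "emeasure ?m (euclid_ball n y (r j)) \<le> ennreal ((r j / \<tau>) ^ n) * unit_ball_volume n"
      using ball r by simp
  next
    fix w assume "w \<in> W"
    then obtain \<rho> where \<rho>: "\<rho> > 0" "euclid_ball n w \<rho> \<subseteq> W" using op by (auto simp: euclid_open_def)
    have "r \<longlonglongrightarrow> 0" unfolding r_def by (rule LIMSEQ_Suc[OF lim_1_over_n])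
    then have "eventually (\<lambda>j. r j < \<rho>) at_top" using \<rho>(1) by (rule order_tendstoD)
    then show "eventually (\<lambda>j. ennreal ((r j / \<tau>) ^ n) * unit_ball_volume n \<le>
        ennreal ((1 / \<tau>) ^ n) * emeasure (Rn n) (W \<inter> euclid_ball n w (r j))) at_top"
    proof eventually_elim
      case (elim j)
      have "euclid_ball n w (r j) \<subseteq> W" using \<rho>(2) elim by (auto simp: euclid_ball_def)
      then have "W \<inter> euclid_ball n w (r j) = euclid_ball n w (r j)" by auto
      then show ?case
        using r[of j] assms(1)
        by (simp add: emeasure_euclid_ball power_divide flip: mult.assoc ennreal_mult)
    qed
  qed (use sigma_finite_Rn sf fin in auto)
  then show ?thesis by (simp add: emeasure_distr)
qed

text \<open>If every ball around w leaves W, points of W's complement at distance below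
  \<open>1 / (j + 1)\<close> converge to w in each coordinate. Openness is thus reduced to
  coordinatewise limits.\<close>

lemma euclid_openI:
  assumes "\<And>w v. w \<in> W \<Longrightarrow> (\<And>j. v j \<in> space (Rn n)) \<Longrightarrow> (\<And>i. i \<in> {1..n} \<Longrightarrow> (\<lambda>j. v j i) \<longlonglongrightarrow> w i) \<Longrightarrow>
    eventually (\<lambda>j :: nat. v j \<in> W) at_top"
  shows "euclid_open n W"
  unfolding euclid_open_def
proof (rule ballI, rule ccontr)
  fix w assume w: "w \<in> W" and "\<not> (\<exists>\<rho>>0. euclid_ball n w \<rho> \<subseteq> W)"
  then have "\<exists>v. v \<in> euclid_ball n w (1 / real (Suc j)) \<and> v \<notin> W" for j
    by (metis of_nat_0_less_iff subsetI zero_less_Suc zero_less_divide_1_iff)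
  then obtain v where v: "\<And>j. v j \<in> euclid_ball n w (1 / real (Suc j))" "\<And>j. v j \<notin> W"
    by metis
  have "eventually (\<lambda>j. v j \<in> W) at_top"
  proof (rule assms[OF w])
    fix i assume i: "i \<in> {1..n}"
    have "\<bar>v j i - w i\<bar> \<le> 1 / real (Suc j)" for j
      using component_le_euclid_dist[OF i, of w "v j"] v(1)[of j]
      by (simp add: euclid_ball_def abs_minus_commute)
    then have "(\<lambda>j. v j i - w i) \<longlonglongrightarrow> 0"
      by (intro Lim_null_comparison[OF _ LIMSEQ_Suc[OF lim_1_over_n]]) auto
    then show "(\<lambda>j. v j i) \<longlonglongrightarrow> w i" by (simp add: LIM_zero_iff)
  qed (use v in \<open>auto simp: euclid_ball_def\<close>)
  then show False using v(2) by simp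
qed

section \<open>Radial projection and its behaviour under similarities\<close>

lemma tendsto_lp_norm:
  assumes "p > 0" "\<And>i. i \<in> {1..n} \<Longrightarrow> (\<lambda>j. v j i) \<longlonglongrightarrow> w i"
  shows "(\<lambda>j. lp_norm p n (v j)) \<longlonglongrightarrow> lp_norm p n w"
  unfolding lp_norm_def using assms
  by (intro tendsto_powr' tendsto_sum tendsto_rabs tendsto_const) (auto simp: sum_nonneg)

lemma tendsto_euclid_dist:
  assumes "\<And>i. i \<in> {1..n} \<Longrightarrow> (\<lambda>j. v j i) \<longlonglongrightarrow> w i"
  shows "(\<lambda>j. euclid_dist n y (v j)) \<longlonglongrightarrow> euclid_dist n y w"
  unfolding euclid_dist_def L2_set_def using assms by (intro tendsto_intros)

definition lp_normalize :: "real \<Rightarrow> nat \<Rightarrow> (nat \<Rightarrow> real) \<Rightarrow> nat \<Rightarrow> real" where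
  "lp_normalize p n z = (\<lambda>i\<in>{1..n}. z i / lp_norm p n z)"

lemma lp_normalize_space [simp]: "lp_normalize p n z \<in> space (Rn n)"
  by (simp add: lp_normalize_def space_Rn)

lemma measurable_lp_normalize [measurable]: "lp_normalize p n \<in> Rn n \<rightarrow>\<^sub>M Rn n"
  by (rule measurable_RnI) (auto simp: lp_normalize_def)

lemma lp_normalize_eq_affine: "lp_normalize p n z = affine_Rn n (\<lambda>_. 0) (1 / lp_norm p n z) z"
  by (auto simp: lp_normalize_def affine_Rn_def fun_eq_iff)

lemma lp_normalize_in_sphere:
  assumes "p > 0" "lp_norm p n z > 0" shows "lp_normalize p n z \<in> lp_sphere p n"
  using assms by (simp add: lp_sphere_def) (simp add: lp_normalize_eq_affine lp_norm_affine_0)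

lemma lp_normalize_affine_0:
  assumes "c > 0" "p > 0" shows "lp_normalize p n (affine_Rn n (\<lambda>_. 0) c z) = lp_normalize p n z"
  using assms by (auto simp: lp_normalize_def lp_norm_affine_0 fun_eq_iff) (simp add: affine_Rn_def)

lemma lp_normalize_sphere:
  assumes "x \<in> lp_sphere p n" shows "lp_normalize p n x = x"
  using assms by (auto simp: lp_normalize_def lp_sphere_def space_Rn extensional_def fun_eq_iff)

text \<open>A nonnegative lower bound \<open>lo\<close> keeps the set away from the origin, where
  the radial projection is not continuous.\<close>

lemma euclid_open_shell:
  assumes "p > 0" "lo \<ge> 0"
  shows "euclid_open n {w \<in> space (Rn n). lp_normalize p n w \<in> euclid_ball n y r \<and> lo < lp_norm p n w \<and> lp_norm p n w < hi}"
proof (rule euclid_openI)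
  fix w v
  assume w: "w \<in> {w \<in> space (Rn n). lp_normalize p n w \<in> euclid_ball n y r \<and> lo < lp_norm p n w \<and> lp_norm p n w < hi}"
    and v: "\<And>j. v j \<in> space (Rn n)" "\<And>i. i \<in> {1..n} \<Longrightarrow> (\<lambda>j. v j i) \<longlonglongrightarrow> w i"
  have norm: "(\<lambda>j. lp_norm p n (v j)) \<longlonglongrightarrow> lp_norm p n w"
    using assms(1) v(2) by (rule tendsto_lp_norm)
  have "(\<lambda>j. euclid_dist n y (lp_normalize p n (v j))) \<longlonglongrightarrow> euclid_dist n y (lp_normalize p n w)"
  proof (rule tendsto_euclid_dist)
    fix i assume i: "i \<in> {1..n}"
    then show "(\<lambda>j. lp_normalize p n (v j) i) \<longlonglongrightarrow> lp_normalize p n w i"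
      using w assms(2) norm v(2)[OF i] by (simp add: lp_normalize_def) (intro tendsto_divide, auto)
  qed
  then have "eventually (\<lambda>j. euclid_dist n y (lp_normalize p n (v j)) < r) at_top"
    using w by (intro order_tendstoD) (auto simp: euclid_ball_def)
  moreover have "eventually (\<lambda>j. lo < lp_norm p n (v j)) at_top" "eventually (\<lambda>j. lp_norm p n (v j) < hi) at_top"
    using norm w by (auto intro: order_tendstoD)
  ultimately show "eventually (\<lambda>j. v j \<in> {w \<in> space (Rn n). lp_normalize p n w \<in> euclid_ball n y r \<and> lo < lp_norm p n w \<and> lp_norm p n w < hi}) at_top"
    by eventually_elim (use v in \<open>auto simp: euclid_ball_def\<close>)
qed

lemma L2_set_sphere_le:
  assumes "p > 0" "x \<in> lp_sphere p n" shows "L2_set x {1..n} \<le> n"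
proof -
  have "L2_set x {1..n} \<le> (\<Sum>i\<in>{1..n}. \<bar>x i\<bar>)" by (rule L2_set_le_sum_abs)
  also have "\<dots> \<le> (\<Sum>i\<in>{1..n}. 1)" using sphere_component_le_1[OF assms] by (intro sum_mono) auto
  finally show ?thesis by simp
qed

text \<open>Some coordinate has \<open>\<bar>x i\<bar> powr p \<ge> 1 / n\<close>, and as it is at
  most 1 in absolute value, lowering the exponent to p - 1 does not decrease this. Quotients of
  gradient lengths are then at most n squared.\<close>

lemma L2_set_lp_grad_bounds:
  assumes "p \<ge> 1" "x \<in> lp_sphere p n" "n \<ge> 1"
  shows "L2_set (lp_grad p x) {1..n} \<le> n" "1 / n \<le> L2_set (lp_grad p x) {1..n}"
proof -
  have p: "p > 0" using assms(1) by simp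
  have "L2_set (lp_grad p x) {1..n} \<le> (\<Sum>i\<in>{1..n}. \<bar>lp_grad p x i\<bar>)" by (rule L2_set_le_sum_abs)
  also have "\<dots> \<le> (\<Sum>i\<in>{1..n}. 1)"
  proof (rule sum_mono)
    fix i assume "i \<in> {1..n}"
    from sphere_component_le_1[OF p assms(2) this] show "\<bar>lp_grad p x i\<bar> \<le> 1"
      using assms(1) by (auto simp: lp_grad_def abs_mult sgn_if powr_le1)
  qed
  finally show "L2_set (lp_grad p x) {1..n} \<le> n" by simp
  have "\<exists>i\<in>{1..n}. \<bar>x i\<bar> powr p \<ge> 1 / n"
  proof (rule ccontr)
    assume "\<not> ?thesis"
    then have "(\<Sum>i\<in>{1..n}. \<bar>x i\<bar> powr p) < (\<Sum>i\<in>{1..n}. 1 / real n)"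
      using assms(3) by (intro sum_strict_mono) (auto simp: not_le simp del: atLeastAtMost_iff)
    then show False using sphere_sum[OF p assms(2)] assms(3) by simp
  qed
  then obtain i where i: "i \<in> {1..n}" "\<bar>x i\<bar> powr p \<ge> 1 / n" by blast
  have xi: "0 < \<bar>x i\<bar>" "\<bar>x i\<bar> \<le> 1"
    using i assms sphere_component_le_1[OF p assms(2) i(1)] by (auto intro!: Nat.gr0I)
  have "1 / n \<le> \<bar>x i\<bar> powr p" by (rule i)
  also have "\<dots> \<le> \<bar>x i\<bar> powr (p - 1)"
    using xi by (intro powr_mono') auto
  also have "\<dots> = \<bar>lp_grad p x i\<bar>"
    using xi by (auto simp: lp_grad_def abs_mult sgn_if)
  also have "\<dots> \<le> L2_set (\<lambda>i. \<bar>lp_grad p x i\<bar>) {1..n}"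
    using i(1) by (intro member_le_L2_set) auto
  also have "\<dots> = L2_set (lp_grad p x) {1..n}" by (simp add: L2_set_def)
  finally show "1 / n \<le> L2_set (lp_grad p x) {1..n}" .
qed

text \<open>With the normalized gradients as \<alpha> and \<beta>, and with c the quotient of their
  lengths before normalization, the norm after the similarity has at x the derivative of the norm
  itself times \<open>\<tau> * c\<close>. So the similarity nearly maps level sets of the norm to
  level sets, uniformly in the pair x, y.\<close>

lemma lp_norm_similarity:
  assumes "p \<ge> 1" "n \<ge> 1" "\<delta> > 0" "e > 0"
  shows "\<exists>r>0. \<forall>x\<in>sphere_interior p n \<delta>. \<forall>y\<in>sphere_interior p n \<delta>. \<exists>\<alpha> \<beta> c. 0 \<le> c \<and> c \<le> real n ^ 2 \<and>
    (\<forall>\<tau> u v. 0 < \<tau> \<longrightarrow> \<tau> \<le> 1 \<longrightarrow> euclid_dist n x u < r \<longrightarrow> euclid_dist n x v < r \<longrightarrow>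
      \<bar>lp_norm p n (similarity n \<tau> \<alpha> \<beta> x y u) - lp_norm p n (similarity n \<tau> \<alpha> \<beta> x y v)
        - \<tau> * c * (lp_norm p n u - lp_norm p n v)\<bar> \<le> e * \<tau> * euclid_dist n u v)"
proof -
  \<comment> \<open>The errors at y and at x add up to \<open>(1 + c) * \<epsilon>\<close>, and
    \<open>1 + c \<le> 2 * n^2\<close>.\<close>
  define \<epsilon> where "\<epsilon> = e / (2 * real n ^ 2)"
  have \<epsilon>: "\<epsilon> > 0" using assms by (simp add: \<epsilon>_def)
  obtain r where r: "r > 0" "\<And>x u v. x \<in> sphere_interior p n \<delta> \<Longrightarrow> euclid_dist n x u < r \<Longrightarrow> euclid_dist n x v < r \<Longrightarrow>
    \<bar>lp_norm p n u - lp_norm p n v - ip n (lp_grad p x) (\<lambda>i. u i - v i)\<bar> \<le> \<epsilon> * euclid_dist n u v"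
    using lp_norm_strict_derivative[OF assms(1,2,3) \<epsilon>] by blast
  show ?thesis
  proof (intro exI[of _ r] conjI ballI r(1))
    fix x y assume x: "x \<in> sphere_interior p n \<delta>" and y: "y \<in> sphere_interior p n \<delta>"
    define a b where "a = L2_set (lp_grad p x) {1..n}" and "b = L2_set (lp_grad p y) {1..n}"
    have ab: "1 / n \<le> a" "b \<le> n" "1 / n \<le> b"
      using L2_set_lp_grad_bounds[OF assms(1) _ assms(2)] x y by (auto simp: a_def b_def sphere_interior_def)
    have pos: "a > 0" "b > 0" using ab assms(2) by (auto intro: less_le_trans[of 0 "1 / real n"])
    define \<alpha> \<beta> where "\<alpha> = (\<lambda>i. 1 / a * lp_grad p x i)" and "\<beta> = (\<lambda>i. 1 / b * lp_grad p y i)"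
    define c where "c = b / a"
    have unit: "ip n \<alpha> \<alpha> = 1" "ip n \<beta> \<beta> = 1"
    proof -
      have "ip n (lp_grad p x) (lp_grad p x) = a\<^sup>2" "ip n (lp_grad p y) (lp_grad p y) = b\<^sup>2"
        by (simp_all add: a_def b_def L2_set_eq_sqrt_ip)
      then show "ip n \<alpha> \<alpha> = 1" "ip n \<beta> \<beta> = 1"
        unfolding \<alpha>_def \<beta>_def ip_scale_left ip_scale_right using pos by (simp_all add: power2_eq_square)
    qed
    have c0: "0 \<le> c" using pos by (simp add: c_def)
    have "b \<le> real n ^ 2 * (1 / n)" using ab assms(2) by (simp add: power2_eq_square)
    also have "\<dots> \<le> real n ^ 2 * a" using ab by (intro mult_left_mono) auto
    finally have c1: "c \<le> real n ^ 2" using pos by (simp add: c_def field_simps)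
    have grad: "ip n (lp_grad p y) (householder n \<alpha> \<beta> v) = c * ip n (lp_grad p x) v" for v
    proof -
      have "ip n (lp_grad p y) w = b * ip n \<beta> w" "ip n (lp_grad p x) w = a * ip n \<alpha> w" for w
        unfolding \<alpha>_def \<beta>_def ip_scale_left using pos by simp_all
      then show ?thesis using ip_householder_right[OF unit] pos by (simp add: c_def)
    qed
    show "\<exists>\<alpha> \<beta> c. 0 \<le> c \<and> c \<le> real n ^ 2 \<and>
      (\<forall>\<tau> u v. 0 < \<tau> \<longrightarrow> \<tau> \<le> 1 \<longrightarrow> euclid_dist n x u < r \<longrightarrow> euclid_dist n x v < r \<longrightarrow>
        \<bar>lp_norm p n (similarity n \<tau> \<alpha> \<beta> x y u) - lp_norm p n (similarity n \<tau> \<alpha> \<beta> x y v)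
          - \<tau> * c * (lp_norm p n u - lp_norm p n v)\<bar> \<le> e * \<tau> * euclid_dist n u v)"
    proof (rule exI[of _ \<alpha>], rule exI[of _ \<beta>], rule exI[of _ c], intro conjI allI impI c0 c1)
      fix \<tau> :: real and u v assume \<tau>: "0 < \<tau>" "\<tau> \<le> 1" and u: "euclid_dist n x u < r" and v: "euclid_dist n x v < r"
      let ?I = "similarity n \<tau> \<alpha> \<beta> x y"
      have near: "euclid_dist n y (?I u) < r" if u: "euclid_dist n x u < r" for u
      proof -
        have "y \<in> space (Rn n)" using y by (auto simp: sphere_interior_def lp_sphere_def)
        then have "euclid_dist n y (?I u) = \<tau> * euclid_dist n x u"
          using euclid_dist_similarity[of \<tau> n \<alpha> \<beta> x y x u] \<tau> by (simp add: similarity_base)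
        also have "\<dots> \<le> 1 * euclid_dist n x u" using \<tau> by (intro mult_right_mono) auto
        finally show ?thesis using u by simp
      qed
      have "ip n (lp_grad p y) (\<lambda>i. ?I u i - ?I v i) = ip n (lp_grad p y) (\<lambda>i. \<tau> * householder n \<alpha> \<beta> (\<lambda>i. u i - v i) i)"
        by (intro ip_cong similarity_diff refl)
      also have "\<dots> = \<tau> * c * ip n (lp_grad p x) (\<lambda>i. u i - v i)"
        by (simp only: ip_scale_right grad mult.assoc)
      finally have ip_eq: "ip n (lp_grad p y) (\<lambda>i. ?I u i - ?I v i) = \<tau> * c * ip n (lp_grad p x) (\<lambda>i. u i - v i)" .
      have 1: "\<bar>lp_norm p n (?I u) - lp_norm p n (?I v) - \<tau> * c * ip n (lp_grad p x) (\<lambda>i. u i - v i)\<bar> \<le> \<epsilon> * (\<tau> * euclid_dist n u v)"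
        using r(2)[OF y near[OF u] near[OF v]] \<tau> by (simp add: ip_eq euclid_dist_similarity)
      have "\<tau> * c * \<bar>lp_norm p n u - lp_norm p n v - ip n (lp_grad p x) (\<lambda>i. u i - v i)\<bar> \<le> \<tau> * c * (\<epsilon> * euclid_dist n u v)"
        using \<tau> c0 r(2)[OF x u v] by (intro mult_left_mono) auto
      then have 2: "\<bar>\<tau> * c * (lp_norm p n u - lp_norm p n v) - \<tau> * c * ip n (lp_grad p x) (\<lambda>i. u i - v i)\<bar> \<le> \<tau> * c * (\<epsilon> * euclid_dist n u v)"
        using \<tau> c0 by (simp add: abs_mult right_diff_distrib[symmetric])
      have "\<bar>lp_norm p n (?I u) - lp_norm p n (?I v) - \<tau> * c * (lp_norm p n u - lp_norm p n v)\<bar> \<le> \<epsilon> * (\<tau> * euclid_dist n u v) + \<tau> * c * (\<epsilon> * euclid_dist n u v)"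
        using 1 2 by linarith
      also have "\<dots> = (1 + c) * \<epsilon> * (\<tau> * euclid_dist n u v)" by (simp add: algebra_simps)
      also have "\<dots> \<le> e * (\<tau> * euclid_dist n u v)"
      proof (rule mult_right_mono)
        have "1 \<le> real n ^ 2" using assms(2) by simp
        then have "(1 + c) * \<epsilon> \<le> (2 * real n ^ 2) * \<epsilon>" using c1 \<epsilon> by (intro mult_right_mono) auto
        also have "\<dots> = e" using assms(2) by (simp add: \<epsilon>_def)
        finally show "(1 + c) * \<epsilon> \<le> e" .
      qed (use \<tau> in auto)
      finally show "\<bar>lp_norm p n (?I u) - lp_norm p n (?I v) - \<tau> * c * (lp_norm p n u - lp_norm p n v)\<bar> \<le> e * \<tau> * euclid_dist n u v"
        by (simp add: mult.assoc)
    qed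
  qed
qed

lemma dist_lp_normalize:
  assumes "p > 0" "lp_norm p n w > 0" "w \<in> space (Rn n)"
  shows "euclid_dist n (lp_normalize p n w) w \<le> n * \<bar>lp_norm p n w - 1\<bar>"
proof -
  have "euclid_dist n (lp_normalize p n w) w = L2_set (\<lambda>i. (1 - lp_norm p n w) * lp_normalize p n w i) {1..n}"
    unfolding euclid_dist_def using assms
    by (intro L2_set_cong) (auto simp: lp_normalize_def field_simps)
  also have "\<dots> = \<bar>lp_norm p n w - 1\<bar> * L2_set (lp_normalize p n w) {1..n}"
    by (simp add: L2_set_def power_mult_distrib real_sqrt_mult power2_commute[of 1] flip: sum_distrib_left)
  also have "\<dots> \<le> \<bar>lp_norm p n w - 1\<bar> * n"
    using assms by (intro mult_left_mono L2_set_sphere_le[OF assms(1)] lp_normalize_in_sphere) auto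
  finally show ?thesis by (simp add: mult.commute)
qed

text \<open>Split \<open>w - w'\<close> as norm of w times the difference of the projections, plus
  difference of the norms times the projection of w'. Points of nearly equal norm are therefore not
  drawn much closer together by the projection.\<close>

lemma dist_le_dist_lp_normalize:
  assumes "p > 0" "lp_norm p n w > 0" "lp_norm p n w' > 0"
  shows "euclid_dist n w w' \<le> lp_norm p n w * euclid_dist n (lp_normalize p n w) (lp_normalize p n w')
      + n * \<bar>lp_norm p n w - lp_norm p n w'\<bar>"
proof -
  let ?f = "lp_norm p n w" and ?f' = "lp_norm p n w'"
  let ?N = "lp_normalize p n w" and ?N' = "lp_normalize p n w'"
  have "euclid_dist n w w' = L2_set (\<lambda>i. ?f * (?N i - ?N' i) + (?f - ?f') * ?N' i) {1..n}"
    unfolding euclid_dist_def using assms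
    by (intro L2_set_cong) (auto simp: lp_normalize_def field_simps)
  also have "\<dots> \<le> L2_set (\<lambda>i. ?f * (?N i - ?N' i)) {1..n} + L2_set (\<lambda>i. (?f - ?f') * ?N' i) {1..n}"
    by (rule L2_set_triangle_ineq)
  also have "L2_set (\<lambda>i. ?f * (?N i - ?N' i)) {1..n} = ?f * euclid_dist n ?N ?N'"
    unfolding euclid_dist_def using assms by (simp add: L2_set_right_distrib)
  also have "L2_set (\<lambda>i. (?f - ?f') * ?N' i) {1..n} = \<bar>?f - ?f'\<bar> * L2_set ?N' {1..n}"
    by (simp add: L2_set_def power_mult_distrib real_sqrt_mult flip: sum_distrib_left)
  also have "\<dots> \<le> \<bar>?f - ?f'\<bar> * n"
    using assms by (intro mult_left_mono L2_set_sphere_le[OF assms(1)] lp_normalize_in_sphere) auto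
  finally show ?thesis by (simp add: mult.commute)
qed

lemma lp_sphere_sets [measurable, simp]: "lp_sphere p n \<in> sets (Rn n)"
  unfolding lp_sphere_def by measurable

lemma sphere_interior_sets [measurable, simp]: "sphere_interior p n \<delta> \<in> sets (Rn n)"
proof -
  have "sphere_interior p n \<delta> = {x \<in> space (Rn n). lp_norm p n x = 1 \<and> (\<forall>i\<in>{1..n}. \<delta> < \<bar>x i\<bar>)}"
    by (auto simp: sphere_interior_def lp_sphere_def)
  also have "\<dots> \<in> sets (Rn n)" by measurable
  finally show ?thesis .
qed

text \<open>Bernoulli's inequality. A contraction by \<open>1 - 1 / (4 * n)\<close> costs only a
  bounded factor even in the power 2n.\<close>

lemma one_minus_power_ge:
  assumes "n \<ge> 1" shows "(1 / 2 :: real) \<le> (1 - 1 / (4 * real n)) ^ (2 * n)" "3 / 4 \<le> (1 - 1 / (4 * real n)) ^ n"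
proof -
  have "- 1 \<le> - (1 / (4 * real n))" using assms by (simp add: field_simps)
  from Bernoulli_inequality[OF this, of "2 * n"] Bernoulli_inequality[OF this, of n]
  show "(1 / 2 :: real) \<le> (1 - 1 / (4 * real n)) ^ (2 * n)" "3 / 4 \<le> (1 - 1 / (4 * real n)) ^ n"
    using assms by (simp_all add: field_simps)
qed

text \<open>
  Small patches of the sphere are nearly isometric: transport the patch at \<open>x\<close> to \<open>y\<close> by a slightly
  contracting similarity that matches the tangent hyperplanes, and project radially onto the sphere.
\<close>

lemma hausdorff_patch_le:
  assumes "p \<ge> 1" "n \<ge> 1" "\<delta> > 0"
  shows "\<exists>r0>0. \<forall>x\<in>sphere_interior p n \<delta>. \<forall>y\<in>sphere_interior p n \<delta>. \<forall>r. 0 < r \<and> r < r0 \<longrightarrow>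
    hausdorff n (n - 1) (euclid_ball n x r \<inter> lp_sphere p n) \<le> 2 * hausdorff n (n - 1) (euclid_ball n y r \<inter> lp_sphere p n)"
proof -
  have p: "p > 0" using assms by simp
  \<comment> \<open>The projection distorts by a relative error of order \<open>n * e\<close>; the
    choice makes \<open>2 * n * e\<close> equal to \<open>1 / (4 * n)\<close>, the margin left by
    the contraction \<tau>.\<close>
  define e where "e = 1 / (8 * real n ^ 2)"
  have n1: "real n \<ge> 1" using assms by simp
  have e: "e > 0" "e \<le> 1 / 8" "real n * e \<le> 1 / (8 * real n)"
    using n1 assms(2) by (auto simp: e_def field_simps power2_eq_square) (use mult_mono[of 1 "real n" 1 "real n"] in simp)
  obtain r1 where r1: "r1 > 0" "\<And>x y. x \<in> sphere_interior p n \<delta> \<Longrightarrow> y \<in> sphere_interior p n \<delta> \<Longrightarrow> \<exists>\<alpha> \<beta> c. 0 \<le> c \<and> c \<le> real n ^ 2 \<and>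
    (\<forall>\<tau> u v. 0 < \<tau> \<longrightarrow> \<tau> \<le> 1 \<longrightarrow> euclid_dist n x u < r1 \<longrightarrow> euclid_dist n x v < r1 \<longrightarrow>
      \<bar>lp_norm p n (similarity n \<tau> \<alpha> \<beta> x y u) - lp_norm p n (similarity n \<tau> \<alpha> \<beta> x y v)
        - \<tau> * c * (lp_norm p n u - lp_norm p n v)\<bar> \<le> e * \<tau> * euclid_dist n u v)"
    using lp_norm_similarity[OF assms(1,2,3) e(1)] by blast
  show ?thesis
  proof (intro exI[of _ "min r1 1"] conjI ballI allI impI)
    show "min r1 1 > 0" using r1 by simp
    fix x y r assume x: "x \<in> sphere_interior p n \<delta>" and y: "y \<in> sphere_interior p n \<delta>" and r: "0 < r \<and> r < min r1 1"
    obtain \<alpha> \<beta> c where sim: "\<And>\<tau> u v. 0 < \<tau> \<Longrightarrow> \<tau> \<le> 1 \<Longrightarrow> euclid_dist n x u < r1 \<Longrightarrow> euclid_dist n x v < r1 \<Longrightarrow>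
      \<bar>lp_norm p n (similarity n \<tau> \<alpha> \<beta> x y u) - lp_norm p n (similarity n \<tau> \<alpha> \<beta> x y v)
        - \<tau> * c * (lp_norm p n u - lp_norm p n v)\<bar> \<le> e * \<tau> * euclid_dist n u v"
      using r1(2)[OF x y] by blast
    define \<tau> where "\<tau> = 1 - 1 / (4 * real n)"
    have \<tau>: "0 < \<tau>" "\<tau> \<le> 1" using n1 by (auto simp: \<tau>_def field_simps)
    let ?I = "similarity n \<tau> \<alpha> \<beta> x y"
    let ?E = "euclid_ball n x r \<inter> lp_sphere p n"
    let ?\<psi> = "\<lambda>u. lp_normalize p n (?I u)"
    have xy: "x \<in> lp_sphere p n" "y \<in> lp_sphere p n" "y \<in> space (Rn n)"
      using x y by (auto simp: sphere_interior_def lp_sphere_def)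
    have Ix: "?I x = y" using xy by (simp add: similarity_base)
    \<comment> \<open>On the sphere both norms are 1, so the term with c drops out.\<close>
    have lip: "\<bar>lp_norm p n (?I u) - lp_norm p n (?I v)\<bar> \<le> e * \<tau> * euclid_dist n u v"
      if "u \<in> ?E" "v \<in> ?E" for u v
      using sim[OF \<tau>, of u v] that r by (simp add: euclid_ball_def lp_sphere_def)
    have near1: "\<bar>lp_norm p n (?I u) - 1\<bar> \<le> e * \<tau> * euclid_dist n x u" if u: "u \<in> ?E" for u
    proof -
      have "x \<in> ?E" using xy r by (auto simp: euclid_ball_def lp_sphere_def)
      from lip[OF u this] show ?thesis using xy by (simp add: Ix lp_sphere_def euclid_dist_commute)
    qed
    have bounds: "lp_norm p n (?I u) > 0" "lp_norm p n (?I u) \<le> 1 + e" if u: "u \<in> ?E" for u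
    proof -
      have "e * \<tau> * euclid_dist n x u \<le> e * 1 * 1"
        using u r e \<tau> by (intro mult_mono) (auto simp: euclid_ball_def)
      then show "lp_norm p n (?I u) > 0" "lp_norm p n (?I u) \<le> 1 + e"
        using near1[OF u] e by linarith+
    qed
    \<comment> \<open>One factor \<tau> belongs to the similarity; the other covers the possible
      shrinking \<open>(1 - e) * (1 - n * e)\<close> by the radial projection.\<close>
    have "ennreal (\<tau> ^ 2) ^ (n - 1) * hausdorff n (n - 1) ?E \<le> hausdorff n (n - 1) (euclid_ball n y r \<inter> lp_sphere p n)"
    proof (rule hausdorff_lipschitz[where \<psi> = ?\<psi>])
      fix u v assume uv: "u \<in> ?E" "v \<in> ?E"
      let ?d = "euclid_dist n u v" and ?D = "euclid_dist n (?\<psi> u) (?\<psi> v)"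
      have "\<tau> * ?d = euclid_dist n (?I u) (?I v)" using \<tau> by (simp add: euclid_dist_similarity)
      also have "\<dots> \<le> lp_norm p n (?I u) * ?D + n * \<bar>lp_norm p n (?I u) - lp_norm p n (?I v)\<bar>"
        using p bounds uv by (intro dist_le_dist_lp_normalize) auto
      also have "\<dots> \<le> (1 + e) * ?D + n * (e * \<tau> * ?d)"
        using bounds(2)[OF uv(1)] lip[OF uv] by (intro add_mono mult_right_mono mult_left_mono) auto
      finally have "(1 - n * e) * (\<tau> * ?d) \<le> (1 + e) * ?D" by (simp add: algebra_simps)
      then have "(1 - e) * ((1 - n * e) * (\<tau> * ?d)) \<le> (1 - e) * ((1 + e) * ?D)"
        using e by (intro mult_left_mono) auto
      also have "\<dots> = (1 - e * e) * ?D" by (simp add: algebra_simps)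
      also have "\<dots> \<le> 1 * ?D" using e by (intro mult_right_mono) auto
      finally have "(1 - e) * (1 - n * e) * (\<tau> * ?d) \<le> ?D" by (simp add: mult.assoc)
      moreover have "\<tau> * (\<tau> * ?d) \<le> (1 - e) * (1 - n * e) * (\<tau> * ?d)"
      proof (rule mult_right_mono)
        have "e \<le> n * e" using n1 e by simp
        have "\<tau> \<le> 1 - 2 * (n * e)" using e by (simp add: \<tau>_def)
        also have "\<dots> \<le> 1 - e - n * e + e * (n * e)" using \<open>e \<le> n * e\<close> mult_nonneg_nonneg[of e "n * e"] e by linarith
        also have "\<dots> = (1 - e) * (1 - n * e)" by (simp add: algebra_simps)
        finally show "\<tau> \<le> (1 - e) * (1 - n * e)" .
      qed (use \<tau> in auto)
      ultimately show "\<tau> ^ 2 * ?d \<le> ?D" by (simp add: power2_eq_square mult.assoc)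
    next
      show "?\<psi> ` ?E \<subseteq> euclid_ball n y r \<inter> lp_sphere p n"
      proof safe
        fix u assume u: "u \<in> euclid_ball n x r" "u \<in> lp_sphere p n"
        then have uE: "u \<in> ?E" by simp
        show "?\<psi> u \<in> lp_sphere p n" using p bounds(1)[OF uE] by (rule lp_normalize_in_sphere)
        have "euclid_dist n y (?\<psi> u) \<le> euclid_dist n y (?I u) + euclid_dist n (?I u) (?\<psi> u)"
          by (rule euclid_dist_triangle)
        also have "euclid_dist n y (?I u) = \<tau> * euclid_dist n x u"
          using euclid_dist_similarity[of \<tau> n \<alpha> \<beta> x y x u] \<tau> Ix by simp
        also have "euclid_dist n (?I u) (?\<psi> u) \<le> n * (e * \<tau> * euclid_dist n x u)"
          using dist_lp_normalize[OF p bounds(1)[OF uE]] mult_left_mono[OF near1[OF uE], of "real n"]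
          by (simp add: euclid_dist_commute)
        also have "\<tau> * euclid_dist n x u + n * (e * \<tau> * euclid_dist n x u) = (\<tau> * (1 + n * e)) * euclid_dist n x u"
          by (simp add: algebra_simps)
        \<comment> \<open>The contraction pays for the displacement by the projection, so the image
          stays in the ball of the same radius r.\<close>
        also have "\<dots> \<le> 1 * euclid_dist n x u"
        proof (rule mult_right_mono)
          have "\<tau> * (1 + n * e) \<le> (1 - 1 / (4 * real n)) * (1 + 1 / (4 * real n))"
            unfolding \<tau>_def using \<tau> e n1 by (intro mult_left_mono add_left_mono) (auto simp: \<tau>_def field_simps)
          also have "\<dots> \<le> 1" by (simp add: algebra_simps)
          finally show "\<tau> * (1 + n * e) \<le> 1" .
        qed simp
        also have "\<dots> < r" using u by (simp add: euclid_ball_def)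
        finally show "?\<psi> u \<in> euclid_ball n y r" by (simp add: euclid_ball_def)
      qed
    qed (use \<tau> in \<open>auto simp: euclid_ball_def\<close>)
    moreover have "1 / 2 \<le> (\<tau> ^ 2) ^ (n - 1)"
    proof -
      have "1 / 2 \<le> \<tau> ^ (2 * n)" unfolding \<tau>_def using assms by (intro one_minus_power_ge)
      also have "\<dots> \<le> \<tau> ^ (2 * (n - 1))" using \<tau> by (intro power_decreasing) auto
      finally show ?thesis by (simp add: power_mult)
    qed
    then have "ennreal (1 / 2) \<le> ennreal (\<tau> ^ 2) ^ (n - 1)"
      by (subst ennreal_power, simp) (rule ennreal_leI)
    then have "ennreal (1 / 2) * hausdorff n (n - 1) ?E \<le> ennreal (\<tau> ^ 2) ^ (n - 1) * hausdorff n (n - 1) ?E"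
      by (rule mult_right_mono) simp
    ultimately have "ennreal (1 / 2) * hausdorff n (n - 1) ?E \<le> hausdorff n (n - 1) (euclid_ball n y r \<inter> lp_sphere p n)"
      by (rule order_trans[rotated])
    then have "2 * (ennreal (1 / 2) * hausdorff n (n - 1) ?E) \<le> 2 * hausdorff n (n - 1) (euclid_ball n y r \<inter> lp_sphere p n)"
      by (intro mult_left_mono) auto
    moreover note two_times_ennreal_half
    ultimately show "hausdorff n (n - 1) ?E \<le> 2 * hausdorff n (n - 1) (euclid_ball n y r \<inter> lp_sphere p n)"
      by (simp flip: mult.assoc)
  qed
qed

section \<open>Cone volumes and thin shells over small patches\<close>

definition cone_mass :: "real \<Rightarrow> nat \<Rightarrow> real \<Rightarrow> (nat \<Rightarrow> real) set \<Rightarrow> real" where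
  "cone_mass p n t E = measure (Rn n) {z \<in> space (Rn n). lp_norm p n z \<le> t \<and> lp_normalize p n z \<in> E}"

lemma emeasure_cone_scaling:
  assumes "p > 0" "t > 0" and [measurable]: "E \<in> sets (Rn n)"
  shows "emeasure (Rn n) {z \<in> space (Rn n). lp_norm p n z \<le> t \<and> lp_normalize p n z \<in> E} =
    ennreal (t ^ n) * emeasure (Rn n) {z \<in> space (Rn n). lp_norm p n z \<le> 1 \<and> lp_normalize p n z \<in> E}"
proof -
  let ?S = "\<lambda>t. {z \<in> space (Rn n). lp_norm p n z \<le> t \<and> lp_normalize p n z \<in> E}"
  have "emeasure (Rn n) (?S t) = ennreal (\<bar>t\<bar> ^ n) * emeasure (Rn n) (affine_Rn n (\<lambda>_. 0) t -` ?S t \<inter> space (Rn n))"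
    using assms by (intro emeasure_Rn_affine) auto
  also have "affine_Rn n (\<lambda>_. 0) t -` ?S t \<inter> space (Rn n) = ?S 1"
    using assms by (auto simp: lp_norm_affine_0 lp_normalize_affine_0) (auto simp: affine_Rn_def space_Rn)
  finally show ?thesis using assms by simp
qed

lemma emeasure_cone_finite:
  assumes "p > 0" "n \<ge> 1" "t > 0" and [measurable]: "E \<in> sets (Rn n)"
  shows "emeasure (Rn n) {z \<in> space (Rn n). lp_norm p n z \<le> t \<and> lp_normalize p n z \<in> E} < \<infinity>"
proof -
  have "emeasure (Rn n) {z \<in> space (Rn n). lp_norm p n z \<le> 1 \<and> lp_normalize p n z \<in> E} \<le> emeasure (Rn n) (lp_ball p n)"
    by (intro emeasure_mono) (auto simp: lp_ball_def)
  also have "\<dots> < \<infinity>" using emeasure_lp_ball[OF assms(1,2)] by (simp add: less_top)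
  finally show ?thesis
    using assms by (subst emeasure_cone_scaling) (auto simp: ennreal_mult_less_top)
qed

lemma cone_mass_scaling:
  assumes "p > 0" "t > 0" "E \<in> sets (Rn n)"
  shows "cone_mass p n t E = t ^ n * cone_mass p n 1 E"
  unfolding cone_mass_def measure_def emeasure_cone_scaling[OF assms] using assms(2)
  by (simp add: enn2real_mult)

lemma cone_mass_shell:
  assumes "p > 0" "n \<ge> 1" "0 < s" "s \<le> t" and [measurable]: "E \<in> sets (Rn n)"
  shows "emeasure (Rn n) {z \<in> space (Rn n). lp_normalize p n z \<in> E \<and> s < lp_norm p n z \<and> lp_norm p n z \<le> t}
    = ennreal ((t ^ n - s ^ n) * cone_mass p n 1 E)"
proof -
  let ?S = "\<lambda>t. {z \<in> space (Rn n). lp_norm p n z \<le> t \<and> lp_normalize p n z \<in> E}"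
  have fin: "emeasure (Rn n) (?S s) < \<infinity>" "emeasure (Rn n) (?S t) < \<infinity>"
    using assms by (auto intro!: emeasure_cone_finite simp del: infinity_ennreal_def)
  have "{z \<in> space (Rn n). lp_normalize p n z \<in> E \<and> s < lp_norm p n z \<and> lp_norm p n z \<le> t} = ?S t - ?S s"
    by auto
  moreover have "emeasure (Rn n) (?S t - ?S s) = emeasure (Rn n) (?S t) - emeasure (Rn n) (?S s)"
    using fin assms(4) by (intro emeasure_Diff) auto
  moreover have "emeasure (Rn n) (?S t) = ennreal (t ^ n * cone_mass p n 1 E)" "emeasure (Rn n) (?S s) = ennreal (s ^ n * cone_mass p n 1 E)"
    using fin assms cone_mass_scaling[of p t E n] cone_mass_scaling[of p s E n]
    by (simp_all add: emeasure_eq_ennreal_measure cone_mass_def)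
  ultimately show ?thesis
    using assms by (simp add: ennreal_minus cone_mass_def left_diff_distrib)
qed

text \<open>Volumes of thin shells are linear in the thickness, from both sides. For the lower bound
  combine Bernoulli's inequality with \<open>(1 - h)^n * (1 + h)^n \<le> 1\<close>; for the upper
  one factor the difference of n-th powers and bound each power by 2.\<close>

lemma shell_estimates:
  fixes a b h :: real
  assumes "n \<ge> 1" "0 \<le> h" "real n * h \<le> 1"
  shows "real n * h / 2 \<le> 1 - (1 - h) ^ n"
    and "0 \<le> b \<Longrightarrow> 0 \<le> a \<Longrightarrow> a \<le> 1 \<Longrightarrow> 2 * real n * b \<le> 1 \<Longrightarrow> (1 + b) ^ n - (1 - a) ^ n \<le> 2 * real n * (a + b)"
proof -
  have h1: "h \<le> 1"
    using mult_right_mono[of 1 "real n" h] assms by simp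
  have "1 + real n * h \<le> (1 + h) ^ n" using assms by (intro Bernoulli_inequality) auto
  then have "(1 - h) ^ n * (1 + real n * h) \<le> (1 - h) ^ n * (1 + h) ^ n"
    using h1 by (intro mult_left_mono) auto
  also have "\<dots> = (1 - h * h) ^ n" by (simp add: algebra_simps flip: power_mult_distrib)
  also have "\<dots> \<le> 1" using h1 assms by (intro power_le_one) (auto simp: mult_le_one)
  finally have "(1 - h) ^ n * (1 + real n * h) \<le> 1" .
  moreover have "1 \<le> (1 - real n * h / 2) * (1 + real n * h)"
  proof -
    have "0 \<le> real n * h * (1 - real n * h)" using assms by (intro mult_nonneg_nonneg) auto
    then show ?thesis by (simp add: algebra_simps)
  qed
  ultimately have "(1 - h) ^ n * (1 + real n * h) \<le> (1 - real n * h / 2) * (1 + real n * h)" by linarith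
  then have "(1 - h) ^ n \<le> 1 - real n * h / 2"
    by (rule mult_right_le_imp_le) (use assms in \<open>simp add: add_pos_nonneg\<close>)
  then show "real n * h / 2 \<le> 1 - (1 - h) ^ n" by simp
next
  assume b: "0 \<le> b" "2 * real n * b \<le> 1" and a: "0 \<le> a" "a \<le> 1"
  have b1: "b \<le> 1"
    using mult_right_mono[of 1 "2 * real n" b] assms b by simp
  have le2: "(1 + b) ^ n \<le> 2"
  proof -
    have "1 + real n * (- b) \<le> (1 + (- b)) ^ n" using b1 by (intro Bernoulli_inequality) auto
    then have "1 / 2 \<le> (1 - b) ^ n" using b by simp
    then have "(1 + b) ^ n * (1 / 2) \<le> (1 + b) ^ n * (1 - b) ^ n"
      using b by (intro mult_left_mono) auto
    also have "\<dots> = (1 - b * b) ^ n" by (simp add: algebra_simps flip: power_mult_distrib)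
    also have "\<dots> \<le> 1" using b1 b by (intro power_le_one) (auto simp: mult_le_one)
    finally show ?thesis by simp
  qed
  have "(1 + b) ^ n - (1 - a) ^ n = (1 + b - (1 - a)) * (\<Sum>i<n. (1 - a) ^ (n - Suc i) * (1 + b) ^ i)"
    by (rule power_diff_sumr2)
  also have "\<dots> \<le> (a + b) * (\<Sum>i<n. 2)"
  proof (intro mult_mono sum_mono)
    fix i assume "i \<in> {..<n}"
    then have "(1 - a) ^ (n - Suc i) * (1 + b) ^ i \<le> 1 * (1 + b) ^ n"
      using a b by (intro mult_mono power_increasing power_le_one) auto
    with le2 show "(1 - a) ^ (n - Suc i) * (1 + b) ^ i \<le> 2" by simp
  qed (use a b in \<open>auto intro!: sum_nonneg\<close>)
  finally show "(1 + b) ^ n - (1 - a) ^ n \<le> 2 * real n * (a + b)" by (simp add: algebra_simps)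
qed

text \<open>A shell of thickness h below the patch at x is carried by the similarity into a shell of
  thickness \<open>(n^2 + 4) * h\<close> over the patch at y. Shell volumes are thickness times cone
  mass up to factors \<open>n / 2\<close> and \<open>2 * n\<close>, and the volume change of the
  similarity is at most 2; h cancels and the constant is
  \<open>2 * 2 * 2 * (n^2 + 4)\<close>.\<close>

lemma cone_mass_patch_le:
  assumes "p \<ge> 1" "n \<ge> 1" "\<delta> > 0"
  shows "\<exists>r0>0. \<forall>x\<in>sphere_interior p n \<delta>. \<forall>y\<in>sphere_interior p n \<delta>. \<forall>r. 0 < r \<and> r < r0 \<longrightarrow>
    cone_mass p n 1 (euclid_ball n x r) \<le> 8 * (real n ^ 2 + 4) * cone_mass p n 1 (euclid_ball n y r)"
proof -
  have p: "p > 0" using assms by simp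
  \<comment> \<open>The radial projection of the image moves points by up to about
    \<open>n^3 * e * r\<close>, which has to fit into the margin \<open>r / (4 * n)\<close> left by
    the contraction.\<close>
  define e where "e = 1 / (64 * real n ^ 4)"
  have n1: "real n \<ge> 1" using assms by simp
  have npow: "real n \<le> real n ^ 4" "real n ^ 3 \<le> real n ^ 4" "1 \<le> real n ^ 2" "1 \<le> real n ^ 4"
    using n1 power_increasing[of 1 4 "real n"] by (auto intro: power_increasing)
  have e: "e > 0" using n1 by (simp add: e_def)
  have e1: "64 * (real n ^ 4 * e) = 1" using n1 by (simp add: e_def)
  have e2: "e \<le> 1 / 64" "real n * e \<le> 1 / 64" "real n ^ 2 * e \<le> 1 / 64" "(real n ^ 2 + 2) * e < 1"
  proof -
    have "real n ^ k * e \<le> real n ^ 4 * e" if "k \<le> 4" for k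
      using that n1 e by (intro mult_right_mono power_increasing) auto
    from this[of 0] this[of 1] this[of 2] e1
    show *: "e \<le> 1 / 64" "real n * e \<le> 1 / 64" "real n ^ 2 * e \<le> 1 / 64" by simp_all
    then show "(real n ^ 2 + 2) * e < 1" by (simp add: algebra_simps)
  qed
  obtain r1 where r1: "r1 > 0" "\<And>x y. x \<in> sphere_interior p n \<delta> \<Longrightarrow> y \<in> sphere_interior p n \<delta> \<Longrightarrow> \<exists>\<alpha> \<beta> c. 0 \<le> c \<and> c \<le> real n ^ 2 \<and>
    (\<forall>\<tau> u v. 0 < \<tau> \<longrightarrow> \<tau> \<le> 1 \<longrightarrow> euclid_dist n x u < r1 \<longrightarrow> euclid_dist n x v < r1 \<longrightarrow>
      \<bar>lp_norm p n (similarity n \<tau> \<alpha> \<beta> x y u) - lp_norm p n (similarity n \<tau> \<alpha> \<beta> x y v)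
        - \<tau> * c * (lp_norm p n u - lp_norm p n v)\<bar> \<le> e * \<tau> * euclid_dist n u v)"
    using lp_norm_similarity[OF assms(1,2,3) e] by blast
  show ?thesis
  \<comment> \<open>Points of the shell over a patch of radius r lie within \<open>2 * r\<close> of
    its centre, hence the half of \<open>r1\<close>.\<close>
  proof (intro exI[of _ "min (r1 / 2) 1"] conjI ballI allI impI)
    show "min (r1 / 2) 1 > 0" using r1 by simp
    fix x y r assume x: "x \<in> sphere_interior p n \<delta>" and y: "y \<in> sphere_interior p n \<delta>" and r: "0 < r \<and> r < min (r1 / 2) 1"
    obtain \<alpha> \<beta> c where c: "0 \<le> c" "c \<le> real n ^ 2" and sim: "\<And>\<tau> u v. 0 < \<tau> \<Longrightarrow> \<tau> \<le> 1 \<Longrightarrow> euclid_dist n x u < r1 \<Longrightarrow> euclid_dist n x v < r1 \<Longrightarrow>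
      \<bar>lp_norm p n (similarity n \<tau> \<alpha> \<beta> x y u) - lp_norm p n (similarity n \<tau> \<alpha> \<beta> x y v)
        - \<tau> * c * (lp_norm p n u - lp_norm p n v)\<bar> \<le> e * \<tau> * euclid_dist n u v"
      using r1(2)[OF x y] by blast
    define \<tau> where "\<tau> = 1 - 1 / (4 * real n)"
    have \<tau>: "0 < \<tau>" "\<tau> \<le> 1" using n1 by (auto simp: \<tau>_def field_simps)
    let ?I = "similarity n \<tau> \<alpha> \<beta> x y"
    \<comment> \<open>The thickness is a small multiple of the patch radius, so that the errors,
      proportional to r, are comparable with h.\<close>
    define h where "h = e * r"
    \<comment> \<open>On the shell the first-order term lowers the norm of the image by at most
      \<open>c * h \<le> n^2 * h\<close> and never raises it, while the error is below
      \<open>2 * h\<close> either way: \<open>h1\<close> bounds the deviation inwards,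
      \<open>h2\<close> outwards.\<close>
    define h1 where "h1 = (real n ^ 2 + 2) * h"
    define h2 where "h2 = 2 * h"
    have h: "0 < h" "real n * h \<le> r" "real n * h \<le> 1" "h < 1"
    proof -
      show "0 < h" using e r by (simp add: h_def)
      have "real n * e * r \<le> 1 * r" using e2 r by (intro mult_right_mono) auto
      then show "real n * h \<le> r" by (simp add: h_def mult.assoc)
      then show "real n * h \<le> 1" using r by simp
      have "e * r \<le> e * 1" using e r by (intro mult_left_mono) auto
      then show "h < 1" using e2 by (simp add: h_def)
    qed
    have h1: "0 \<le> h1" "h1 < 1"
    proof -
      show "0 \<le> h1" using h by (simp add: h1_def)
      have "h1 = (real n ^ 2 + 2) * e * r" by (simp add: h1_def h_def)
      also have "\<dots> \<le> (real n ^ 2 + 2) * e * 1" using e r by (intro mult_left_mono) auto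
      finally show "h1 < 1" using e2 by simp
    qed
    have h2: "0 \<le> h2" "2 * real n * h2 \<le> 1"
    proof -
      show "0 \<le> h2" using h by (simp add: h2_def)
      have "real n * e * r \<le> real n * e * 1" using e r by (intro mult_left_mono) auto
      then show "2 * real n * h2 \<le> 1" using e2 by (simp add: h2_def h_def)
    qed
    have xy: "x \<in> lp_sphere p n" "y \<in> lp_sphere p n" "y \<in> space (Rn n)" "x \<in> space (Rn n)"
      using x y by (auto simp: sphere_interior_def lp_sphere_def)
    have Ix: "?I x = y" using xy by (simp add: similarity_base)
    define Z where "Z = {z \<in> space (Rn n). lp_normalize p n z \<in> euclid_ball n x r \<and> 1 - h < lp_norm p n z \<and> lp_norm p n z \<le> 1}"
    define W where "W = {w \<in> space (Rn n). lp_normalize p n w \<in> euclid_ball n y r \<and> 1 - h1 < lp_norm p n w \<and> lp_norm p n w < 1 + h2}"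
    have Z_sub: "Z \<subseteq> ?I -` W \<inter> space (Rn n)"
    proof
      fix z assume z: "z \<in> Z"
      let ?f = "lp_norm p n z" and ?w = "?I z"
      have f: "0 < ?f" "1 - h < ?f" "?f \<le> 1" "z \<in> space (Rn n)" "euclid_dist n x (lp_normalize p n z) < r"
        using z h by (auto simp: Z_def euclid_ball_def)
      have "euclid_dist n x z \<le> euclid_dist n x (lp_normalize p n z) + euclid_dist n (lp_normalize p n z) z"
        by (rule euclid_dist_triangle)
      also have "euclid_dist n (lp_normalize p n z) z \<le> n * \<bar>?f - 1\<bar>"
        using p f by (intro dist_lp_normalize) auto
      also have "n * \<bar>?f - 1\<bar> \<le> n * h" using f by (intro mult_left_mono) auto
      finally have dz: "euclid_dist n x z < r + n * h" using f by simp
      then have dz2: "euclid_dist n x z < 2 * r" using h by simp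
      have "\<bar>lp_norm p n ?w - 1 - \<tau> * c * (?f - 1)\<bar> \<le> e * \<tau> * euclid_dist n z x"
        using sim[OF \<tau>, of z x] dz2 r r1(1) xy by (simp add: Ix lp_sphere_def)
      also have "\<dots> \<le> e * 1 * euclid_dist n x z"
        using e \<tau> by (simp add: euclid_dist_commute mult_left_le mult_right_mono mult_le_cancel_left1)
      also have "\<dots> < e * (2 * r)" using dz2 e by simp
      finally have wf: "\<bar>lp_norm p n ?w - 1 - \<tau> * c * (?f - 1)\<bar> < h2" by (simp add: h2_def h_def)
      have "\<tau> * c * (1 - ?f) \<le> 1 * real n ^ 2 * h"
        using \<tau> c f by (intro mult_mono) auto
      moreover have "0 \<le> \<tau> * c * (1 - ?f)" using \<tau> c f by (intro mult_nonneg_nonneg) auto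
      moreover have "\<tau> * c * (?f - 1) = - (\<tau> * c * (1 - ?f))" by (simp add: algebra_simps)
      ultimately have wf2: "1 - h1 < lp_norm p n ?w" "lp_norm p n ?w < 1 + h2" "\<bar>lp_norm p n ?w - 1\<bar> \<le> h1"
        using wf h n1 unfolding h1_def h2_def distrib_right by (auto simp: abs_less_iff abs_le_iff)
      have w0: "lp_norm p n ?w > 0" using wf2 h1 by simp
      have "euclid_dist n y (lp_normalize p n ?w) \<le> euclid_dist n y ?w + euclid_dist n ?w (lp_normalize p n ?w)"
        by (rule euclid_dist_triangle)
      also have "euclid_dist n y ?w = \<tau> * euclid_dist n x z"
        using euclid_dist_similarity[of \<tau> n \<alpha> \<beta> x y x z] \<tau> Ix by simp
      also have "euclid_dist n ?w (lp_normalize p n ?w) \<le> n * \<bar>lp_norm p n ?w - 1\<bar>"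
        using dist_lp_normalize[OF p w0] by (simp add: euclid_dist_commute)
      also have "n * \<bar>lp_norm p n ?w - 1\<bar> \<le> n * h1"
        using wf2 by (intro mult_left_mono) auto
      also have "\<tau> * euclid_dist n x z + n * h1 < \<tau> * (r + n * h) + n * h1"
        using dz \<tau> by simp
      also have "\<dots> \<le> r"
      proof -
        have "\<tau> * (n * h) \<le> 1 * (n * h)" using \<tau> h by (intro mult_right_mono) auto
        moreover have "real n * h + n * h1 \<le> r / (4 * real n)"
        proof -
          have "real n * (real n * h + n * h1) = (real n ^ 4 + 3 * real n ^ 2) * (e * r)"
            by (simp add: h1_def h_def power2_eq_square power4_eq_xxxx algebra_simps)
          also have "\<dots> \<le> (4 * real n ^ 4) * (e * r)"
            using npow n1 e r power_increasing[of 2 4 "real n"] by (intro mult_right_mono) auto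
          also have "\<dots> = (64 * (real n ^ 4 * e)) * r / 16" by simp
          also have "\<dots> \<le> r / 4" unfolding e1 using r by simp
          finally show ?thesis using n1 by (simp add: field_simps)
        qed
        moreover have "\<tau> * r = r - r / (4 * real n)" by (simp add: \<tau>_def algebra_simps)
        ultimately show ?thesis by (simp add: distrib_left)
      qed
      finally show "z \<in> ?I -` W \<inter> space (Rn n)"
        using wf2 f by (simp add: W_def euclid_ball_def)
    qed
    have W_open: "euclid_open n W"
      unfolding W_def using p h1 by (intro euclid_open_shell) auto
    have W_sets [measurable]: "W \<in> sets (Rn n)" unfolding W_def by measurable
    let ?M = "\<lambda>x. cone_mass p n 1 (euclid_ball n x r)"
    have M_nonneg: "?M x \<ge> 0" for x by (simp add: cone_mass_def)
    have "ennreal ((1 ^ n - (1 - h) ^ n) * ?M x) = emeasure (Rn n) Z"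
      unfolding Z_def using p assms h by (intro cone_mass_shell[symmetric]) auto
    also have "\<dots> \<le> emeasure (Rn n) (?I -` W \<inter> space (Rn n))"
      using Z_sub by (intro emeasure_mono) auto
    also have "\<dots> \<le> ennreal ((1 / \<tau>) ^ n) * emeasure (Rn n) W"
      using \<tau>(1) W_sets W_open by (rule emeasure_similarity_vimage)
    also have "\<dots> \<le> ennreal ((1 / \<tau>) ^ n) * emeasure (Rn n) {z \<in> space (Rn n). lp_normalize p n z \<in> euclid_ball n y r \<and> 1 - h1 < lp_norm p n z \<and> lp_norm p n z \<le> 1 + h2}"
      by (intro mult_left_mono emeasure_mono) (auto simp: W_def)
    also have "\<dots> = ennreal ((1 / \<tau>) ^ n) * ennreal (((1 + h2) ^ n - (1 - h1) ^ n) * ?M y)"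
      using p assms h1 h2 by (subst cone_mass_shell) auto
    also have "\<dots> \<le> ennreal 2 * ennreal (2 * real n * (h1 + h2) * ?M y)"
    proof (intro mult_mono ennreal_leI mult_right_mono M_nonneg)
      have "1 / 2 \<le> \<tau> ^ n" using one_minus_power_ge(2)[OF assms(2)] by (simp add: \<tau>_def)
      then have "inverse (\<tau> ^ n) \<le> inverse (1 / 2)" by (intro le_imp_inverse_le) auto
      then show "(1 / \<tau>) ^ n \<le> 2" by (simp add: power_one_over inverse_eq_divide)
      show "(1 + h2) ^ n - (1 - h1) ^ n \<le> 2 * real n * (h1 + h2)"
        using assms(2) h h1 h2 by (intro shell_estimates(2)[of n h]) auto
    qed (use h1 h2 M_nonneg in auto)
    also have "\<dots> = ennreal (2 * (2 * real n * (h1 + h2) * ?M y))"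
      using h1 h2 M_nonneg by (subst ennreal_mult) auto
    finally have "(1 ^ n - (1 - h) ^ n) * ?M x \<le> 2 * (2 * real n * (h1 + h2) * ?M y)"
      using h1 h2 M_nonneg by (subst (asm) ennreal_le_iff) auto
    moreover have "real n * h / 2 * ?M x \<le> (1 - (1 - h) ^ n) * ?M x"
      using assms(2) h M_nonneg by (intro mult_right_mono shell_estimates(1)) auto
    ultimately have "real n * h / 2 * ?M x \<le> 2 * (2 * real n * (h1 + h2) * ?M y)" by simp
    also have "h1 + h2 = (real n ^ 2 + 4) * h" by (simp add: h1_def h2_def algebra_simps)
    finally have "(real n * h / 2) * ?M x \<le> (real n * h / 2) * (8 * (real n ^ 2 + 4) * ?M y)"
      by (simp add: algebra_simps)
    then show "?M x \<le> 8 * (real n ^ 2 + 4) * ?M y"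
      by (rule mult_left_le_imp_le) (use h n1 in simp)
  qed
qed

section \<open>Comparison of surface and cone measure\<close>

text \<open>The cone probability measure as the image of the uniform distribution under radial
  projection; in this form it is a measure by construction.\<close>

definition sphere_law :: "real \<Rightarrow> nat \<Rightarrow> (nat \<Rightarrow> real) measure" where
  "sphere_law p n = distr (uniform_lp_ball p n) (Rn n) (lp_normalize p n)"

lemma sets_sphere_law [simp, measurable_cong]: "sets (sphere_law p n) = sets (Rn n)"
  and space_sphere_law [simp]: "space (sphere_law p n) = space (Rn n)"
  by (simp_all add: sphere_law_def)

lemma prob_space_sphere_law:
  assumes "p > 0" "n \<ge> 1" shows "prob_space (sphere_law p n)"
proof -
  interpret prob_space "uniform_lp_ball p n" using assms by (rule prob_space_uniform_lp_ball)
  show ?thesis unfolding sphere_law_def by (rule prob_space_distr) simp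
qed

lemma AE_uniform_lp_ball:
  assumes "AE x in Rn n. P x" shows "AE x in uniform_lp_ball p n. P x"
  unfolding uniform_lp_ball_def by (rule AE_uniform_measureI) (use assms in \<open>auto elim: eventually_mono\<close>)

lemma lp_norm_pos:
  assumes "p > 0" "n \<ge> 1" "\<forall>i\<in>{1..n}. x i \<noteq> 0" shows "lp_norm p n x > 0"
proof -
  have "(\<Sum>i\<in>{1..n}. \<bar>x i\<bar> powr p) > 0"
    using assms by (intro sum_pos) auto
  then show ?thesis by (simp add: lp_norm_def)
qed

lemma AE_sphere_law_nonzero:
  assumes "p > 0" "n \<ge> 1" shows "AE x in sphere_law p n. x \<in> lp_sphere p n \<and> (\<forall>i\<in>{1..n}. x i \<noteq> 0)"
proof -
  have "AE x in uniform_lp_ball p n. lp_normalize p n x \<in> lp_sphere p n \<and> (\<forall>i\<in>{1..n}. lp_normalize p n x i \<noteq> 0)"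
    using AE_uniform_lp_ball[OF AE_Rn_component_nonzero]
  proof eventually_elim
    case (elim x)
    then have "lp_norm p n x > 0" using assms by (intro lp_norm_pos) auto
    then show ?case
      using elim assms(1) by (auto intro: lp_normalize_in_sphere) (auto simp: lp_normalize_def)
  qed
  then show ?thesis
    unfolding sphere_law_def by (subst AE_distr_iff) measurable
qed

lemma measure_sphere_law:
  assumes "p > 0" "n \<ge> 1" and [measurable]: "E \<in> sets (Rn n)"
  shows "measure (sphere_law p n) E = cone_mass p n 1 E / measure (Rn n) (lp_ball p n)"
proof -
  have "measure (sphere_law p n) E = measure (uniform_lp_ball p n) (lp_normalize p n -` E \<inter> space (Rn n))"
    unfolding sphere_law_def by (subst measure_distr) auto
  also have "\<dots> = measure (Rn n) (lp_ball p n \<inter> (lp_normalize p n -` E \<inter> space (Rn n))) / measure (Rn n) (lp_ball p n)"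
    unfolding uniform_lp_ball_def
    using emeasure_lp_ball[OF assms(1,2)] by (intro measure_uniform_measure) auto
  also have "lp_ball p n \<inter> (lp_normalize p n -` E \<inter> space (Rn n)) = {z \<in> space (Rn n). lp_norm p n z \<le> 1 \<and> lp_normalize p n z \<in> E}"
    by (auto simp: lp_ball_def)
  finally show ?thesis by (simp add: cone_mass_def)
qed

lemma sphere_law_mean_ratio:
  assumes "p > 0" "n \<ge> 1" and [measurable]: "E \<in> sets borel"
  shows "measure (sphere_law p n) {x \<in> space (Rn n). mean_ratio p n x \<in> E} = ball_prob p n E"
proof -
  have "measure (sphere_law p n) {x \<in> space (Rn n). mean_ratio p n x \<in> E} =
    measure (uniform_lp_ball p n) (lp_normalize p n -` {x \<in> space (Rn n). mean_ratio p n x \<in> E} \<inter> space (Rn n))"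
    unfolding sphere_law_def by (subst measure_distr) auto
  also have "\<dots> = ball_prob p n E"
    unfolding ball_prob_def
  proof (rule measure_eq_AE)
    show "AE x in uniform_lp_ball p n. (x \<in> lp_normalize p n -` {x \<in> space (Rn n). mean_ratio p n x \<in> E} \<inter> space (Rn n)) =
      (x \<in> {x \<in> space (Rn n). mean_ratio p n x \<in> E})"
      using AE_uniform_lp_ball[OF AE_Rn_component_nonzero]
    proof eventually_elim
      case (elim x)
      then have "lp_norm p n x > 0" using assms by (intro lp_norm_pos) auto
      then have "mean_ratio p n (lp_normalize p n x) = mean_ratio p n x"
        using assms by (simp add: lp_normalize_eq_affine mean_ratio_affine_0)
      then show ?case by auto
    qed
  qed measurable
  finally show ?thesis .
qed

text \<open>The point x/2 lies in the open truncated cone over the ball around x, so a whole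
  Euclidean ball fits into it.\<close>

lemma sphere_law_ball_pos:
  assumes "p > 0" "n \<ge> 1" "x \<in> lp_sphere p n" "r > 0"
  shows "emeasure (sphere_law p n) (euclid_ball n x r) > 0"
proof -
  let ?W = "{w \<in> space (Rn n). lp_normalize p n w \<in> euclid_ball n x r \<and> 0 < lp_norm p n w \<and> lp_norm p n w < 1}"
  let ?w = "affine_Rn n (\<lambda>_. 0) (1 / 2) x"
  have "lp_norm p n ?w = 1 / 2" "lp_normalize p n ?w = x"
    using assms by (simp_all add: lp_norm_affine_0 lp_normalize_affine_0 lp_normalize_sphere)
      (simp add: lp_sphere_def)
  moreover have "?w \<in> space (Rn n)" "x \<in> space (Rn n)"
    using assms(3) by (simp_all add: affine_Rn_def space_Rn lp_sphere_def)
  ultimately have "?w \<in> ?W" using assms(4) by (simp add: euclid_ball_def)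
  moreover have "euclid_open n ?W" using assms(1) by (intro euclid_open_shell) auto
  ultimately obtain \<rho> where \<rho>: "\<rho> > 0" "euclid_ball n ?w \<rho> \<subseteq> ?W" unfolding euclid_open_def by blast
  have "0 < emeasure (Rn n) (euclid_ball n ?w \<rho>)"
    using \<rho>(1) unit_ball_volume_pos[of n] by (simp add: emeasure_euclid_ball ennreal_zero_less_mult_iff)
  also have "\<dots> \<le> emeasure (Rn n) {z \<in> space (Rn n). lp_norm p n z \<le> 1 \<and> lp_normalize p n z \<in> euclid_ball n x r}"
    using \<rho>(2) by (intro emeasure_mono) auto
  finally have "0 < cone_mass p n 1 (euclid_ball n x r)"
    unfolding cone_mass_def using emeasure_cone_finite[of p n 1 "euclid_ball n x r"] assms
    by (simp add: measure_def enn2real_positive_iff)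
  moreover have "measure (Rn n) (lp_ball p n) > 0"
    using emeasure_lp_ball[OF assms(1,2)] by (simp add: measure_def enn2real_positive_iff less_top zero_less_iff_neq_zero)
  ultimately have "0 < measure (sphere_law p n) (euclid_ball n x r)"
    using assms by (simp add: measure_sphere_law)
  then show ?thesis
    by (simp add: measure_def enn2real_positive_iff)
qed

text \<open>Both total masses are 1, so an average links the two measures: the m1-mass of the ball
  at x is at most K times that at any w; integrate over w with respect to m2, swap, and bound the
  m2-masses by K times the one at y. Integrating over a set of mass at least 1/2 accounts for the
  factor 2. The margin \<open>2 * \<delta>\<close> puts all points of the sphere within r of w into
  the \<delta>-interior.\<close>

lemma ball_mass_comparison:
  assumes m1: "prob_space m1" "sets m1 = sets (Rn n)" "AE x in m1. x \<in> lp_sphere p n"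
    and m2: "prob_space m2" "sets m2 = sets (Rn n)"
    and patch1: "\<And>x y. x \<in> sphere_interior p n \<delta> \<Longrightarrow> y \<in> sphere_interior p n \<delta> \<Longrightarrow>
      emeasure m1 (euclid_ball n x r) \<le> K * emeasure m1 (euclid_ball n y r)"
    and patch2: "\<And>x y. x \<in> sphere_interior p n \<delta> \<Longrightarrow> y \<in> sphere_interior p n \<delta> \<Longrightarrow>
      emeasure m2 (euclid_ball n x r) \<le> K * emeasure m2 (euclid_ball n y r)"
    and half: "emeasure m2 (sphere_interior p n (2 * \<delta>)) \<ge> ennreal (1 / 2)"
    and r: "r \<le> \<delta>" "\<delta> > 0"
    and x: "x \<in> sphere_interior p n \<delta>" and y: "y \<in> sphere_interior p n \<delta>"
  shows "emeasure m1 (euclid_ball n x r) \<le> 2 * K * K * emeasure m2 (euclid_ball n y r)"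
proof -
  interpret m1: prob_space m1 by fact
  interpret m2: prob_space m2 by fact
  note [measurable_cong] = m1(2) m2(2)
  let ?S = "sphere_interior p n"
  let ?B = "\<lambda>x. euclid_ball n x r"
  define a where "a = emeasure m1 (?B x)"
  have a_le: "a \<le> K * emeasure m1 (?S \<delta> \<inter> ?B w)" if w: "w \<in> ?S (2 * \<delta>)" for w
  proof -
    have "w \<in> ?S \<delta>" using w r by (auto simp: sphere_interior_def)
    then have "a \<le> K * emeasure m1 (?B w)" unfolding a_def using x by (intro patch1)
    also have "emeasure m1 (?B w) = emeasure m1 (?S \<delta> \<inter> ?B w)"
    proof (rule emeasure_eq_AE)
      show "AE z in m1. (z \<in> ?B w) = (z \<in> ?S \<delta> \<inter> ?B w)"
        using m1(3)
      proof eventually_elim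
        case (elim z)
        have "\<delta> < \<bar>z i\<bar>" if "z \<in> ?B w" "i \<in> {1..n}" for i
        proof -
          have "2 * \<delta> < \<bar>w i\<bar>" using w that(2) by (simp add: sphere_interior_def)
          moreover have "\<bar>w i - z i\<bar> < r"
            using component_le_euclid_dist[OF that(2), of w z] that(1) by (simp add: euclid_ball_def)
          ultimately show ?thesis using r by linarith
        qed
        then show ?case using elim by (auto simp: sphere_interior_def)
      qed
    qed (auto simp: m1(2))
    finally show ?thesis .
  qed
  have "ennreal (1 / 2) * a \<le> emeasure m2 (?S (2 * \<delta>)) * a"
    using half by (rule mult_right_mono) simp
  also have "\<dots> = (\<integral>\<^sup>+w. a * indicator (?S (2 * \<delta>)) w \<partial>m2)"
    by (subst nn_integral_cmult_indicator) (auto simp: m2(2) mult.commute)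
  also have "\<dots> \<le> (\<integral>\<^sup>+w. K * (indicator (?S (2 * \<delta>)) w * emeasure m1 (?S \<delta> \<inter> ?B w)) \<partial>m2)"
    using a_le by (intro nn_integral_mono) (auto simp: indicator_def)
  also have "\<dots> = K * (\<integral>\<^sup>+w. indicator (?S (2 * \<delta>)) w * emeasure m1 (?S \<delta> \<inter> ?B w) \<partial>m2)"
  proof (intro nn_integral_cmult borel_measurable_times_ennreal)
    show "(\<lambda>w. emeasure m1 (?S \<delta> \<inter> ?B w)) \<in> borel_measurable m2"
      using m2(2) m1.sigma_finite_measure_axioms m1(2) by (rule measurable_emeasure_ball) simp
  qed (auto simp: m2(2))
  also have "(\<integral>\<^sup>+w. indicator (?S (2 * \<delta>)) w * emeasure m1 (?S \<delta> \<inter> ?B w) \<partial>m2) =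
     (\<integral>\<^sup>+w. indicator (?S \<delta>) w * emeasure m2 (?S (2 * \<delta>) \<inter> ?B w) \<partial>m1)"
    using m2.sigma_finite_measure_axioms m2(2) m1.sigma_finite_measure_axioms m1(2)
    by (rule emeasure_ball_integral_swap) simp_all
  also have "\<dots> \<le> (\<integral>\<^sup>+w. K * emeasure m2 (?B y) \<partial>m1)"
  proof (rule nn_integral_mono)
    fix w
    have "emeasure m2 (?S (2 * \<delta>) \<inter> ?B w) \<le> K * emeasure m2 (?B y)" if "w \<in> ?S \<delta>"
    proof -
      have "emeasure m2 (?S (2 * \<delta>) \<inter> ?B w) \<le> emeasure m2 (?B w)"
        by (rule emeasure_mono) (auto simp: m2(2))
      also have "\<dots> \<le> K * emeasure m2 (?B y)" using that y by (rule patch2)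
      finally show ?thesis .
    qed
    then show "indicator (?S \<delta>) w * emeasure m2 (?S (2 * \<delta>) \<inter> ?B w) \<le> K * emeasure m2 (?B y)"
      by (auto simp: indicator_def)
  qed
  also have "\<dots> = K * emeasure m2 (?B y)" by (simp add: m1.emeasure_space_1)
  finally have "ennreal (1 / 2) * a \<le> K * (K * emeasure m2 (?B y))"
    by (rule meta_mp) (auto intro: mult_left_mono)
  then have "2 * (ennreal (1 / 2) * a) \<le> 2 * (K * (K * emeasure m2 (?B y)))"
    by (rule mult_left_mono) simp
  moreover note two_times_ennreal_half
  ultimately show ?thesis by (simp add: a_def mult.assoc[symmetric])
qed

text \<open>The scale s of the small balls is K times the m1-mass of the balls at one fixed centre
  \<open>x0\<close>. That it dominates all m1-masses is \<open>patch1\<close> and costs one K; that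
  the m2-masses reach it is the comparison of balls and costs the factor
  \<open>2 * K * K\<close>.\<close>

lemma open_set_comparison:
  assumes m1: "prob_space m1" "sets m1 = sets (Rn n)" "AE x in m1. x \<in> lp_sphere p n"
    and m2: "prob_space m2" "sets m2 = sets (Rn n)" "AE x in m2. x \<in> lp_sphere p n"
    and patch1: "\<And>x y r. x \<in> sphere_interior p n \<delta> \<Longrightarrow> y \<in> sphere_interior p n \<delta> \<Longrightarrow> 0 < r \<Longrightarrow> r < r0 \<Longrightarrow>
      emeasure m1 (euclid_ball n x r) \<le> K * emeasure m1 (euclid_ball n y r)"
    and patch2: "\<And>x y r. x \<in> sphere_interior p n \<delta> \<Longrightarrow> y \<in> sphere_interior p n \<delta> \<Longrightarrow> 0 < r \<Longrightarrow> r < r0 \<Longrightarrow>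
      emeasure m2 (euclid_ball n x r) \<le> K * emeasure m2 (euclid_ball n y r)"
    and K: "0 < K" "K < \<infinity>"
    and half: "emeasure m2 (sphere_interior p n (2 * \<delta>)) \<ge> ennreal (1 / 2)"
    and pos: "\<And>x r. x \<in> sphere_interior p n \<delta> \<Longrightarrow> 0 < r \<Longrightarrow> r < r0 \<Longrightarrow> 0 < emeasure m1 (euclid_ball n x r)"
    and r0: "0 < r0" "r0 \<le> \<delta>"
    and U: "U \<in> sets (Rn n)" "U \<subseteq> sphere_interior p n \<delta>"
    and op: "\<And>x. x \<in> U \<Longrightarrow> \<exists>\<rho>>0. euclid_ball n x \<rho> \<inter> lp_sphere p n \<subseteq> U"
  shows "emeasure m1 U \<le> 2 * K * K * K * emeasure m2 U"
proof (cases "U = {}")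
  case False
  then obtain x0 where x0: "x0 \<in> U" by blast
  interpret m1: prob_space m1 by fact
  interpret m2: prob_space m2 by fact
  \<comment> \<open>Starting at \<open>r0 / 2\<close> keeps all radii strictly below
    \<open>r0\<close>.\<close>
  define r where "r = (\<lambda>j. r0 / real (Suc (Suc j)))"
  have r: "0 < r j" "r j < r0" for j
  proof -
    show "0 < r j" using r0 by (simp add: r_def)
    have "0 < r0 + r0 * real j" using r0 by (intro add_pos_nonneg) auto
    then show "r j < r0" by (simp add: r_def divide_less_eq algebra_simps)
  qed
  have lim: "r \<longlonglongrightarrow> 0"
    unfolding r_def by (intro LIMSEQ_Suc[OF LIMSEQ_Suc] lim_const_over_n)
  show ?thesis
  proof (rule measure_le_of_ball_bounds[where r = r and s = "\<lambda>j. K * emeasure m1 (euclid_ball n x0 (r j))"])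
    fix j
    show "0 < K * emeasure m1 (euclid_ball n x0 (r j))"
      using pos[of x0 "r j"] x0 U(2) r K by (auto simp: ennreal_zero_less_mult_iff)
    show "K * emeasure m1 (euclid_ball n x0 (r j)) < \<infinity>"
      unfolding infinity_ennreal_def ennreal_mult_less_top
      using K m1.emeasure_finite[of "euclid_ball n x0 (r j)"] by (simp add: less_top[symmetric])
  next
    fix j y assume "y \<in> U"
    then show "emeasure m1 (euclid_ball n y (r j)) \<le> K * emeasure m1 (euclid_ball n x0 (r j))"
      using U(2) x0 r by (intro patch1) auto
  next
    fix x assume x: "x \<in> U"
    obtain \<rho> where \<rho>: "\<rho> > 0" "euclid_ball n x \<rho> \<inter> lp_sphere p n \<subseteq> U" using op[OF x] by blast
    have "eventually (\<lambda>j. r j < \<rho>) at_top" using lim \<rho>(1) by (rule order_tendstoD)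
    then show "eventually (\<lambda>j. K * emeasure m1 (euclid_ball n x0 (r j)) \<le> 2 * K * K * K * emeasure m2 (U \<inter> euclid_ball n x (r j))) at_top"
    proof eventually_elim
      case (elim j)
      have "emeasure m1 (euclid_ball n x0 (r j)) \<le> 2 * K * K * emeasure m2 (euclid_ball n x (r j))"
        using m1 m2(1,2)
      proof (rule ball_mass_comparison[where \<delta> = \<delta>])
        show "r j \<le> \<delta>" using r[of j] r0 by simp
      qed (use patch1 patch2 r half r0 x x0 U in auto)
      also have "emeasure m2 (euclid_ball n x (r j)) = emeasure m2 (U \<inter> euclid_ball n x (r j))"
      proof (rule emeasure_eq_AE)
        show "AE z in m2. (z \<in> euclid_ball n x (r j)) = (z \<in> U \<inter> euclid_ball n x (r j))"
          using m2(3) by eventually_elim (use \<rho>(2) elim in \<open>auto simp: euclid_ball_def\<close>)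
      qed (use U m2 in auto)
      finally have "emeasure m1 (euclid_ball n x0 (r j)) \<le> 2 * K * K * emeasure m2 (U \<inter> euclid_ball n x (r j))" .
      from mult_left_mono[OF this, of K] show ?case by (simp add: mult_ac)
    qed
  qed (use m1 m2 U m1.sigma_finite_measure_axioms m2.sigma_finite_measure_axioms in auto)
qed simp

text \<open>The sets increase to the sphere without the coordinate hyperplanes, which has full
  mass.\<close>

lemma prob_sphere_interior_limit:
  assumes "prob_space m" "sets m = sets (Rn n)" "AE x in m. x \<in> lp_sphere p n \<and> (\<forall>i\<in>{1..n}. x i \<noteq> 0)"
    and E[measurable]: "E \<in> sets (Rn n)"
  shows "(\<lambda>j. measure m (sphere_interior p n (1 / real (Suc j)) \<inter> E)) \<longlonglongrightarrow> measure m E"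
proof -
  interpret prob_space m by fact
  note [measurable_cong] = assms(2)
  let ?A = "\<lambda>j. sphere_interior p n (1 / real (Suc j)) \<inter> E"
  have "(\<lambda>j. measure m (?A j)) \<longlonglongrightarrow> measure m (\<Union>j. ?A j)"
  proof (rule finite_Lim_measure_incseq)
    show "incseq ?A"
    proof (rule incseq_SucI, rule subsetI)
      fix j x assume x: "x \<in> ?A j"
      have "1 / real (Suc (Suc j)) \<le> 1 / real (Suc j)" by (simp add: frac_le)
      then show "x \<in> ?A (Suc j)" using x by (force simp: sphere_interior_def)
    qed
  qed (auto simp: assms(2))
  moreover have "measure m (\<Union>j. ?A j) = measure m E"
  proof (rule measure_eq_AE)
    show "AE x in m. (x \<in> (\<Union>j. ?A j)) = (x \<in> E)"
      using assms(3)
    proof eventually_elim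
      case (elim x)
      have "\<exists>j. \<forall>i\<in>{1..n}. 1 / real (Suc j) < \<bar>x i\<bar>"
      proof -
        have "\<forall>i\<in>{1..n}. eventually (\<lambda>j. 1 / real (Suc j) < \<bar>x i\<bar>) at_top"
          using elim by (intro ballI order_tendstoD(2)[OF LIMSEQ_Suc[OF lim_1_over_n]]) simp
        then have "eventually (\<lambda>j. \<forall>i\<in>{1..n}. 1 / real (Suc j) < \<bar>x i\<bar>) at_top"
          by (subst eventually_ball_finite_distrib) auto
        then show ?thesis using eventually_happens'[OF sequentially_bot] by blast
      qed
      then show ?case using elim by (auto simp: sphere_interior_def)
    qed
  qed (auto simp: assms(2))
  ultimately show ?thesis by simp
qed

text \<open>Adding all points off the sphere turns relative openness in the sphere into openness in
  \<open>Rn n\<close>, where the sequential criterion applies; on the sphere interior the ratio is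
  continuous.\<close>

lemma mean_ratio_level_open:
  assumes "p > 0" "n \<ge> 1" "\<delta> > 0" "open V" "x \<in> sphere_interior p n \<delta>" "mean_ratio p n x \<in> V"
  shows "\<exists>\<rho>>0. euclid_ball n x \<rho> \<inter> lp_sphere p n \<subseteq> {x \<in> sphere_interior p n \<delta>. mean_ratio p n x \<in> V}"
proof -
  let ?U = "{x \<in> sphere_interior p n \<delta>. mean_ratio p n x \<in> V}"
  have "euclid_open n {w \<in> space (Rn n). w \<in> lp_sphere p n \<longrightarrow> w \<in> ?U}"
  proof (rule euclid_openI)
    fix w v assume w: "w \<in> {w \<in> space (Rn n). w \<in> lp_sphere p n \<longrightarrow> w \<in> ?U}"
      and v: "\<And>j. v j \<in> space (Rn n)" "\<And>i. i \<in> {1..n} \<Longrightarrow> (\<lambda>j. v j i) \<longlonglongrightarrow> w i"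
    show "eventually (\<lambda>j. v j \<in> {w \<in> space (Rn n). w \<in> lp_sphere p n \<longrightarrow> w \<in> ?U}) at_top"
    proof (cases "w \<in> lp_sphere p n")
      case False
      then have "lp_norm p n w \<noteq> 1" using w by (simp add: lp_sphere_def)
      then have "eventually (\<lambda>j. lp_norm p n (v j) \<noteq> 1) at_top"
        using tendsto_lp_norm[OF assms(1) v(2)] by (rule tendsto_imp_eventually_ne[rotated])
      then show ?thesis by eventually_elim (use v(1) in \<open>auto simp: lp_sphere_def\<close>)
    next
      case True
      with w have w': "\<And>i. i \<in> {1..n} \<Longrightarrow> \<delta> < \<bar>w i\<bar>" "mean_ratio p n w \<in> V" by (auto simp: sphere_interior_def)
      have "\<forall>i\<in>{1..n}. eventually (\<lambda>j. \<delta> < \<bar>v j i\<bar>) at_top"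
        using order_tendstoD(1)[OF tendsto_rabs[OF v(2)] w'(1)] by blast
      then have 1: "eventually (\<lambda>j. \<forall>i\<in>{1..n}. \<delta> < \<bar>v j i\<bar>) at_top"
        by (subst eventually_ball_finite_distrib) auto
      have nz: "w i \<noteq> 0" if "i \<in> {1..n}" for i using w'(1)[OF that] assms(3) by auto
      have sum: "(\<Sum>i\<in>{1..n}. \<bar>w i\<bar> powr p) = 1" using sphere_sum[OF assms(1) True] .
      have prod: "(\<Prod>i\<in>{1..n}. \<bar>w i\<bar>) \<noteq> 0" using nz by auto
      have "(\<lambda>j. mean_ratio p n (v j)) \<longlonglongrightarrow> mean_ratio p n w"
        unfolding mean_ratio_def
      proof (intro tendsto_divide tendsto_powr tendsto_prod tendsto_mult tendsto_sum tendsto_rabs tendsto_const v(2))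
        fix i assume "i \<in> {1..n}" then show "\<bar>w i\<bar> \<noteq> 0" using nz by simp
      qed (use prod sum assms(1,2) in \<open>auto simp del: prod_zero_iff\<close>)
      then have "eventually (\<lambda>j. mean_ratio p n (v j) \<in> V) at_top"
        using assms(4) w'(2) by (rule topological_tendstoD)
      with 1 show ?thesis by eventually_elim (use v(1) in \<open>auto simp: sphere_interior_def\<close>)
    qed
  qed
  moreover have "x \<in> space (Rn n)" using assms(5) by (auto simp: sphere_interior_def lp_sphere_def)
  ultimately obtain \<rho> where \<rho>: "\<rho> > 0" "euclid_ball n x \<rho> \<subseteq> {w \<in> space (Rn n). w \<in> lp_sphere p n \<longrightarrow> w \<in> ?U}"
    using assms(5,6) unfolding euclid_open_def by blast
  then have "euclid_ball n x \<rho> \<inter> lp_sphere p n \<subseteq> ?U" by blast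
  with \<rho>(1) show ?thesis by blast
qed

section \<open>The surface measure: null sections and comparison with the cone measure\<close>

context
  fixes p :: real and n :: nat
  assumes prob: "prob_space (surface_measure p n)" and p: "1 \<le> p" and n: "2 \<le> n"
begin

lemma space_surface_measure: "space (surface_measure p n) = space (Rn n)"
  and sets_surface_measure: "sets (surface_measure p n) = sets (Rn n)"
  unfolding surface_measure_def by (simp_all add: space_measure_of sets_measure_of sets.space_closed sets.sigma_sets_eq)

lemma emeasure_surface_measure:
  assumes "E \<in> sets (Rn n)"
  shows "emeasure (surface_measure p n) E = hausdorff n (n - 1) (E \<inter> lp_sphere p n) / hausdorff n (n - 1) (lp_sphere p n)"
proof (rule emeasure_measure_of_total[OF surface_measure_def])
  show "emeasure (surface_measure p n) (space (surface_measure p n)) \<noteq> 0"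
    using prob_space.emeasure_space_1[OF prob] by simp
qed (use assms in simp)

lemma AE_surface_measure_sphere: "AE x in surface_measure p n. x \<in> lp_sphere p n"
proof (rule AE_I)
  interpret prob_space "surface_measure p n" by (rule prob)
  show "{x \<in> space (surface_measure p n). x \<notin> lp_sphere p n} \<subseteq> space (Rn n) - lp_sphere p n"
    by (auto simp: space_surface_measure)
  have "space (Rn n) \<inter> lp_sphere p n = lp_sphere p n"
    by (auto simp: lp_sphere_def)
  then have "emeasure (surface_measure p n) (lp_sphere p n) = emeasure (surface_measure p n) (space (Rn n))"
    by (subst (1 2) emeasure_surface_measure) auto
  then have "emeasure (surface_measure p n) (lp_sphere p n) = 1"
    using emeasure_space_1 by (simp add: space_surface_measure)
  then show "emeasure (surface_measure p n) (space (Rn n) - lp_sphere p n) = 0"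
    using emeasure_compl[of "lp_sphere p n" "surface_measure p n"] emeasure_space_1
    by (simp add: sets_surface_measure space_surface_measure)
qed (simp add: sets_surface_measure)

text \<open>
  The section \<open>x\<^sub>i = 0\<close> of the sphere can be mapped into each of the infinitely many disjoint sections
  \<open>x\<^sub>i = t\<close>, \<open>0 < t \<le> 1/2\<close>, by a scaling with factor at least \<open>1/2\<close>; so its mass is zero.
\<close>

lemma surface_measure_section_le:
  assumes i: "i \<in> {1..n}" and t: "0 < t" "t \<le> 1 / 2"
  shows "ennreal ((1 / 2) ^ (n - 1)) * emeasure (surface_measure p n) {x \<in> lp_sphere p n. x i = 0}
    \<le> emeasure (surface_measure p n) {x \<in> lp_sphere p n. x i = t}"
proof -
  have p0: "p > 0" using p by simp
  let ?E = "\<lambda>t. {x \<in> lp_sphere p n. x i = t}"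
  \<comment> \<open>Replacing the zero coordinate by t and scaling the others by c preserves the
    norm because \<open>t powr p + c powr p = 1\<close>; as p \<ge> 1, both
    \<open>t powr p \<le> t\<close> and \<open>c \<ge> 1 - t powr p \<ge> 1 / 2\<close>
    hold.\<close>
  define c where "c = (1 - t powr p) powr (1 / p)"
  have tp: "0 < t powr p" "t powr p \<le> 1 / 2"
  proof -
    have "t powr p \<le> t powr 1" using t p by (intro powr_mono') auto
    then show "0 < t powr p" "t powr p \<le> 1 / 2" using t by auto
  qed
  have c: "1 / 2 \<le> c" "c powr p = 1 - t powr p"
  proof -
    have "1 / 2 \<le> (1 - t powr p) powr 1" using tp by simp
    also have "\<dots> \<le> c" unfolding c_def using tp p by (intro powr_mono') auto
    finally show "1 / 2 \<le> c" .
    show "c powr p = 1 - t powr p" using tp p0 by (simp add: c_def powr_powr)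
  qed
  define \<psi> where "\<psi> = (\<lambda>x. \<lambda>j\<in>{1..n}. if j = i then t else c * x j)"
  have "ennreal (1 / 2) ^ (n - 1) * hausdorff n (n - 1) (?E 0) \<le> hausdorff n (n - 1) (?E t)"
  proof (rule hausdorff_lipschitz[where \<psi> = \<psi>])
    fix u v assume uv: "u \<in> ?E 0" "v \<in> ?E 0"
    have "euclid_dist n (\<psi> u) (\<psi> v) = L2_set (\<lambda>j. c * (u j - v j)) {1..n}"
      unfolding euclid_dist_def using uv i by (intro L2_set_cong) (auto simp: \<psi>_def right_diff_distrib)
    also have "\<dots> = c * euclid_dist n u v"
      using c by (simp add: euclid_dist_def L2_set_right_distrib)
    also have "\<dots> \<ge> 1 / 2 * euclid_dist n u v"
      using c by (intro mult_right_mono) auto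
    finally show "1 / 2 * euclid_dist n u v \<le> euclid_dist n (\<psi> u) (\<psi> v)" .
  next
    show "\<psi> ` ?E 0 \<subseteq> ?E t"
    proof safe
      fix u assume u: "u \<in> lp_sphere p n" "u i = 0"
      show "\<psi> u i = t" using i by (simp add: \<psi>_def)
      have "(\<Sum>j\<in>{1..n}. \<bar>\<psi> u j\<bar> powr p) = \<bar>\<psi> u i\<bar> powr p + (\<Sum>j\<in>{1..n} - {i}. \<bar>\<psi> u j\<bar> powr p)"
        using i by (intro sum.remove) auto
      also have "(\<Sum>j\<in>{1..n} - {i}. \<bar>\<psi> u j\<bar> powr p) = (\<Sum>j\<in>{1..n} - {i}. c powr p * \<bar>u j\<bar> powr p)"
        using c by (intro sum.cong) (auto simp: \<psi>_def abs_mult powr_mult)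
      also have "\<dots> = c powr p * (\<Sum>j\<in>{1..n}. \<bar>u j\<bar> powr p)"
        using i u(2) by (subst (2) sum.remove[of _ i]) (auto simp: sum_distrib_left)
      also have "\<bar>\<psi> u i\<bar> powr p + c powr p * (\<Sum>j\<in>{1..n}. \<bar>u j\<bar> powr p) = 1"
        using sphere_sum[OF p0 u(1)] t i c by (simp add: \<psi>_def)
      finally have "(\<Sum>j\<in>{1..n}. \<bar>\<psi> u j\<bar> powr p) = 1" .
      then show "\<psi> u \<in> lp_sphere p n" by (simp add: lp_sphere_def lp_norm_def space_Rn \<psi>_def)
    qed
  qed (auto simp: lp_sphere_def)
  then have "ennreal (1 / 2) ^ (n - 1) * hausdorff n (n - 1) (?E 0) / hausdorff n (n - 1) (lp_sphere p n)
    \<le> hausdorff n (n - 1) (?E t) / hausdorff n (n - 1) (lp_sphere p n)"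
    by (rule divide_right_mono_ennreal)
  moreover have "?E t \<inter> lp_sphere p n = ?E t" for t by auto
  moreover have "?E t \<in> sets (Rn n)" for t
  proof -
    have "?E t = {x \<in> space (Rn n). lp_norm p n x = 1 \<and> x i = t}" by (auto simp: lp_sphere_def)
    also have "\<dots> \<in> sets (Rn n)" using i by measurable
    finally show ?thesis .
  qed
  moreover have "ennreal (1 / 2) ^ (n - 1) = ennreal ((1 / 2) ^ (n - 1))"
    by (rule ennreal_power) simp
  ultimately show ?thesis
    by (simp only: emeasure_surface_measure ennreal_times_divide)
qed

lemma AE_surface_measure_nonzero:
  "AE x in surface_measure p n. x \<in> lp_sphere p n \<and> (\<forall>i\<in>{1..n}. x i \<noteq> 0)"
proof -
  interpret prob_space "surface_measure p n" by (rule prob)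
  let ?E = "\<lambda>i t. {x \<in> lp_sphere p n. x i = t}"
  have E_sets: "?E i t \<in> sets (surface_measure p n)" if i: "i \<in> {1..n}" for i t
  proof -
    have "?E i t = {x \<in> space (Rn n). lp_norm p n x = 1 \<and> x i = t}" by (auto simp: lp_sphere_def)
    also have "\<dots> \<in> sets (Rn n)" using i by measurable
    finally show ?thesis by (simp add: sets_surface_measure)
  qed
  have null: "measure (surface_measure p n) (?E i 0) = 0" if i: "i \<in> {1..n}" for i
  proof -
    define a where "a = (1 / 2) ^ (n - 1) * measure (surface_measure p n) (?E i 0)"
    define t where "t = (\<lambda>j. 1 / real (Suc (Suc j)))"
    have t: "0 < t j" "t j \<le> 1 / 2" for j by (auto simp: t_def field_simps)
    have a_le: "a \<le> measure (surface_measure p n) (?E i (t j))" for j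
      using surface_measure_section_le[OF i t[of j]] unfolding a_def emeasure_eq_measure
      by (simp flip: ennreal_mult)
    have "real N * a \<le> 1" for N
    proof -
      have "real N * a = (\<Sum>j<N. a)" by simp
      also have "\<dots> \<le> (\<Sum>j<N. measure (surface_measure p n) (?E i (t j)))"
        using a_le by (intro sum_mono)
      also have "\<dots> = measure (surface_measure p n) (\<Union>j\<in>{..<N}. ?E i (t j))"
      proof (rule finite_measure_finite_Union[symmetric])
        show "disjoint_family_on (\<lambda>j. ?E i (t j)) {..<N}"
          by (auto simp: disjoint_family_on_def t_def)
      qed (use E_sets[OF i] in auto)
      also have "\<dots> \<le> 1" by (rule prob_le_1)
      finally show ?thesis .
    qed
    then have "a \<le> 0"
      by (metis linorder_not_le mult.commute ex_less_of_nat_mult)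
    show ?thesis
    proof (rule ccontr)
      assume "measure (surface_measure p n) (?E i 0) \<noteq> 0"
      then have "a > 0" unfolding a_def by (intro mult_pos_pos) (simp_all add: zero_less_measure_iff)
      with \<open>a \<le> 0\<close> show False by simp
    qed
  qed
  have "\<forall>i\<in>{1..n}. AE x in surface_measure p n. x \<notin> ?E i 0"
    using null E_sets by (auto intro!: AE_not_in simp: null_sets_def emeasure_eq_measure simp del: mem_Collect_eq)
  then have "AE x in surface_measure p n. \<forall>i\<in>{1..n}. x \<notin> ?E i 0"
    by (subst AE_finite_all) auto
  with AE_surface_measure_sphere show ?thesis by eventually_elim auto
qed

lemma surface_measure_patch:
  assumes "\<delta> > 0"
  shows "\<exists>r0>0. \<forall>x\<in>sphere_interior p n \<delta>. \<forall>y\<in>sphere_interior p n \<delta>. \<forall>r. 0 < r \<and> r < r0 \<longrightarrow>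
    emeasure (surface_measure p n) (euclid_ball n x r) \<le> ennreal (8 * (real n ^ 2 + 4)) * emeasure (surface_measure p n) (euclid_ball n y r)"
proof -
  have n1: "1 \<le> n" using n by simp
  obtain r0 where r0: "r0 > 0" "\<And>x y r. x \<in> sphere_interior p n \<delta> \<Longrightarrow> y \<in> sphere_interior p n \<delta> \<Longrightarrow> 0 < r \<Longrightarrow> r < r0 \<Longrightarrow>
    hausdorff n (n - 1) (euclid_ball n x r \<inter> lp_sphere p n) \<le> 2 * hausdorff n (n - 1) (euclid_ball n y r \<inter> lp_sphere p n)"
    using hausdorff_patch_le[OF p n1 assms] by blast
  \<comment> \<open>The constant 2 is weakened to the one of the cone measure, so that a single K
    serves both.\<close>
  have "(2 :: ennreal) \<le> ennreal (8 * (real n ^ 2 + 4))"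
    unfolding ennreal_numeral[symmetric] by (rule ennreal_leI) simp
  then have le: "2 * (a :: ennreal) \<le> ennreal (8 * (real n ^ 2 + 4)) * a" for a
    by (rule mult_right_mono) simp
  show ?thesis
  proof (intro exI[of _ r0] conjI ballI allI impI r0(1))
    fix x y r assume *: "x \<in> sphere_interior p n \<delta>" "y \<in> sphere_interior p n \<delta>" "0 < r \<and> r < r0"
    have "emeasure (surface_measure p n) (euclid_ball n x r) \<le>
      2 * hausdorff n (n - 1) (euclid_ball n y r \<inter> lp_sphere p n) / hausdorff n (n - 1) (lp_sphere p n)"
      using r0(2)[of x y r] * by (simp only: emeasure_surface_measure sets_euclid_ball) (intro divide_right_mono_ennreal, auto)
    also have "\<dots> = 2 * emeasure (surface_measure p n) (euclid_ball n y r)"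
      by (simp only: emeasure_surface_measure sets_euclid_ball ennreal_times_divide)
    also note le
    finally show "emeasure (surface_measure p n) (euclid_ball n x r) \<le> ennreal (8 * (real n ^ 2 + 4)) * emeasure (surface_measure p n) (euclid_ball n y r)" .
  qed
qed

lemma sphere_law_patch:
  assumes "\<delta> > 0"
  shows "\<exists>r0>0. \<forall>x\<in>sphere_interior p n \<delta>. \<forall>y\<in>sphere_interior p n \<delta>. \<forall>r. 0 < r \<and> r < r0 \<longrightarrow>
    emeasure (sphere_law p n) (euclid_ball n x r) \<le> ennreal (8 * (real n ^ 2 + 4)) * emeasure (sphere_law p n) (euclid_ball n y r)"
proof -
  have n1: "1 \<le> n" and p0: "p > 0" using n p by simp_all
  interpret S: prob_space "sphere_law p n" using p0 n1 by (rule prob_space_sphere_law)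
  obtain r0 where r0: "r0 > 0" "\<And>x y r. x \<in> sphere_interior p n \<delta> \<Longrightarrow> y \<in> sphere_interior p n \<delta> \<Longrightarrow> 0 < r \<Longrightarrow> r < r0 \<Longrightarrow>
    cone_mass p n 1 (euclid_ball n x r) \<le> 8 * (real n ^ 2 + 4) * cone_mass p n 1 (euclid_ball n y r)"
    using cone_mass_patch_le[OF p n1 assms] by blast
  show ?thesis
  proof (intro exI[of _ r0] conjI ballI allI impI r0(1))
    fix x y r assume *: "x \<in> sphere_interior p n \<delta>" "y \<in> sphere_interior p n \<delta>" "0 < r \<and> r < r0"
    have "measure (sphere_law p n) (euclid_ball n x r) \<le> 8 * (real n ^ 2 + 4) * cone_mass p n 1 (euclid_ball n y r) / measure (Rn n) (lp_ball p n)"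
      using r0(2)[of x y r] * p0 n1 by (simp only: measure_sphere_law sets_euclid_ball) (intro divide_right_mono, auto)
    also have "\<dots> = 8 * (real n ^ 2 + 4) * measure (sphere_law p n) (euclid_ball n y r)"
      using p0 n1 by (simp only: measure_sphere_law sets_euclid_ball times_divide_eq_right)
    finally show "emeasure (sphere_law p n) (euclid_ball n x r) \<le> ennreal (8 * (real n ^ 2 + 4)) * emeasure (sphere_law p n) (euclid_ball n y r)"
      unfolding S.emeasure_eq_measure by (subst ennreal_mult[symmetric]) (auto intro: ennreal_leI)
  qed
qed

text \<open>With the common patch constant K, \<kappa> is \<open>2 * K^3\<close>. It depends on n
  only and not on the cut-off \<open>1 / (2 * (j + 1))\<close>, so the inequalities for the inner
  parts pass to the limit.\<close>

lemma surface_open_comparison: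
  assumes "open V"
  defines "L \<equiv> {x \<in> space (Rn n). mean_ratio p n x \<in> V}" and "\<kappa> \<equiv> 2 * (8 * (real n ^ 2 + 4)) ^ 3"
  shows "measure (surface_measure p n) L \<le> \<kappa> * measure (sphere_law p n) L"
    and "measure (sphere_law p n) L \<le> \<kappa> * measure (surface_measure p n) L"
proof -
  have n1: "1 \<le> n" and p0: "p > 0" using n p by simp_all
  interpret \<sigma>: prob_space "surface_measure p n" by (rule prob)
  interpret \<mu>: prob_space "sphere_law p n" using p0 n1 by (rule prob_space_sphere_law)
  let ?S = "sphere_interior p n"
  let ?\<delta> = "\<lambda>j. 1 / real (Suc j)"
  have [measurable]: "V \<in> sets borel" using assms(1) by auto
  have L [measurable]: "L \<in> sets (Rn n)" unfolding L_def by measurable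
  note AE\<sigma> = AE_surface_measure_nonzero and AE\<mu> = AE_sphere_law_nonzero[OF p0 n1]
  have AE\<sigma>': "AE x in surface_measure p n. x \<in> lp_sphere p n" and AE\<mu>': "AE x in sphere_law p n. x \<in> lp_sphere p n"
    using AE\<sigma> AE\<mu> by auto
  have half: "eventually (\<lambda>j. ennreal (1 / 2) \<le> emeasure m (?S (2 * (?\<delta> j / 2)))) at_top"
    if m: "prob_space m" "sets m = sets (Rn n)" "AE x in m. x \<in> lp_sphere p n \<and> (\<forall>i\<in>{1..n}. x i \<noteq> 0)" for m
  proof -
    interpret m: prob_space m by fact
    have sp: "space m = space (Rn n)" using m(2) by (rule sets_eq_imp_space_eq)
    have "(\<lambda>j. measure m (?S (?\<delta> j) \<inter> space (Rn n))) \<longlonglongrightarrow> measure m (space (Rn n))"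
      using m by (intro prob_sphere_interior_limit) auto
    moreover have "?S (?\<delta> j) \<inter> space (Rn n) = ?S (?\<delta> j)" for j
      by (auto simp: sphere_interior_def lp_sphere_def)
    ultimately have "(\<lambda>j. measure m (?S (?\<delta> j))) \<longlonglongrightarrow> 1"
      using m.prob_space by (simp add: sp)
    then have "eventually (\<lambda>j. 1 / 2 < measure m (?S (?\<delta> j))) at_top"
      by (rule order_tendstoD) simp
    then show ?thesis
    proof eventually_elim
      case (elim j)
      have eq: "2 * (?\<delta> j / 2) = ?\<delta> j" by (simp add: field_simps)
      show ?case unfolding eq m.emeasure_eq_measure using elim by (intro ennreal_leI) simp
    qed
  qed
  let ?K = "ennreal (8 * (real n ^ 2 + 4))"
  have K: "0 < ?K" "?K < \<infinity>" by (simp_all add: add_nonneg_pos)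
  have \<kappa>: "2 * ?K * ?K * ?K = ennreal \<kappa>" "\<kappa> > 0"
  proof -
    have "2 * ennreal k * ennreal k * ennreal k = ennreal (2 * k ^ 3)" if "k \<ge> 0" for k
      using that by (simp add: power3_eq_cube ennreal_mult mult.assoc)
    from this[of "8 * (real n ^ 2 + 4)"] show "2 * ?K * ?K * ?K = ennreal \<kappa>"
      unfolding \<kappa>_def by simp
    show "\<kappa> > 0" unfolding \<kappa>_def by (intro mult_pos_pos zero_less_power) (simp_all add: add_nonneg_pos)
  qed
  have inner: "eventually (\<lambda>j. measure (surface_measure p n) (?S (?\<delta> j / 2) \<inter> L) \<le> \<kappa> * measure (sphere_law p n) (?S (?\<delta> j / 2) \<inter> L) \<and>
      measure (sphere_law p n) (?S (?\<delta> j / 2) \<inter> L) \<le> \<kappa> * measure (surface_measure p n) (?S (?\<delta> j / 2) \<inter> L)) at_top"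
    using half[OF prob sets_surface_measure AE\<sigma>] half[OF \<mu>.prob_space_axioms sets_sphere_law AE\<mu>]
  proof eventually_elim
    case (elim j)
    let ?d = "?\<delta> j / 2"
    have d: "?d > 0" by simp
    obtain r1 where r1: "r1 > 0" "\<And>x y r. x \<in> ?S ?d \<Longrightarrow> y \<in> ?S ?d \<Longrightarrow> 0 < r \<Longrightarrow> r < r1 \<Longrightarrow>
      emeasure (surface_measure p n) (euclid_ball n x r) \<le> ?K * emeasure (surface_measure p n) (euclid_ball n y r)"
      using surface_measure_patch[OF d] by blast
    obtain r2 where r2: "r2 > 0" "\<And>x y r. x \<in> ?S ?d \<Longrightarrow> y \<in> ?S ?d \<Longrightarrow> 0 < r \<Longrightarrow> r < r2 \<Longrightarrow>
      emeasure (sphere_law p n) (euclid_ball n x r) \<le> ?K * emeasure (sphere_law p n) (euclid_ball n y r)"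
      using sphere_law_patch[OF d] by blast
    define r0 where "r0 = min (min r1 r2) ?d"
    have r0: "0 < r0" "r0 \<le> r1" "r0 \<le> r2" "r0 \<le> ?d" using r1(1) r2(1) d by (auto simp: r0_def)
    let ?U = "?S ?d \<inter> L"
    have U: "?U \<in> sets (Rn n)" "?U \<subseteq> ?S ?d" by auto
    have op: "\<exists>\<rho>>0. euclid_ball n x \<rho> \<inter> lp_sphere p n \<subseteq> ?U" if "x \<in> ?U" for x
    proof -
      have "{x \<in> ?S ?d. mean_ratio p n x \<in> V} = ?U"
        by (auto simp: L_def sphere_interior_def lp_sphere_def)
      then show ?thesis
        using mean_ratio_level_open[OF p0 n1 d assms(1), of x] that by auto
    qed
    have pos\<mu>: "0 < emeasure (sphere_law p n) (euclid_ball n x r)" if "x \<in> ?S ?d" "0 < r" for x r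
      using that p0 n1 by (intro sphere_law_ball_pos) (auto simp: sphere_interior_def)
    \<comment> \<open>That surface balls have positive mass is not evident from the Hausdorff
      measure; it is inherited from the cone measure through the comparison of balls.\<close>
    have pos\<sigma>: "0 < emeasure (surface_measure p n) (euclid_ball n x r)" if x: "x \<in> ?S ?d" and r: "0 < r" "r < r0" for x r
    proof -
      have "emeasure (sphere_law p n) (euclid_ball n x r) \<le> 2 * ?K * ?K * emeasure (surface_measure p n) (euclid_ball n x r)"
        using \<mu>.prob_space_axioms sets_sphere_law AE\<mu>' prob sets_surface_measure
        by (rule ball_mass_comparison[where \<delta> = ?d]) (use r1 r2 r r0 elim d x in auto)
      with pos\<mu>[OF x r(1)] show ?thesis
        by (auto simp: zero_less_iff_neq_zero)
    qed
    have "emeasure (surface_measure p n) ?U \<le> 2 * ?K * ?K * ?K * emeasure (sphere_law p n) ?U"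
      using prob sets_surface_measure AE\<sigma>' \<mu>.prob_space_axioms sets_sphere_law AE\<mu>'
      by (rule open_set_comparison[where \<delta> = ?d and ?r0.0 = r0]) (use r1 r2 r0 K elim U op pos\<sigma> in auto)
    moreover have "emeasure (sphere_law p n) ?U \<le> 2 * ?K * ?K * ?K * emeasure (surface_measure p n) ?U"
      using \<mu>.prob_space_axioms sets_sphere_law AE\<mu>' prob sets_surface_measure AE\<sigma>'
      by (rule open_set_comparison[where \<delta> = ?d and ?r0.0 = r0]) (use r1 r2 r0 K elim U op pos\<mu> in auto)
    ultimately show ?case
      unfolding \<kappa>(1) \<sigma>.emeasure_eq_measure \<mu>.emeasure_eq_measure using \<kappa>(2) by (simp flip: ennreal_mult)
  qed
  have lim: "(\<lambda>j. measure m (?S (?\<delta> j / 2) \<inter> L)) \<longlonglongrightarrow> measure m L"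
    if m: "prob_space m" "sets m = sets (Rn n)" "AE x in m. x \<in> lp_sphere p n \<and> (\<forall>i\<in>{1..n}. x i \<noteq> 0)" for m
  proof -
    \<comment> \<open>The halved cut-offs form the subsequence with index 2j + 1.\<close>
    have "(\<lambda>j. measure m (?S (?\<delta> (2 * j + 1)) \<inter> L)) \<longlonglongrightarrow> measure m L"
      using prob_sphere_interior_limit[OF m L] by (rule LIMSEQ_subseq_LIMSEQ[unfolded o_def]) (auto simp: strict_mono_def)
    moreover have "?\<delta> (2 * j + 1) = ?\<delta> j / 2" for j by (simp add: field_simps)
    ultimately show ?thesis by (simp only:)
  qed
  note l1 = lim[OF prob sets_surface_measure AE\<sigma>] and l2 = lim[OF \<mu>.prob_space_axioms sets_sphere_law AE\<mu>]
  show "measure (surface_measure p n) L \<le> \<kappa> * measure (sphere_law p n) L"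
    by (rule tendsto_le[OF sequentially_bot tendsto_mult_left[OF l2] l1]) (use inner in \<open>auto elim: eventually_mono\<close>)
  show "measure (sphere_law p n) L \<le> \<kappa> * measure (surface_measure p n) L"
    by (rule tendsto_le[OF sequentially_bot tendsto_mult_left[OF l1] l2]) (use inner in \<open>auto elim: eventually_mono\<close>)
qed

end

text \<open>Outer regularity of m2 supplies an open superset of nearly the same m2-mass. It is
  applied to the laws of the ratio, so regularity on the real line is enough.\<close>

lemma measure_le_of_open:
  fixes m1 m2 :: "real measure"
  assumes "prob_space m1" "sets m1 = sets borel" "prob_space m2" "sets m2 = sets borel"
    and "\<kappa> \<ge> 0" and le: "\<And>V. open V \<Longrightarrow> measure m1 V \<le> \<kappa> * measure m2 V"
    and A: "A \<in> sets borel"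
  shows "measure m1 A \<le> \<kappa> * measure m2 A"
proof -
  interpret m1: prob_space m1 by fact
  interpret m2: prob_space m2 by fact
  show ?thesis
  proof (rule field_le_epsilon)
    fix e :: real assume e: "e > 0"
    \<comment> \<open>Dividing by \<open>\<kappa> + 1\<close> also covers \<kappa> = 0.\<close>
    define d where "d = e / (\<kappa> + 1)"
    have d: "d > 0" "\<kappa> * d \<le> e" using e assms(5) by (auto simp: d_def field_simps)
    have "(INF V\<in>{V. A \<subseteq> V \<and> open V}. emeasure m2 V) = emeasure m2 A"
      using A by (intro outer_regular[symmetric]) (auto simp: assms(4))
    also have "\<dots> < ennreal (measure m2 A + d)"
      unfolding m2.emeasure_eq_measure using d by (intro ennreal_lessI) (auto simp: add_nonneg_pos)
    finally obtain V where V: "A \<subseteq> V" "open V" "emeasure m2 V < ennreal (measure m2 A + d)"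
      by (auto simp: INF_less_iff)
    have "measure m1 A \<le> measure m1 V" using V assms(2) by (intro m1.finite_measure_mono) auto
    also have "\<dots> \<le> \<kappa> * measure m2 V" using V(2) by (rule le)
    also have "\<dots> \<le> \<kappa> * (measure m2 A + d)"
      using V(3) assms(5) by (intro mult_left_mono) (auto simp: m2.emeasure_eq_measure ennreal_less_iff)
    also have "\<dots> \<le> \<kappa> * measure m2 A + e" using d by (simp add: distrib_left)
    finally show "measure m1 A \<le> \<kappa> * measure m2 A + e" .
  qed
qed

lemma surface_comparison:
  assumes "1 \<le> p" "2 \<le> n" and prob: "prob_space (surface_measure p n)" and [measurable]: "A \<in> sets borel"
  defines "P \<equiv> measure (surface_measure p n) {x \<in> space (Rn n). mean_ratio p n x \<in> A}"
    and "\<kappa> \<equiv> 2 * (8 * (real n ^ 2 + 4)) ^ 3"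
  shows "P \<le> \<kappa> * ball_prob p n A" "ball_prob p n A \<le> \<kappa> * P"
proof -
  have p0: "p > 0" and n1: "n \<ge> 1" using assms by simp_all
  interpret \<sigma>: prob_space "surface_measure p n" by (rule prob)
  interpret \<mu>: prob_space "sphere_law p n" using p0 n1 by (rule prob_space_sphere_law)
  note s = sets_surface_measure[OF prob assms(1,2)] space_surface_measure[OF prob assms(1,2)]
  note [measurable_cong] = s(1)
  have R [measurable]: "mean_ratio p n \<in> surface_measure p n \<rightarrow>\<^sub>M borel" by measurable
  let ?\<sigma> = "distr (surface_measure p n) borel (mean_ratio p n)"
  let ?\<mu> = "distr (sphere_law p n) borel (mean_ratio p n)"
  have eq: "measure ?\<sigma> V = measure (surface_measure p n) {x \<in> space (Rn n). mean_ratio p n x \<in> V}"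
    "measure ?\<mu> V = measure (sphere_law p n) {x \<in> space (Rn n). mean_ratio p n x \<in> V}" if "V \<in> sets borel" for V
    using that by (simp_all add: measure_distr s vimage_def Int_def conj_commute)
  have \<kappa>: "\<kappa> \<ge> 0" unfolding \<kappa>_def by (intro mult_nonneg_nonneg zero_le_power) auto
  have \<sigma>': "prob_space ?\<sigma>" "sets ?\<sigma> = sets borel" and \<mu>': "prob_space ?\<mu>" "sets ?\<mu> = sets borel"
    by (simp_all add: \<sigma>.prob_space_distr \<mu>.prob_space_distr)
  have open_le: "measure ?\<sigma> V \<le> \<kappa> * measure ?\<mu> V" "measure ?\<mu> V \<le> \<kappa> * measure ?\<sigma> V" if "open V" for V
    using surface_open_comparison[OF prob assms(1,2) that] eq[of V] that by (simp_all add: \<kappa>_def)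
  have "measure ?\<sigma> A \<le> \<kappa> * measure ?\<mu> A"
    using \<sigma>' \<mu>' \<kappa> open_le(1) assms(4) by (rule measure_le_of_open)
  moreover have "measure ?\<mu> A \<le> \<kappa> * measure ?\<sigma> A"
    using \<mu>' \<sigma>' \<kappa> open_le(2) assms(4) by (rule measure_le_of_open)
  ultimately show "P \<le> \<kappa> * ball_prob p n A" "ball_prob p n A \<le> \<kappa> * P"
    using p0 n1 by (simp_all add: eq P_def sphere_law_mean_ratio)
qed

text \<open>Since the ratio is invariant under scaling, the segments from the origin to the points
  of the sphere with ratio in A fill exactly the points of the ball with ratio in A, except possibly
  for the origin.\<close>

lemma cone_measure_mean_ratio:
  assumes "p > 0" "n \<ge> 1" and prob: "prob_space (cone_measure p n)" and A[measurable]: "A \<in> sets borel"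
  shows "measure (cone_measure p n) {x \<in> space (Rn n). mean_ratio p n x \<in> A} = ball_prob p n A"
proof -
  let ?E = "{x \<in> space (Rn n). mean_ratio p n x \<in> A}"
  define C where "C = {(\<lambda>i\<in>{1..n}. r * x i) | r x. x \<in> ?E \<inter> lp_sphere p n \<and> r \<in> {0..1}}"
  let ?D = "{z \<in> space (Rn n). lp_norm p n z \<le> 1 \<and> mean_ratio p n z \<in> A}"
  let ?o = "\<lambda>i\<in>{1..n}. 0 :: real"
  have scale: "(\<lambda>i\<in>{1..n}. r * x i) = affine_Rn n (\<lambda>_. 0) r x" for r x
    by (auto simp: affine_Rn_def)
  have norm0: "z = ?o" if "z \<in> space (Rn n)" "\<not> lp_norm p n z > 0" for z
  proof -
    have "(\<Sum>i\<in>{1..n}. \<bar>z i\<bar> powr p) = 0"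
      using that(2) by (auto simp: lp_norm_def)
    then have "\<forall>i\<in>{1..n}. z i = 0"
      by (simp add: sum_nonneg_eq_0_iff)
    then show ?thesis using that(1) by (auto simp: space_Rn extensional_def fun_eq_iff)
  qed
  have C_iff: "z \<in> C \<longleftrightarrow> z \<in> ?D" if z: "z \<in> space (Rn n)" "z \<noteq> ?o" for z
  proof
    assume "z \<in> C"
    then obtain r x where rx: "z = affine_Rn n (\<lambda>_. 0) r x" "x \<in> ?E" "x \<in> lp_sphere p n" "0 \<le> r" "r \<le> 1"
      by (auto simp: C_def scale)
    have "r \<noteq> 0" using z(2) rx(1) by (auto simp: affine_Rn_def)
    with rx assms show "z \<in> ?D"
      using z(1) by (simp add: lp_norm_affine_0 mean_ratio_affine_0 lp_sphere_def)
  next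
    assume D: "z \<in> ?D"
    have pos: "lp_norm p n z > 0" using norm0[OF z(1)] z(2) by blast
    have "lp_normalize p n z \<in> ?E \<inter> lp_sphere p n"
      using D pos assms lp_normalize_in_sphere[OF assms(1) pos]
      by (simp add: mean_ratio_affine_0[of "1 / lp_norm p n z" p n] lp_normalize_eq_affine[of p n z]) (simp add: affine_Rn_def space_Rn)
    moreover have "z = (\<lambda>i\<in>{1..n}. lp_norm p n z * lp_normalize p n z i)"
      using pos z(1) by (auto simp: lp_normalize_def space_Rn extensional_def fun_eq_iff)
    ultimately show "z \<in> C"
      unfolding C_def using D pos by force
  qed
  have o_sets: "{?o} \<in> sets (Rn n)"
  proof -
    have "{?o} = {z \<in> space (Rn n). lp_norm p n z \<le> 0}"
      using norm0 by (auto simp: space_Rn lp_norm_def)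
    also have "\<dots> \<in> sets (Rn n)" by measurable
    finally show ?thesis .
  qed
  \<comment> \<open>As a union of segments, C is not obviously measurable; up to the origin it is a
    measurable set. The origin is split off because it lies in C through r = 0, whereas its own
    ratio is the default value 0.\<close>
  have C_eq: "C = (?D - {?o}) \<union> (C \<inter> {?o})"
    using C_iff by (auto simp: C_def space_Rn)
  have 1: "C \<inter> {?o} \<in> sets (Rn n)"
    using o_sets by (cases "?o \<in> C") auto
  have 2: "?D - {?o} \<in> sets (Rn n)" using o_sets by (intro sets.Diff) measurable
  from sets.Un[OF 2 1] have C_sets: "C \<in> sets (Rn n)" unfolding C_eq[symmetric] .
  have "emeasure (cone_measure p n) ?E = emeasure (Rn n) C / emeasure (Rn n) (lp_ball p n)"
    unfolding C_def
  proof (rule emeasure_measure_of_total[OF cone_measure_def])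
    show "emeasure (cone_measure p n) (space (cone_measure p n)) \<noteq> 0"
      using prob_space.emeasure_space_1[OF prob] by simp
  qed measurable
  also have "emeasure (Rn n) C = emeasure (Rn n) ?D"
  proof (rule emeasure_eq_AE)
    show "AE z in Rn n. (z \<in> C) = (z \<in> ?D)"
      using AE_Rn_component_nonzero[of n] AE_space
    proof eventually_elim
      case (elim z)
      then have "z \<noteq> ?o" using assms(2) by force
      with elim show ?case by (intro C_iff)
    qed
  qed (use C_sets in measurable)
  also have "?D = lp_ball p n \<inter> ?E" by (auto simp: lp_ball_def)
  also have "emeasure (Rn n) (lp_ball p n \<inter> ?E) / emeasure (Rn n) (lp_ball p n) = emeasure (uniform_lp_ball p n) ?E"
    unfolding uniform_lp_ball_def by (rule emeasure_uniform_measure[symmetric]) measurable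
  finally show ?thesis by (simp add: ball_prob_def measure_def)
qed

theorem mainTheorem3:
  fixes p :: real
    and M :: "nat \<Rightarrow> 'w measure"
    and X :: "nat \<Rightarrow> 'w \<Rightarrow> nat \<Rightarrow> real"
    and A :: "real set"
  assumes "1 \<le> p"
    and "\<And>n. 1 \<le> n \<Longrightarrow> prob_space (M n)"
    and "\<And>n. 1 \<le> n \<Longrightarrow> X n \<in> M n \<rightarrow>\<^sub>M Rn n"
    and "\<And>n. 1 \<le> n \<Longrightarrow>
           distr (M n) (Rn n) (X n) = uniform_lp_ball p n \<or>
           distr (M n) (Rn n) (X n) = cone_measure p n \<or>
           distr (M n) (Rn n) (X n) = surface_measure p n"
    and "A \<in> sets borel"
  shows "- (INF \<theta>\<in>interior A. rate_fun p \<theta>)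
           \<le> liminf (\<lambda>n. ereal (1 / real n) *
               elog (measure (M n) {\<omega> \<in> space (M n). mean_ratio p n (X n \<omega>) \<in> A})) \<and>
         liminf (\<lambda>n. ereal (1 / real n) *
               elog (measure (M n) {\<omega> \<in> space (M n). mean_ratio p n (X n \<omega>) \<in> A}))
           \<le> limsup (\<lambda>n. ereal (1 / real n) *
               elog (measure (M n) {\<omega> \<in> space (M n). mean_ratio p n (X n \<omega>) \<in> A})) \<and>
         limsup (\<lambda>n. ereal (1 / real n) *
               elog (measure (M n) {\<omega> \<in> space (M n). mean_ratio p n (X n \<omega>) \<in> A}))
           \<le> - (INF \<theta>\<in>closure A. rate_fun p \<theta>)"
proof -
  have p0: "p > 0" using assms(1) by simp
  define \<kappa> where "\<kappa> = (\<lambda>n. 2 * (8 * (real n ^ 2 + 4)) ^ 3)"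
  define P where "P = (\<lambda>n. measure (M n) {\<omega> \<in> space (M n). mean_ratio p n (X n \<omega>) \<in> A})"
  \<comment> \<open>With \<kappa> at least 1, one factor also serves the ball and the cone, where
    the probabilities are equal.\<close>
  have \<kappa>1: "\<kappa> n \<ge> 1" for n
  proof -
    have "1 \<le> 2 * k ^ 3" if "1 \<le> k" for k :: real
      using one_le_power[OF that, of 3] by simp
    then show ?thesis unfolding \<kappa>_def by this simp
  qed
  \<comment> \<open>Dimensions below 2 do not influence the limits.\<close>
  have comparison: "P n \<le> \<kappa> n * ball_prob p n A \<and> ball_prob p n A \<le> \<kappa> n * P n" if n: "n \<ge> 2" for n
  proof -
    have n1: "n \<ge> 1" using n by simp
    let ?D = "distr (M n) (Rn n) (X n)"
    have X [measurable]: "X n \<in> M n \<rightarrow>\<^sub>M Rn n" using n1 by (rule assms(3))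
    have [measurable]: "A \<in> sets borel" by fact
    interpret prob_space "M n" using n1 by (rule assms(2))
    have D: "prob_space ?D" using X by (rule prob_space_distr)
    have P: "P n = measure ?D {x \<in> space (Rn n). mean_ratio p n x \<in> A}"
      unfolding P_def using measurable_space[OF X]
      by (subst measure_distr) (auto intro!: arg_cong[where f = "measure (M n)"])
    have "P n \<le> \<kappa> n * P n" "ball_prob p n A \<ge> 0"
      using mult_right_mono[OF \<kappa>1[of n], of "P n"] by (simp_all add: P_def ball_prob_def)
    consider "?D = uniform_lp_ball p n" | "?D = cone_measure p n" | "?D = surface_measure p n"
      using assms(4)[OF n1] by blast
    then show ?thesis
    proof cases
      case 1
      then have "P n = ball_prob p n A" by (simp add: P ball_prob_def)
      then show ?thesis using \<open>P n \<le> \<kappa> n * P n\<close> by simp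
    next
      case 2
      then have "P n = ball_prob p n A"
        using D p0 n1 by (simp add: P cone_measure_mean_ratio assms(5))
      then show ?thesis using \<open>P n \<le> \<kappa> n * P n\<close> by simp
    next
      case 3
      then show ?thesis
        using D surface_comparison[OF assms(1) n _ assms(5)] by (simp add: P \<kappa>_def)
    qed
  qed
  have \<kappa>_lim: "(\<lambda>n. ln (\<kappa> n) / real n) \<longlonglongrightarrow> 0"
    unfolding \<kappa>_def by real_asymp
  have \<kappa>_pos: "eventually (\<lambda>n. \<kappa> n > 0) at_top"
    using \<kappa>1 by (intro always_eventually allI) (rule less_le_trans[OF zero_less_one])
  have le: "eventually (\<lambda>n. P n \<le> \<kappa> n * ball_prob p n A) at_top"
    and ge: "eventually (\<lambda>n. ball_prob p n A \<le> \<kappa> n * P n) at_top"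
    using eventually_ge_at_top[of 2] by (eventually_elim, use comparison in blast)+
  show ?thesis
    using ldp_of_comparison[OF p0 assms(5) \<kappa>_lim \<kappa>_pos le ge] Liminf_le_Limsup[OF sequentially_bot]
    unfolding P_def by blast
qed

end
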